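(* Let $\sigma>0$, $b\in\mathbb{R}^d$, and let $H$ be the RKHS on $\mathbb{R}^d$ of the kernel $k(x,y)=e^{(x-b)^\top(y-b)/\sigma^2}$ or of the kernel $k(x,y)=e^{-\|x-y\|^2/2\sigma^2}$. Let $f:\mathbb{R}^d\to\mathbb{R}^d$ be of class $C^\infty$ with $C_f$ densely defined on $H$, and let $p\in\mathbb{R}^d$ with $f(p)=p$ and $V_p\subset D(C_f)$. Let $m,n\ge0$ be integers with $m\le n$. Let $\mu=\rho(x)\,\mathrm{d}x$ be a Borel probability measure on $\mathbb{R}^d$, where $\rho:\mathbb{R}^d\to\mathbb{R}_{\ge0}$ is measurable and compactly supported, and suppose there is a rectangle $R(a,r)=\prod_{i=1}^d[a_i-r_i,a_i+r_i]$ with $a_i\in\mathbb{R}$, $r_i>0$, such that $\operatorname{ess\,inf}_{x\in R(a,r)}\rho(x)>0$. Let $x_1,\dots,x_N$ be i.i.d. random variables with law $\mu$ and $y_i=f(x_i)$; assume $r_n\le N$ and that $\pi_nk_{x_1},\dots,\pi_nk_{x_N}$ span $V_{p,n}$. Assume also that the elements of $V_{p,n}$ are square integrable with respect to $\mu$ and that the natural map $V_{p,n}\to L^2(\mu)$ is injective. Set $$B_1:=\sup_{x\in\mathrm{supp}(\rho)}\|x-p\|,\qquad B_2:=\sup_{i=1,\dots,d}\Big(1+\frac{|a_i-p_i|}{r_i}\Big).$$ Then there exists a constant $C>0$ independent of $n$ such that, almost everywhere (almost surely), $$\limsup_{N\to\infty}\big\|\mathbf{C}_{f,m}^\star-\widehat{\mathbf{C}}_{m,n,N}\big\|\le\frac{C\,n^{m+d}}{\sqrt{(n+1)!}}\Big(\frac{2B_1B_2}{\sigma}\Big)^n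 .$$
   Context: Conventions: $k_x:=k(x,\cdot)\in H$, $\langle h,k_x\rangle_H=h(x)$. $C_fh:=h\circ f$ on $D(C_f)=\{h\in H:h\circ f\in H\}$; $C_f^*$ is its adjoint. $V_{p,n}:=\mathrm{span}\{\partial_x^\alpha k(x,\cdot)|_{x=p}:|\alpha|\le n\}\subset H$, $V_p:=\bigcup_nV_{p,n}$, $r_n:=\dim V_{p,n}$ $(=\binom{n+d}{d})$, and $\pi_n:H\to V_{p,n}$ is the orthogonal projection; $C_f^*$ maps $V_{p,n}$ into itself because $f(p)=p$. Fix a basis $\{v_i\}_{i\ge1}$ of $V_p$ such that, for each $n$, $\{v_1,\dots,v_{r_n}\}$ is a basis of $V_{p,n}$ and an orthogonal system in $H$. Put $\mathbf{v}_n(x):=(\overline{v_i(x)})_{i=1}^{r_n}$, $\mathbf{G}_n:=(\langle v_i,v_j\rangle_H)_{i,j=1}^{r_n}$, and $\mathbf{V}_n^X:=(\mathbf{v}_n(x_1),\dots,\mathbf{v}_n(x_N))\in\mathbb{C}^{r_n\times N}$ for $X=(x_1,\dots,x_N)$. With $X_N=(x_1,\dots,x_N)$, $Y_N=(y_1,\dots,y_N)$, the matrix $\widehat{\mathbf{C}}_{m,n,N}\in\mathbb{C}^{r_m\times r_m}$ consists of the first $r_m$ columns of $\mathbf{G}_m^{-1}\mathbf{V}_m^{Y_N}(\mathbf{V}_n^{X_N})^\dagger\mathbf{G}_n$ ($\dagger$ = Moore–Penrose pseudo-inverse). $\mathbf{C}_{f,m}^\star$ is the matrix of $C_f^*|_{V_{p,m}}$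 in the basis $\{v_1,\dots,v_{r_m}\}$. $\|\cdot\|$ on matrices is the Frobenius norm.
   Formalization: The formal theorem takes n ≥ 1 (with 0 ≤ m ≤ n) instead of n ≥ 0, since for m = n = 0 the stated bound is 0 and fails, e.g. for the Gaussian kernel with d = 1, p = 0, f(x) = x/2. *)

theory Defs
  imports
    "HOL-Probability.Probability"
    "HOL-Library.Function_Algebras"
    "Jordan_Normal_Form.Schur_Decomposition"
begin

hide_const (open) Matrix.mat Finite_Cartesian_Product.mat
no_notation Matrix.vec_index (infixl \<open>$\<close> 100)

definition cscale :: "complex \<Rightarrow> ('a \<Rightarrow> complex) \<Rightarrow> 'a \<Rightarrow> complex" where
  "cscale c h = (\<lambda>x. c * h x)"

global_interpretation cfun: vector_space "cscale :: complex \<Rightarrow> ('a \<Rightarrow> complex) \<Rightarrow> 'a \<Rightarrow> complex"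
  defines csubspace = cfun.subspace
    and cspan = cfun.span
    and cindependent = "\<lambda>B. \<not> cfun.dependent B"
    and cdim = cfun.dim
    and crepresentation = cfun.representation
  by unfold_locales (auto simp: cscale_def fun_eq_iff algebra_simps)

definition hnorm :: "(('a \<Rightarrow> complex) \<Rightarrow> ('a \<Rightarrow> complex) \<Rightarrow> complex) \<Rightarrow> ('a \<Rightarrow> complex) \<Rightarrow> real" where
  "hnorm ip h = sqrt (Re (ip h h))"

text \<open>The inner product is linear in the first argument. Its values outside \<open>H\<close> are irrelevant.\<close>

locale hilbert_function_space =
  fixes H :: "('a \<Rightarrow> complex) set"
    and ip :: "('a \<Rightarrow> complex) \<Rightarrow> ('a \<Rightarrow> complex) \<Rightarrow> complex"
  assumes subspace: "csubspace H"
    and ip_add: "\<lbrakk>g \<in> H; h \<in> H; u \<in> H\<rbrakk> \<Longrightarrow> ip (g + h) u = ip g u + ip h u"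
    and ip_scale: "\<lbrakk>g \<in> H; u \<in> H\<rbrakk> \<Longrightarrow> ip (cscale c g) u = c * ip g u"
    and ip_cnj: "\<lbrakk>g \<in> H; h \<in> H\<rbrakk> \<Longrightarrow> ip h g = cnj (ip g h)"
    and ip_nonneg: "h \<in> H \<Longrightarrow> 0 \<le> Re (ip h h)"
    and ip_definite: "\<lbrakk>h \<in> H; ip h h = 0\<rbrakk> \<Longrightarrow> h = 0"
    and complete:
      "\<lbrakk>\<And>j. s j \<in> H; \<And>e. e > 0 \<Longrightarrow> \<exists>J. \<forall>i\<ge>J. \<forall>j\<ge>J. hnorm ip (s i - s j) < e\<rbrakk>
        \<Longrightarrow> \<exists>h\<in>H. (\<lambda>j. hnorm ip (s j - h)) \<longlonglongrightarrow> 0"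

text \<open>By the Moore-Aronszajn theorem a positive definite kernel \<open>k\<close> determines \<open>H\<close>, and \<open>ip\<close>
  on \<open>H\<close>, uniquely. The section \<open>k x\<close> is the function \<open>y \<mapsto> k(x,y)\<close>.\<close>

locale rkhs = hilbert_function_space H ip
  for H :: "('a \<Rightarrow> complex) set"
    and ip :: "('a \<Rightarrow> complex) \<Rightarrow> ('a \<Rightarrow> complex) \<Rightarrow> complex" +
  fixes k :: "'a \<Rightarrow> 'a \<Rightarrow> complex"
  assumes kernel_mem: "k x \<in> H"
    and reproducing: "h \<in> H \<Longrightarrow> ip h (k x) = h x"

definition exp_kernel :: "real \<Rightarrow> real ^ 'd \<Rightarrow> real ^ 'd \<Rightarrow> real ^ 'd \<Rightarrow> complex" where
  "exp_kernel \<sigma> b x y = of_real (exp ((x - b) \<bullet> (y - b) / \<sigma>\<^sup>2))"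

definition gauss_kernel :: "real \<Rightarrow> real ^ 'd \<Rightarrow> real ^ 'd \<Rightarrow> complex" where
  "gauss_kernel \<sigma> x y = of_real (exp (- (norm (x - y))\<^sup>2 / (2 * \<sigma>\<^sup>2)))"

text \<open>Orthogonal projection of \<open>h\<close> onto \<open>V\<close>; it exists and is unique if \<open>V\<close> is a finite-dimensional
  subspace of \<open>H\<close>.\<close>

definition oproj ::
  "(('a \<Rightarrow> complex) \<Rightarrow> ('a \<Rightarrow> complex) \<Rightarrow> complex) \<Rightarrow> ('a \<Rightarrow> complex) set \<Rightarrow> ('a \<Rightarrow> complex) \<Rightarrow> 'a \<Rightarrow> complex"
  where "oproj ip V h = (THE u. u \<in> V \<and> (\<forall>w\<in>V. ip (h - u) w = 0))"

definition comp_domain :: "('a \<Rightarrow> complex) set \<Rightarrow> ('a \<Rightarrow> 'a) \<Rightarrow> ('a \<Rightarrow> complex) set" where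
  "comp_domain H f = {h \<in> H. h \<circ> f \<in> H}"

definition comp_densely_defined ::
  "('a \<Rightarrow> complex) set \<Rightarrow> (('a \<Rightarrow> complex) \<Rightarrow> ('a \<Rightarrow> complex) \<Rightarrow> complex) \<Rightarrow> ('a \<Rightarrow> 'a) \<Rightarrow> bool" where
  "comp_densely_defined H ip f \<longleftrightarrow>
     (\<forall>h\<in>H. \<forall>e>0. \<exists>g\<in>comp_domain H f. hnorm ip (h - g) < e)"

text \<open>The value \<open>C\<^sub>f\<^sup>* g\<close>; when \<open>C\<^sub>f\<close> is densely defined there is at most one such \<open>u\<close>, and there is
  one exactly when \<open>g\<close> lies in the domain of the adjoint.\<close>

definition comp_adjoint ::
  "('a \<Rightarrow> complex) set \<Rightarrow> (('a \<Rightarrow> complex) \<Rightarrow> ('a \<Rightarrow> complex) \<Rightarrow> complex) \<Rightarrow> ('a \<Rightarrow> 'a)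
    \<Rightarrow> ('a \<Rightarrow> complex) \<Rightarrow> 'a \<Rightarrow> complex" where
  "comp_adjoint H ip f g = (THE u. u \<in> H \<and> (\<forall>h\<in>comp_domain H f. ip (h \<circ> f) g = ip h u))"

definition partial_deriv :: "'d \<Rightarrow> (real ^ 'd \<Rightarrow> 'b::real_normed_vector) \<Rightarrow> real ^ 'd \<Rightarrow> 'b" where
  "partial_deriv i F x = vector_derivative (\<lambda>t. F (x + t *\<^sub>R axis i 1)) (at 0)"

text \<open>Iterated partial derivatives are indexed by the list of the directions of differentiation.
  For smooth functions the order of the list is immaterial, so a list \<open>is\<close> stands for the
  multi-index \<open>\<alpha>\<close> with \<open>\<alpha>\<^sub>i = count_list is i\<close>, and \<open>|\<alpha>| = length is\<close>.\<close>

definition iter_partial :: "'d list \<Rightarrow> (real ^ 'd \<Rightarrow> 'b::real_normed_vector) \<Rightarrow> real ^ 'd \<Rightarrow> 'b" where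
  "iter_partial is F = foldr partial_deriv is F"

definition smooth :: "(real ^ 'd \<Rightarrow> 'b::real_normed_vector) \<Rightarrow> bool" where
  "smooth F \<longleftrightarrow>
     (\<forall>is. continuous_on UNIV (iter_partial is F) \<and>
        (\<forall>i x. (\<lambda>t. iter_partial is F (x + t *\<^sub>R axis i 1)) differentiable (at 0)))"

definition jet_space :: "(real ^ 'd \<Rightarrow> real ^ 'd \<Rightarrow> complex) \<Rightarrow> real ^ 'd \<Rightarrow> nat \<Rightarrow> (real ^ 'd \<Rightarrow> complex) set"
  where "jet_space k p n = cspan {(\<lambda>y. iter_partial is (\<lambda>x. k x y) p) | is. length is \<le> n}"

definition jet_space_all :: "(real ^ 'd \<Rightarrow> real ^ 'd \<Rightarrow> complex) \<Rightarrow> real ^ 'd \<Rightarrow> (real ^ 'd \<Rightarrow> complex) set"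
  where "jet_space_all k p = (\<Union>n. jet_space k p n)"

definition jet_dim :: "(real ^ 'd \<Rightarrow> real ^ 'd \<Rightarrow> complex) \<Rightarrow> real ^ 'd \<Rightarrow> nat \<Rightarrow> nat" where
  "jet_dim k p n = cdim (jet_space k p n)"

text \<open>Basis elements are indexed from \<open>0\<close>.\<close>

definition jet_basis ::
  "((real ^ 'd \<Rightarrow> complex) \<Rightarrow> (real ^ 'd \<Rightarrow> complex) \<Rightarrow> complex) \<Rightarrow> (real ^ 'd \<Rightarrow> real ^ 'd \<Rightarrow> complex)
    \<Rightarrow> real ^ 'd \<Rightarrow> (nat \<Rightarrow> real ^ 'd \<Rightarrow> complex) \<Rightarrow> bool" where
  "jet_basis ip k p v \<longleftrightarrow>
     inj v \<and> cindependent (range v) \<and> cspan (range v) = jet_space_all k p \<and>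
     (\<forall>n. cspan (v ` {..<jet_dim k p n}) = jet_space k p n \<and>
          (\<forall>i<jet_dim k p n. \<forall>j<jet_dim k p n. i \<noteq> j \<longrightarrow> ip (v i) (v j) = 0))"

definition frobenius_norm :: "complex mat \<Rightarrow> real" where
  "frobenius_norm A = sqrt (\<Sum>i<dim_row A. \<Sum>j<dim_col A. (cmod (A $$ (i, j)))\<^sup>2)"

text \<open>The unique solution of the four Penrose equations.\<close>

definition pinv :: "complex mat \<Rightarrow> complex mat" where
  "pinv A = (THE X. X \<in> carrier_mat (dim_col A) (dim_row A) \<and>
     A * X * A = A \<and> X * A * X = X \<and>
     mat_adjoint (A * X) = A * X \<and> mat_adjoint (X * A) = X * A)"

definition gram_mat ::
  "(('a \<Rightarrow> complex) \<Rightarrow> ('a \<Rightarrow> complex) \<Rightarrow> complex) \<Rightarrow> (nat \<Rightarrow> 'a \<Rightarrow> complex) \<Rightarrow> nat \<Rightarrow> complex mat" where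
  "gram_mat ip v r = Matrix.mat r r (\<lambda>(i, j). ip (v i) (v j))"

definition sample_mat :: "(nat \<Rightarrow> 'a \<Rightarrow> complex) \<Rightarrow> nat \<Rightarrow> nat \<Rightarrow> (nat \<Rightarrow> 'a) \<Rightarrow> complex mat" where
  "sample_mat v r N x = Matrix.mat r N (\<lambda>(i, j). cnj (v i (x j)))"

text \<open>\<open>jet_dmd ip k p v m n N x y\<close> consists of the first \<open>r\<^sub>m\<close> columns of
  \<open>G\<^sub>m\<^sup>-\<^sup>1 V\<^sub>m\<^sup>Y (V\<^sub>n\<^sup>X)\<^sup>\<dagger> G\<^sub>n\<close>, for the samples \<open>x\<^sub>0,\<dots>,x\<^sub>N\<^sub>-\<^sub>1\<close> and \<open>y\<^sub>0,\<dots>,y\<^sub>N\<^sub>-\<^sub>1\<close>.\<close>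

definition jet_dmd ::
  "((real ^ 'd \<Rightarrow> complex) \<Rightarrow> (real ^ 'd \<Rightarrow> complex) \<Rightarrow> complex) \<Rightarrow> (real ^ 'd \<Rightarrow> real ^ 'd \<Rightarrow> complex)
    \<Rightarrow> real ^ 'd \<Rightarrow> (nat \<Rightarrow> real ^ 'd \<Rightarrow> complex) \<Rightarrow> nat \<Rightarrow> nat \<Rightarrow> nat
    \<Rightarrow> (nat \<Rightarrow> real ^ 'd) \<Rightarrow> (nat \<Rightarrow> real ^ 'd) \<Rightarrow> complex mat" where
  "jet_dmd ip k p v m n N x y =
     (let rm = jet_dim k p m; rn = jet_dim k p n;
          A = the (mat_inverse (gram_mat ip v rm)) * sample_mat v rm N y
              * pinv (sample_mat v rn N x) * gram_mat ip v rn
      in Matrix.mat rm rm (\<lambda>(i, j). A $$ (i, j)))"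

text \<open>The matrix of the restriction of \<open>C\<^sub>f\<^sup>*\<close> to \<open>V\<^sub>p\<^sub>,\<^sub>m\<close>: column \<open>j\<close> holds the coordinates of
  \<open>C\<^sub>f\<^sup>* v\<^sub>j\<close>.\<close>

definition comp_adjoint_mat ::
  "(real ^ 'd \<Rightarrow> complex) set \<Rightarrow> ((real ^ 'd \<Rightarrow> complex) \<Rightarrow> (real ^ 'd \<Rightarrow> complex) \<Rightarrow> complex)
    \<Rightarrow> (real ^ 'd \<Rightarrow> real ^ 'd \<Rightarrow> complex) \<Rightarrow> real ^ 'd \<Rightarrow> (nat \<Rightarrow> real ^ 'd \<Rightarrow> complex)
    \<Rightarrow> (real ^ 'd \<Rightarrow> real ^ 'd) \<Rightarrow> nat \<Rightarrow> complex mat" where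
  "comp_adjoint_mat H ip k p v f m =
     (let r = jet_dim k p m
      in Matrix.mat r r (\<lambda>(i, j). crepresentation (v ` {..<r}) (comp_adjoint H ip f (v j)) (v i)))"

definition essinf_on :: "(real ^ 'd) set \<Rightarrow> (real ^ 'd \<Rightarrow> real) \<Rightarrow> ereal" where
  "essinf_on R \<rho> = - esssup (restrict_space lborel R) (\<lambda>x. - ereal (\<rho> x))"

definition rectangle :: "real ^ 'd \<Rightarrow> real ^ 'd \<Rightarrow> (real ^ 'd) set" where
  "rectangle a r = {x. \<forall>i. a $ i - r $ i \<le> x $ i \<and> x $ i \<le> a $ i + r $ i}"

text \<open>The support is the pointwise one. Changing \<open>\<rho>\<close> on a null set turns it into the essential
  support.\<close>

definition supp :: "(real ^ 'd \<Rightarrow> real) \<Rightarrow> (real ^ 'd) set" where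
  "supp \<rho> = closure {x. \<rho> x \<noteq> 0}"

end

(* Both kernels factor as k(x,y) = w(x) w(y) exp((x-p).(y-p)/sigma^2) with w > 0, and therefore V_{p,n}
   consists of the products of w with the polynomials of degree at most n. Expanding the exponential along
   rays gives |h(x)| <= |h|_H w(x) exp(c/2) sqrt(c^(n+1)/(n+1)!), c = |x-p|^2/sigma^2, for every h in H
   that is orthogonal to V_{p,n}. Hence h is orthogonal to V_{p,m} iff it vanishes to order m+1 at p; as f
   fixes p, composition with f preserves this condition, and so C_f^* maps V_{p,m} into itself.

   By the strong law of large numbers the estimator converges almost surely, and the (i,j) entry of the
   limiting error is, up to constants, <q_i, v_j>_H, where q_i is the L^2(mu)-projection to V_{p,n} of the
   part of v_i o f that is orthogonal to V_{p,n} in H. The L^2(mu)-norm of that part is controlled by the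
   estimate above. It remains to bound <wQ, v_j>_H by the L^2-norm of Q on the rectangle: expand Q in
   products of Chebyshev polynomials of the second kind, which are orthogonal for the weight
   prod sqrt(1 - t_i^2) <= 1, and bound <w U_alpha, v_j>_H by the coefficients of U_alpha at p. The
   recursion of the U_l shows that these grow at most like (2 B2)^|alpha|, while <w x^alpha, v_j>_H
   vanishes for |alpha| > m. *)

theory Submission
  imports Defs
begin

section \<open>Weighted polynomials in the reproducing kernel Hilbert space\<close>

text \<open>The inner product is known only through the reproducing property. Along a single ray
  from \<open>p\<close> the kernel sections form a one-parameter family with an explicit Gram
  function, and the metric information on \<open>H\<close> is drawn from there. Inner products of
  monomials in different directions are never computed: the orthogonality that is needed follows
  from the order of vanishing at \<open>p\<close>.

  The adjoint and the pseudo-inverse are defined as the unique objects with certain properties, so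
  each explicit formula comes with a uniqueness argument; for the adjoint this is where density of
  the domain of C_f enters.

  Origin of the constants: the Taylor remainder contributes the power \<open>n + 1\<close> of
  B1/sigma and the root of the factorial, and one factor B1/sigma goes into \<open>C\<close>.
  Returning from the L2 norm to \<open>H\<close> costs a factor 2 B2 per degree and one summand per
  multi-index, hence the power d of \<open>n\<close>. The constants for v_i and v_j serve all
  \<open>n\<close>, and only indices below r_m occur, so \<open>C\<close> depends on
  \<open>m\<close> but not on \<open>n\<close>.\<close>

lemma sum_fun_apply: "sum g A x = (\<Sum>i\<in>A. g i x)"
  for g :: "'i \<Rightarrow> 'a \<Rightarrow> 'b::comm_monoid_add"
  by (induct A rule: infinite_finite_induct) auto

section \<open>Sesquilinear calculus in a Hilbert space of functions\<close>

context hilbert_function_space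
begin

lemmas mem_zero = cfun.subspace_0[OF subspace]
  and mem_add = cfun.subspace_add[OF subspace]
  and mem_diff = cfun.subspace_diff[OF subspace]
  and mem_scale = cfun.subspace_scale[OF subspace]
  and mem_sum = cfun.subspace_sum[OF subspace]

lemma ip_zero_left: "u \<in> H \<Longrightarrow> ip 0 u = 0"
  using ip_scale[of u u 0] by (simp add: cscale_def zero_fun_def)

lemma ip_diff:
  assumes "g \<in> H" "h \<in> H" "u \<in> H" shows "ip (g - h) u = ip g u - ip h u"
  using ip_add[of "g - h" h u] assms mem_diff by simp

lemma ip_sum:
  assumes "\<And>i. i \<in> A \<Longrightarrow> g i \<in> H" "u \<in> H" shows "ip (\<Sum>i\<in>A. g i) u = (\<Sum>i\<in>A. ip (g i) u)"
  using assms
proof (induct A rule: infinite_finite_induct)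
  case (insert i A)
  then have "sum g A \<in> H" by (intro mem_sum) auto
  then have "ip (g i + sum g A) u = ip (g i) u + ip (sum g A) u"
    using insert by (intro ip_add) auto
  also have "ip (sum g A) u = (\<Sum>i\<in>A. ip (g i) u)" using insert by simp
  finally show ?case unfolding sum.insert[OF insert(1,2)] .
qed (auto simp: ip_zero_left)

lemma ip_diff_right:
  assumes "g \<in> H" "h \<in> H" "u \<in> H" shows "ip u (g - h) = ip u g - ip u h"
  using assms ip_diff[of g h u] ip_cnj[of "g - h" u] ip_cnj[of g u] ip_cnj[of h u] mem_diff by simp

lemma ip_scale_right:
  assumes "g \<in> H" "u \<in> H" shows "ip u (cscale c g) = cnj c * ip u g"
  using assms ip_scale[of g u c] ip_cnj[of "cscale c g" u] ip_cnj[of g u] mem_scale by simp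

lemma ip_sum_right:
  assumes "\<And>i. i \<in> A \<Longrightarrow> g i \<in> H" "u \<in> H" shows "ip u (\<Sum>i\<in>A. g i) = (\<Sum>i\<in>A. ip u (g i))"
proof -
  have "ip u (\<Sum>i\<in>A. g i) = cnj (ip (\<Sum>i\<in>A. g i) u)"
    using assms by (intro ip_cnj mem_sum) auto
  also have "\<dots> = (\<Sum>i\<in>A. cnj (ip (g i) u))"
    using assms by (simp add: ip_sum)
  also have "\<dots> = (\<Sum>i\<in>A. ip u (g i))"
    using assms by (intro sum.cong refl) (metis ip_cnj)
  finally show ?thesis .
qed

lemma ip_zero_right: "u \<in> H \<Longrightarrow> ip u 0 = 0"
  using ip_cnj[of 0 u] ip_zero_left[of u] mem_zero by simp

lemma ip_self: assumes "h \<in> H" shows "ip h h = of_real ((hnorm ip h)\<^sup>2)"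
proof -
  have "Im (ip h h) = 0" using arg_cong[OF ip_cnj[OF assms assms], of Im] by simp
  then show ?thesis using ip_nonneg[OF assms] by (simp add: hnorm_def complex_eq_iff)
qed

lemma norm_ip_self: "h \<in> H \<Longrightarrow> cmod (ip h h) = (hnorm ip h)\<^sup>2"
  by (simp add: ip_self norm_power)

lemma hnorm_nonneg: "h \<in> H \<Longrightarrow> 0 \<le> hnorm ip h"
  by (simp add: hnorm_def ip_nonneg)

lemma Cauchy_Schwarz:
  assumes "g \<in> H" "h \<in> H" shows "cmod (ip g h) \<le> hnorm ip g * hnorm ip h"
proof (cases "ip h h = 0")
  case True
  then have "h = 0" using ip_definite assms by blast
  then show ?thesis using ip_zero_right[OF assms(1)] hnorm_nonneg assms by simp
next
  case False
  define b where "b = (hnorm ip h)\<^sup>2"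
  have hh: "ip h h = of_real b" using ip_self[OF assms(2)] by (simp add: b_def)
  have b: "b > 0" using False hh unfolding b_def by (metis of_real_0 zero_le_power2 order_le_less)
  define c where "c = ip g h / of_real b"
  have ch: "cscale c h \<in> H" using assms mem_scale by blast
  have hg: "ip h g = cnj (ip g h)" using ip_cnj assms by blast
  have "ip (g - cscale c h) (g - cscale c h) = ip g g - cnj c * ip g h - c * (ip h g - cnj c * ip h h)"
    using assms ch by (simp add: ip_diff ip_diff_right ip_scale ip_scale_right mem_diff algebra_simps)
  also have "\<dots> = ip g g - ip g h * cnj (ip g h) / of_real b"
    using b by (simp add: hh hg c_def field_simps)
  also have "\<dots> = of_real ((hnorm ip g)\<^sup>2 - (cmod (ip g h))\<^sup>2 / b)"
    using complex_norm_square[of "ip g h"] by (simp add: ip_self[OF assms(1)])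
  finally have "0 \<le> (hnorm ip g)\<^sup>2 - (cmod (ip g h))\<^sup>2 / b"
    using ip_nonneg[OF mem_diff[OF assms(1) ch]] by simp
  then have "(cmod (ip g h))\<^sup>2 \<le> (hnorm ip g * hnorm ip h)\<^sup>2"
    using b by (simp add: field_simps b_def)
  then show ?thesis by (rule power2_le_imp_le) (simp add: hnorm_nonneg assms)
qed

lemma tendsto_ip:
  assumes "\<And>j. s j \<in> H" "h \<in> H" "(\<lambda>j. hnorm ip (s j - h)) \<longlonglongrightarrow> 0" "u \<in> H"
  shows "(\<lambda>j. ip (s j) u) \<longlonglongrightarrow> ip h u"
proof (rule Lim_transform2[OF tendsto_const])
  have "(\<lambda>j. ip (s j) u - ip h u) \<longlonglongrightarrow> 0"
  proof (rule Lim_null_comparison)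
    show "\<forall>\<^sub>F j in sequentially. cmod (ip (s j) u - ip h u) \<le> hnorm ip (s j - h) * hnorm ip u"
      using Cauchy_Schwarz[OF mem_diff[OF assms(1,2)] assms(4)] assms by (simp add: ip_diff)
    show "(\<lambda>j. hnorm ip (s j - h) * hnorm ip u) \<longlonglongrightarrow> 0"
      using tendsto_mult_left_zero[OF assms(3)] .
  qed
  then show "(\<lambda>j. ip h u - ip (s j) u) \<longlonglongrightarrow> 0"
    using tendsto_minus by fastforce
qed

end

text \<open>Lagrange's form of the remainder makes the quotient equal to
  \<open>a ^ n / fact n * exp t\<close> with \<open>\<bar>t\<bar> \<le> \<bar>a * z\<bar>\<close>,
  so it remains to see that \<open>exp t\<close> tends to 1.\<close>

lemma tendsto_exp_Taylor_remainder:
  fixes a :: real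
  shows "((\<lambda>z. (exp (a * z) - (\<Sum>j<n. (a * z) ^ j / fact j)) / z ^ n) \<longlongrightarrow> a ^ n / fact n) (at 0)"
proof (rule LIM_zero_cancel, rule Lim_null_comparison)
  show "\<forall>\<^sub>F z in at 0. norm ((exp (a * z) - (\<Sum>j<n. (a * z) ^ j / fact j)) / z ^ n - a ^ n / fact n)
      \<le> \<bar>a ^ n / fact n\<bar> * (exp \<bar>a * z\<bar> - 1)"
  proof (rule eventually_mono[OF eventually_neq_at_within[of 0]])
    fix z :: real assume z: "z \<noteq> 0"
    obtain t where t: "\<bar>t\<bar> \<le> \<bar>a * z\<bar>"
      "exp (a * z) = (\<Sum>m<n. (a * z) ^ m / fact m) + exp t / fact n * (a * z) ^ n"
      using Maclaurin_exp_le by blast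
    have "(exp (a * z) - (\<Sum>j<n. (a * z) ^ j / fact j)) / z ^ n - a ^ n / fact n
        = a ^ n / fact n * (exp t - 1)"
      using z by (simp add: t(2) field_simps power_mult_distrib)
    moreover have "\<bar>exp t - 1\<bar> \<le> exp \<bar>a * z\<bar> - 1"
    proof (cases "t \<ge> 0")
      case True then show ?thesis using t(1) by simp
    next
      case False
      \<comment> \<open>Expanding the square yields \<open>2 \<le> exp t + exp (-t)\<close>, hence
        \<open>1 - exp t \<le> exp (-t) - 1\<close>, which handles negative
        \<open>t\<close>.\<close>
      have "1 \<le> (exp (t/2) - exp (-t/2))\<^sup>2 + 1" by simp
      then have "2 \<le> exp t + exp (-t)"
        by (simp add: power2_eq_square algebra_simps flip: exp_add)
      moreover have "exp (-t) \<le> exp \<bar>a * z\<bar>" using False t by simp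
      moreover have "exp t < 1" using False by simp
      ultimately show ?thesis by linarith
    qed
    ultimately show "norm ((exp (a * z) - (\<Sum>j<n. (a * z) ^ j / fact j)) / z ^ n - a ^ n / fact n)
      \<le> \<bar>a ^ n / fact n\<bar> * (exp \<bar>a * z\<bar> - 1)"
      by (simp only: real_norm_def abs_mult mult_left_mono abs_ge_zero)
  qed
  show "((\<lambda>z. \<bar>a ^ n / fact n\<bar> * (exp \<bar>a * z\<bar> - 1)) \<longlongrightarrow> 0) (at 0)"
    by (rule tendsto_eq_intros refl | simp)+
qed

text \<open>Indexing by lists of directions matches \<open>iter_partial\<close>: prepending a
  direction multiplies by one coordinate, and list induction replaces arithmetic with
  multi-indices.\<close>

definition monom_at :: "real ^ 'd \<Rightarrow> 'd list \<Rightarrow> real ^ 'd \<Rightarrow> real" where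
  "monom_at p is y = (\<Prod>i\<leftarrow>is. (y - p) $ i)"

definition wmonom :: "(real ^ 'd \<Rightarrow> real) \<Rightarrow> real ^ 'd \<Rightarrow> 'd list \<Rightarrow> real ^ 'd \<Rightarrow> complex" where
  "wmonom w p is y = of_real (w y * monom_at p is y)"

definition wpoly :: "(real ^ 'd \<Rightarrow> real) \<Rightarrow> real ^ 'd \<Rightarrow> nat \<Rightarrow> (real ^ 'd \<Rightarrow> complex) set" where
  "wpoly w p n = cspan {wmonom w p is | is. length is \<le> n}"

lemma wpoly_mono: "m \<le> n \<Longrightarrow> wpoly w p m \<subseteq> wpoly w p n"
  unfolding wpoly_def by (intro cfun.span_mono) auto

lemma subspace_wpoly: "csubspace (wpoly w p n)"
  unfolding wpoly_def by simp

lemma wmonom_in_wpoly: "length is \<le> n \<Longrightarrow> wmonom w p is \<in> wpoly w p n"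
  unfolding wpoly_def by (intro cfun.span_base) auto

lemma wpoly_mult_coord:
  assumes "q \<in> wpoly w p n"
  shows "(\<lambda>y. of_real ((y - p) $ i) * q y) \<in> wpoly w p (Suc n)"
  using assms unfolding wpoly_def[of w p n]
proof (induct rule: cfun.span_induct_alt)
  case base
  have "(\<lambda>y. of_real ((y - p) $ i) * (0::real ^ 'a \<Rightarrow> complex) y) = 0" by (simp add: fun_eq_iff)
  then show ?case using cfun.subspace_0[OF subspace_wpoly] by metis
next
  case (step c x y)
  from step(1) obtain "is" where is_def: "x = wmonom w p is" "length is \<le> n" by auto
  have "(\<lambda>z. of_real ((z - p) $ i) * (cscale c x + y) z)
    = cscale c (wmonom w p (i # is)) + (\<lambda>z. of_real ((z - p) $ i) * y z)"
    by (simp add: fun_eq_iff is_def cscale_def wmonom_def monom_at_def algebra_simps)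
  then show ?case
    using is_def step(2) by (auto intro!: cfun.subspace_add cfun.subspace_scale subspace_wpoly wmonom_in_wpoly)
qed

lemma wpoly_mult_linear:
  assumes "q \<in> wpoly w p n"
  shows "(\<lambda>y. of_real (inner u (y - p)) * q y) \<in> wpoly w p (Suc n)"
proof -
  have "(\<lambda>y. of_real (inner u (y - p)) * q y)
    = (\<Sum>i\<in>UNIV. cscale (of_real (u $ i)) (\<lambda>y. of_real ((y - p) $ i) * q y))"
    by (simp add: fun_eq_iff sum_fun_apply cscale_def inner_vec_def sum_distrib_right mult.assoc
        del: vector_minus_component)
  then show ?thesis
    using wpoly_mult_coord[OF assms]
    by (auto intro!: cfun.subspace_sum cfun.subspace_scale subspace_wpoly simp del: vector_minus_component)
qed

text \<open>The common setting of both kernels. That weighted polynomials belong to \<open>H\<close>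
  is an assumption because the theorem provides it through the domain of C_f; what has to be derived
  is how \<open>ip\<close> acts on them.\<close>

locale weighted_rkhs = rkhs H ip k
  for H :: "(real ^ 'd \<Rightarrow> complex) set"
    and ip :: "(real ^ 'd \<Rightarrow> complex) \<Rightarrow> (real ^ 'd \<Rightarrow> complex) \<Rightarrow> complex"
    and k :: "real ^ 'd \<Rightarrow> real ^ 'd \<Rightarrow> complex" +
  fixes w :: "real ^ 'd \<Rightarrow> real" and p :: "real ^ 'd" and \<sigma> :: real
  assumes sigma_pos: "\<sigma> > 0"
    and weight_pos: "\<And>x. w x > 0"
    and kernel_eq: "\<And>x y. k x y = of_real (w x * w y * exp (inner (x - p) (y - p) / \<sigma>\<^sup>2))"
    and wpoly_subset: "\<And>n. wpoly w p n \<subseteq> H"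
begin

text \<open>Up to the factor \<open>1 / fact l\<close>, this is the coefficient of
  \<open>t ^ l\<close> in the expansion of \<open>ksec u t\<close>.\<close>

definition ray :: "real ^ 'd \<Rightarrow> nat \<Rightarrow> real ^ 'd \<Rightarrow> complex" where
  "ray u l y = of_real (w y * (inner u (y - p) / \<sigma>\<^sup>2) ^ l)"

lemma ray_in_wpoly: "l \<le> n \<Longrightarrow> ray u l \<in> wpoly w p n"
proof -
  have "ray u l \<in> wpoly w p l"
  proof (induct l)
    case 0
    have "ray u 0 = wmonom w p []" by (simp add: fun_eq_iff ray_def wmonom_def monom_at_def)
    then show ?case by (simp add: wmonom_in_wpoly)
  next
    case (Suc l)
    have "ray u (Suc l) = cscale (of_real (1 / \<sigma>\<^sup>2)) (\<lambda>y. of_real (inner u (y - p)) * ray u l y)"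
      by (simp add: fun_eq_iff ray_def cscale_def)
    then show ?case
      using wpoly_mult_linear[OF Suc] cfun.subspace_scale[OF subspace_wpoly] by metis
  qed
  then show "l \<le> n \<Longrightarrow> ?thesis" using wpoly_mono by blast
qed

lemma ray_mem: "ray u l \<in> H"
  using ray_in_wpoly[of l l] wpoly_subset by blast

text \<open>Dividing the kernel section by the weight of its base point leaves a pure exponential in
  \<open>t\<close>. The Gram function of the family then depends only on the product of the two
  parameters.\<close>

definition ksec :: "real ^ 'd \<Rightarrow> real \<Rightarrow> real ^ 'd \<Rightarrow> complex" where
  "ksec u t = cscale (of_real (1 / w (p + t *\<^sub>R u))) (k (p + t *\<^sub>R u))"

lemma ksec_apply: "ksec u t y = of_real (w y * exp (t * (inner u (y - p) / \<sigma>\<^sup>2)))"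
  using weight_pos[of "p + t *\<^sub>R u"] by (simp add: ksec_def cscale_def kernel_eq)

lemma ksec_mem: "ksec u t \<in> H"
  unfolding ksec_def by (intro mem_scale kernel_mem)

lemma ip_ksec: "h \<in> H \<Longrightarrow> ip h (ksec u t) = h (p + t *\<^sub>R u) / of_real (w (p + t *\<^sub>R u))"
  by (simp add: ksec_def ip_scale_right kernel_mem reproducing)

lemma ip_ksec_ksec: "ip (ksec u s) (ksec u t) = of_real (exp (inner u u / \<sigma>\<^sup>2 * (s * t)))"
  using weight_pos[of "p + t *\<^sub>R u"] by (simp add: ip_ksec ksec_mem ksec_apply field_simps)

lemma ip_ray_ksec: "ip (ray u l) (ksec u t) = of_real ((inner u u / \<sigma>\<^sup>2 * t) ^ l)"
  using weight_pos[of "p + t *\<^sub>R u"] by (simp add: ip_ksec ray_mem ray_def field_simps)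

lemma ip_ksec_ray: "ip (ksec u t) (ray u l) = of_real ((inner u u / \<sigma>\<^sup>2 * t) ^ l)"
  by (subst ip_cnj[OF ray_mem ksec_mem]) (simp add: ip_ray_ksec)

definition krem :: "real ^ 'd \<Rightarrow> nat \<Rightarrow> real \<Rightarrow> real ^ 'd \<Rightarrow> complex" where
  "krem u n t = ksec u t - (\<Sum>j<n. cscale (of_real (t ^ j / fact j)) (ray u j))"

lemma krem_mem: "krem u n t \<in> H"
  unfolding krem_def by (intro mem_diff mem_sum mem_scale ray_mem ksec_mem)

lemma krem_apply: "krem u n t y = of_real (w y *
    (exp (inner u (y - p) / \<sigma>\<^sup>2 * t) - (\<Sum>j<n. (inner u (y - p) / \<sigma>\<^sup>2 * t) ^ j / fact j)))"
proof -
  define a where "a = inner u (y - p) / \<sigma>\<^sup>2"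
  have "krem u n t y = of_real (w y * exp (t * a) - (\<Sum>j<n. t ^ j / fact j * (w y * a ^ j)))"
    by (simp add: krem_def ksec_apply sum_fun_apply cscale_def ray_def a_def)
  then show ?thesis
    unfolding a_def[symmetric] by (simp add: algebra_simps sum_distrib_left power_mult_distrib)
qed

context
  fixes u :: "real ^ 'd" and n :: nat
  assumes orth: "\<And>i j. i < n \<Longrightarrow> j < n \<Longrightarrow>
    ip (ray u i) (ray u j) = (if i = j then of_real (fact i * (inner u u / \<sigma>\<^sup>2) ^ i) else 0)"
begin

text \<open>The context assumption is the induction hypothesis of \<open>ip_ray_ray\<close>, so the
  two lemmas of this context serve inside that induction and again after it. Orthogonality selects
  the one Taylor term of index \<open>j\<close>, and it equals the inner product of
  \<open>ksec u t\<close> with \<open>ray u j\<close>.\<close>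

lemma ip_krem_ray: assumes "j < n" shows "ip (krem u n t) (ray u j) = 0"
proof -
  have "ip (krem u n t) (ray u j) = of_real ((inner u u / \<sigma>\<^sup>2 * t) ^ j)
      - (\<Sum>i<n. of_real (t ^ i / fact i) * ip (ray u i) (ray u j))"
    unfolding krem_def
    by (simp add: ip_diff ip_sum ip_scale mem_sum mem_scale ray_mem ksec_mem ip_ksec_ray)
  also have "(\<Sum>i<n. of_real (t ^ i / fact i) * ip (ray u i) (ray u j))
      = (\<Sum>i<n. if i = j then of_real (t ^ j / fact j * (fact j * (inner u u / \<sigma>\<^sup>2) ^ j)) else (0::complex))"
    using assms by (intro sum.cong refl) (simp add: orth)
  also have "\<dots> = of_real ((inner u u / \<sigma>\<^sup>2 * t) ^ j)"
    using assms by (subst sum.delta) (simp_all add: power_mult_distrib field_simps)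
  finally show ?thesis by simp
qed

text \<open>A remainder is orthogonal to the rays that were subtracted, so the second argument may
  be replaced by \<open>ksec u t\<close>; pairing with that is evaluation at a point of the
  ray.\<close>

lemma ip_krem_krem: "ip (krem u n s) (krem u n t) =
    of_real (exp (inner u u / \<sigma>\<^sup>2 * (s * t)) - (\<Sum>j<n. (inner u u / \<sigma>\<^sup>2 * (s * t)) ^ j / fact j))"
proof -
  have "ip (krem u n s) (krem u n t) = ip (krem u n s) (ksec u t)
      - (\<Sum>j<n. of_real (t ^ j / fact j) * ip (krem u n s) (ray u j))"
    unfolding krem_def[of u n t]
    by (simp add: ip_diff_right ip_sum_right ip_scale_right mem_sum mem_scale ray_mem ksec_mem krem_mem)
  also have "\<dots> = ip (krem u n s) (ksec u t)" by (simp add: ip_krem_ray)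
  also have "\<dots> = of_real (exp (inner u u / \<sigma>\<^sup>2 * (s * t)))
      - (\<Sum>j<n. of_real (s ^ j / fact j) * of_real ((inner u u / \<sigma>\<^sup>2 * t) ^ j))"
    unfolding krem_def
    by (simp add: ip_diff ip_sum ip_scale mem_sum mem_scale ray_mem ksec_mem ip_ksec_ksec ip_ray_ksec
        del: of_real_power of_real_divide)
  finally show ?thesis by (simp add: power_mult_distrib algebra_simps power_divide)
qed

end

text \<open>The norm of \<open>ray u n\<close> is not given by point evaluation, so the ray is
  realized as a norm limit: the remainders of order \<open>n\<close>, divided by
  \<open>t ^ n\<close>, converge to \<open>ray u n\<close> divided by \<open>fact n\<close> as
  \<open>t\<close> tends to 0. They form a Cauchy sequence because their Gram matrix converges to a
  constant, and completeness supplies the limit. Inner products with the earlier rays pass to the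
  limit as 0.\<close>

lemma ip_ray_ray: "ip (ray u i) (ray u j) = (if i = j then of_real (fact i * (inner u u / \<sigma>\<^sup>2) ^ i) else 0)"
proof -
  define c where "c = inner u u / \<sigma>\<^sup>2"
  have "\<forall>i<n. \<forall>j<n. ip (ray u i) (ray u j) = (if i = j then of_real (fact i * c ^ i) else 0)" for n
  proof (induct n)
    case (Suc n)
    note orth = Suc[rule_format, unfolded c_def]
    \<comment> \<open>The Gram function of the rescaled remainders: \<open>ip (R i) (R j)\<close>
      turns out to be \<open>\<psi>\<close> at \<open>\<tau> i * \<tau> j\<close>, so the single
      limit \<open>L\<close> at 0 controls all of them.\<close>
    define \<psi> where "\<psi> z = (exp (c * z) - (\<Sum>j<n. (c * z) ^ j / fact j)) / z ^ n" for z
    define L where "L = c ^ n / fact n"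
    have psi: "(\<psi> \<longlongrightarrow> L) (at 0)"
      unfolding \<psi>_def L_def by (rule tendsto_exp_Taylor_remainder)
    define \<tau> where "\<tau> j = 1 / real (Suc j)" for j
    have \<tau>: "\<tau> j > 0" "\<tau> j \<le> 1" for j by (simp_all add: \<tau>_def)
    have \<tau>_lim: "\<tau> \<longlonglongrightarrow> 0" unfolding \<tau>_def by (rule LIMSEQ_Suc[OF lim_1_over_n])
    define R where "R j = cscale (of_real (1 / \<tau> j ^ n)) (krem u n (\<tau> j))" for j
    have R_mem: "R j \<in> H" for j unfolding R_def by (intro mem_scale krem_mem)
    have RR: "ip (R i) (R j) = of_real (\<psi> (\<tau> i * \<tau> j))" for i j
      unfolding R_def \<psi>_def
      by (simp add: ip_scale ip_scale_right krem_mem mem_scale ip_krem_krem[OF orth] c_def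
          power_mult_distrib field_simps)
    have R_ray: "ip (R i) (ray u j) = 0" if "j < n" for i j
      using that unfolding R_def by (simp add: ip_scale krem_mem ray_mem ip_krem_ray[OF orth])
    have "\<exists>h\<in>H. (\<lambda>j. hnorm ip (R j - h)) \<longlonglongrightarrow> 0"
    proof (rule complete[OF R_mem])
      fix e :: real assume e: "e > 0"
      from tendstoD[OF psi, of "e\<^sup>2 / 4"] e obtain d where d: "d > 0"
        "\<And>z. z \<noteq> 0 \<Longrightarrow> dist z 0 < d \<Longrightarrow> dist (\<psi> z) L < e\<^sup>2 / 4"
        by (auto simp: eventually_at)
      obtain J where J: "\<And>j. j \<ge> J \<Longrightarrow> \<tau> j < d"
        using order_tendstoD(2)[OF \<tau>_lim d(1)] by (auto simp: eventually_sequentially)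
      have *: "\<bar>\<psi> (\<tau> i * \<tau> j) - L\<bar> < e\<^sup>2 / 4" if "i \<ge> J" "j \<ge> J" for i j
      proof -
        have "\<tau> i * \<tau> j \<le> \<tau> i" using \<tau>[of i] \<tau>[of j] mult_left_mono[of "\<tau> j" 1 "\<tau> i"] by simp
        then have "\<tau> i * \<tau> j < d" using J[OF that(1)] by simp
        moreover have "\<tau> i * \<tau> j > 0" using \<tau>(1) by simp
        ultimately show ?thesis
          using d(2)[of "\<tau> i * \<tau> j"] less_imp_neq[of 0 "\<tau> i * \<tau> j"] by (simp add: dist_real_def)
      qed
      have "hnorm ip (R i - R j) < e" if "i \<ge> J" "j \<ge> J" for i j
      proof -
        \<comment> \<open>Four values of \<open>\<psi>\<close>, each within
          \<open>e\<^sup>2 / 4\<close> of \<open>L\<close>, and with signs for which the multiples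
          of \<open>L\<close> cancel.\<close>
        have "Re (ip (R i - R j) (R i - R j)) = \<psi> (\<tau> i * \<tau> i) - \<psi> (\<tau> i * \<tau> j) - \<psi> (\<tau> j * \<tau> i) + \<psi> (\<tau> j * \<tau> j)"
          by (simp add: ip_diff ip_diff_right R_mem mem_diff RR)
        also have "\<dots> < e\<^sup>2" using *[OF that(1,1)] *[OF that] *[OF that(2,1)] *[OF that(2,2)] by linarith
        finally show ?thesis using e unfolding hnorm_def
          by (metis real_sqrt_less_iff real_sqrt_abs abs_of_pos)
      qed
      then show "\<exists>J. \<forall>i\<ge>J. \<forall>j\<ge>J. hnorm ip (R i - R j) < e" by blast
    qed
    then obtain h where h: "h \<in> H" "(\<lambda>j. hnorm ip (R j - h)) \<longlonglongrightarrow> 0" by blast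
    have conv: "(\<lambda>j. ip (R j) g) \<longlonglongrightarrow> ip h g" if "g \<in> H" for g
      using tendsto_ip[OF R_mem h that] .
    \<comment> \<open>Convergence in norm implies pointwise convergence by the reproducing property,
      and the pointwise limit is computed from the Taylor expansion of the exponential.\<close>
    have h_eq: "h = cscale (of_real (1 / fact n)) (ray u n)"
    proof
      fix y
      have "(\<lambda>j. R j y) \<longlonglongrightarrow> h y"
        using conv[OF kernel_mem[of y]] by (simp add: reproducing R_mem h)
      moreover have "(\<lambda>j. R j y) \<longlonglongrightarrow> cscale (of_real (1 / fact n)) (ray u n) y"
      proof -
        define a where "a = inner u (y - p) / \<sigma>\<^sup>2"
        have "filterlim \<tau> (at 0) sequentially"
          using \<tau>_lim \<tau>(1) by (auto simp: filterlim_at intro!: always_eventually less_imp_neq[symmetric])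
        from filterlim_compose[OF tendsto_exp_Taylor_remainder[of a n] this]
        have "(\<lambda>j. w y * ((exp (a * \<tau> j) - (\<Sum>i<n. (a * \<tau> j) ^ i / fact i)) / \<tau> j ^ n))
           \<longlonglongrightarrow> w y * (a ^ n / fact n)" by (rule tendsto_mult_left)
        then have "(\<lambda>j. complex_of_real (w y * ((exp (a * \<tau> j) - (\<Sum>i<n. (a * \<tau> j) ^ i / fact i)) / \<tau> j ^ n)))
           \<longlonglongrightarrow> of_real (w y * (a ^ n / fact n))" by (rule tendsto_of_real)
        then show ?thesis
          by (simp add: R_def cscale_def krem_apply ray_def a_def)
      qed
      ultimately show "h y = cscale (of_real (1 / fact n)) (ray u n) y" by (rule LIMSEQ_unique)
    qed
    have Rh: "ip (R j) h = of_real L" for j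
    proof -
      have "(\<lambda>i. \<tau> i * \<tau> j) \<longlonglongrightarrow> 0" using tendsto_mult_left_zero[OF \<tau>_lim] .
      then have "filterlim (\<lambda>i. \<tau> i * \<tau> j) (at 0) sequentially"
        using \<tau>(1) by (auto simp: filterlim_at intro!: always_eventually less_imp_neq[symmetric])
      from filterlim_compose[OF psi this]
      have "(\<lambda>i. ip (R i) (R j)) \<longlonglongrightarrow> of_real L" unfolding RR by (rule tendsto_of_real)
      with conv[OF R_mem] have "ip h (R j) = of_real L" by (rule LIMSEQ_unique)
      then show ?thesis using ip_cnj[OF h(1) R_mem] by simp
    qed
    have hh: "ip h h = of_real L"
      using conv[OF h(1)] unfolding Rh by (simp add: LIMSEQ_const_iff)
    have hj: "ip h (ray u j) = 0" if "j < n" for j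
      using conv[OF ray_mem[of u j]] unfolding R_ray[OF that] by (simp add: LIMSEQ_const_iff)
    have ray_eq: "ray u n = cscale (of_real (fact n)) h"
      by (simp add: h_eq cscale_def fun_eq_iff)
    have nn: "ip (ray u n) (ray u n) = of_real (fact n * c ^ n)"
      unfolding ray_eq using h(1) by (simp add: ip_scale ip_scale_right mem_scale hh L_def)
    have nj: "ip (ray u n) (ray u j) = 0" if "j < n" for j
      unfolding ray_eq[of] using h(1) that by (simp add: ip_scale ray_mem hj)
    have jn: "ip (ray u j) (ray u n) = 0" if "j < n" for j
      using ip_cnj[OF ray_mem ray_mem, of u n u j] nj[OF that] by simp
    show ?case using Suc nn nj jn by (auto simp: less_Suc_eq)
  qed simp
  from this[of "Suc (max i j)"] show ?thesis by (simp add: c_def less_Suc_eq_le)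
qed

text \<open>A function orthogonal to \<open>wpoly w p n\<close> does not see the Taylor polynomial
  of the kernel section. Its value at \<open>x\<close> is the inner product with the remainder
  alone, to which Cauchy-Schwarz and \<open>ip_krem_krem\<close> apply.\<close>

lemma orthogonal_wpoly_bound:
  assumes h: "h \<in> H" and orth: "\<And>g. g \<in> wpoly w p n \<Longrightarrow> ip h g = 0"
  shows "cmod (h x) \<le> hnorm ip h * (w x * sqrt (exp ((norm (x - p) / \<sigma>)\<^sup>2) / fact (n + 1)) * (norm (x - p) / \<sigma>) ^ (n + 1))"
proof -
  define u where "u = x - p"
  define c where "c = inner u u / \<sigma>\<^sup>2"
  have c: "c = (norm (x - p) / \<sigma>)\<^sup>2" by (simp add: c_def u_def power_divide dot_square_norm)
  have c0: "c \<ge> 0" by (simp add: c)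
  \<comment> \<open>With \<open>u = x - p\<close> the point \<open>x\<close> is reached at
    \<open>t = 1\<close>. The subtracted terms have degrees 0 to \<open>n\<close>, whence the index
    \<open>Suc n\<close>.\<close>
  let ?A = "krem u (Suc n) 1"
  have norm_krem: "hnorm ip ?A \<le> sqrt (exp c / fact (n + 1)) * (norm (x - p) / \<sigma>) ^ (n + 1)"
  proof -
    obtain t where t: "\<bar>t\<bar> \<le> \<bar>c\<bar>"
      "exp c = (\<Sum>m<Suc n. c ^ m / fact m) + exp t / fact (Suc n) * c ^ Suc n"
      using Maclaurin_exp_le by blast
    have "Re (ip ?A ?A) = exp t / fact (Suc n) * c ^ Suc n"
    proof -
      have "ip ?A ?A = of_real (exp c - (\<Sum>m<Suc n. c ^ m / fact m))"
        using ip_krem_krem[OF ip_ray_ray, of u "Suc n" 1 1] by (simp only: c_def mult_1_right)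
      also have "exp c - (\<Sum>m<Suc n. c ^ m / fact m) = exp t / fact (Suc n) * c ^ Suc n"
        using t(2) by linarith
      finally show ?thesis by (simp only: Re_complex_of_real)
    qed
    also have "\<dots> \<le> exp c / fact (Suc n) * c ^ Suc n"
      using t(1) c0 by (intro mult_right_mono divide_right_mono) auto
    finally have "hnorm ip ?A \<le> sqrt (exp c / fact (Suc n) * c ^ Suc n)"
      unfolding hnorm_def by (rule real_sqrt_le_mono)
    also have "\<dots> = sqrt (exp c / fact (n + 1)) * sqrt (c ^ Suc n)"
      by (simp only: real_sqrt_mult Suc_eq_plus1)
    also have "sqrt (c ^ Suc n) = (norm (x - p) / \<sigma>) ^ (n + 1)"
      using sigma_pos by (simp add: c real_sqrt_power power_mult_distrib real_sqrt_mult)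
    finally show ?thesis .
  qed
  have "ip h (ksec u 1) = ip h ?A"
    unfolding krem_def using h
    by (simp add: ip_diff_right ip_sum_right ip_scale_right mem_sum mem_scale ray_mem ksec_mem
        orth ray_in_wpoly less_Suc_eq_le del: sum.lessThan_Suc)
  then have "h x = of_real (w x) * ip h ?A"
    using weight_pos[of x] h by (simp add: ip_ksec u_def field_simps)
  then have "cmod (h x) = w x * cmod (ip h ?A)"
    using weight_pos[of x] by (simp add: norm_mult)
  also have "\<dots> \<le> w x * (hnorm ip h * (sqrt (exp c / fact (n + 1)) * (norm (x - p) / \<sigma>) ^ (n + 1)))"
  proof (intro mult_left_mono)
    have "cmod (ip h ?A) \<le> hnorm ip h * hnorm ip ?A"
      by (rule Cauchy_Schwarz[OF h krem_mem])
    also have "\<dots> \<le> hnorm ip h * (sqrt (exp c / fact (n + 1)) * (norm (x - p) / \<sigma>) ^ (n + 1))"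
      by (rule mult_left_mono[OF norm_krem hnorm_nonneg[OF h]])
    finally show "cmod (ip h ?A) \<le> hnorm ip h * (sqrt (exp c / fact (n + 1)) * (norm (x - p) / \<sigma>) ^ (n + 1))" .
    show "0 \<le> w x" using weight_pos[of x] by simp
  qed
  finally show ?thesis by (simp only: c mult_ac)
qed

end

section \<open>Chebyshev expansion of weighted polynomials\<close>

fun cheb :: "nat \<Rightarrow> real \<Rightarrow> real" where
  "cheb 0 t = 1"
| "cheb (Suc 0) t = 2 * t"
| "cheb (Suc (Suc n)) t = 2 * t * cheb (Suc n) t - cheb n t"

lemma sin_times_cheb_cos: "sin \<theta> * cheb n (cos \<theta>) = sin (real (n + 1) * \<theta>)"
proof (induct n rule: induct_nat_012)
  case 1 then show ?case using sin_double[of \<theta>] by (simp add: algebra_simps)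
next
  case (ge2 n)
  let ?a = "real (n + 2) * \<theta>"
  have "sin \<theta> * cheb (Suc (Suc n)) (cos \<theta>) = 2 * cos \<theta> * sin ?a - sin (real (n + 1) * \<theta>)"
    using ge2 by (simp add: algebra_simps)
  also have "sin (real (n + 1) * \<theta>) = sin (?a - \<theta>)" by (simp add: algebra_simps)
  also have "2 * cos \<theta> * sin ?a - sin (?a - \<theta>) = sin (?a + \<theta>)"
    by (simp add: sin_add sin_diff)
  also have "?a + \<theta> = real (Suc (Suc n) + 1) * \<theta>" by (simp add: algebra_simps)
  finally show ?case .
qed simp

text \<open>The three-term recursion solved for the product. At \<open>n = 0\<close> the missing
  lower term is 0, as if a polynomial of index -1 vanished.\<close>

lemma times_cheb: "t * cheb n t = cheb (Suc n) t / 2 + (if n = 0 then 0 else cheb (n - 1) t / 2)"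
  by (induct n rule: induct_nat_012) (auto simp: field_simps)

lemma continuous_on_cheb [continuous_intros]: "continuous_on A f \<Longrightarrow> continuous_on A (\<lambda>x. cheb n (f x))"
proof (induct n rule: induct_nat_012)
  case (ge2 n) then show ?case by (simp, intro continuous_intros)
qed (auto intro!: continuous_intros)

text \<open>The indicator matters: \<open>sqrt\<close> is an odd function on the reals, so
  \<open>sqrt (1 - t\<^sup>2)\<close> is negative outside the interval.\<close>

definition cheb_weight :: "real \<Rightarrow> real" where
  "cheb_weight t = indicator {-1..1} t * sqrt (1 - t\<^sup>2)"

lemma cheb_weight_nonneg: "0 \<le> cheb_weight t"
proof (cases "t \<in> {-1..1}")
  case True
  then have "t\<^sup>2 \<le> 1" by (simp add: abs_square_le_1 abs_le_iff)
  then show ?thesis using True by (simp add: cheb_weight_def)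
qed (simp add: cheb_weight_def)

lemma cheb_weight_le: "cheb_weight t \<le> indicator {-1..1} t"
  by (simp add: cheb_weight_def indicator_def)

text \<open>The product-to-sum formula gives the antiderivative. The diagonal case stands apart
  because the general one divides by \<open>i - j\<close>.\<close>

lemma sin_sin_antiderivative:
  obtains F :: "real \<Rightarrow> real"
  where "\<And>\<theta>. (F has_real_derivative sin (real (i + 1) * \<theta>) * sin (real (j + 1) * \<theta>)) (at \<theta>)"
    and "F pi - F 0 = (if i = j then pi / 2 else 0)"
proof (cases "i = j")
  case True
  define c where "c = real (i + 1)"
  have c: "c > 0" by (simp add: c_def)
  have "((\<lambda>\<theta>. \<theta> / 2 - sin (2 * (c * \<theta>)) / (4 * c)) has_real_derivative sin (c * \<theta>) * sin (c * \<theta>)) (at \<theta>)" for \<theta>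
  proof -
    have "((\<lambda>\<theta>. \<theta> / 2 - sin (2 * (c * \<theta>)) / (4 * c)) has_real_derivative (1 - cos (2 * (c * \<theta>))) / 2) (at \<theta>)"
      using c by (auto intro!: derivative_eq_intros simp: field_simps)
    also have "(1 - cos (2 * (c * \<theta>))) / 2 = sin (c * \<theta>) * sin (c * \<theta>)"
      by (simp add: cos_double_sin power2_eq_square)
    finally show ?thesis .
  qed
  moreover have "sin (2 * (c * pi)) = 0"
    using sin_npi2[of "2 * (i + 1)"] by (simp add: c_def algebra_simps)
  ultimately show ?thesis
    by (intro that[of "\<lambda>\<theta>. \<theta> / 2 - sin (2 * (c * \<theta>)) / (4 * c)"]) (use True in \<open>simp_all add: c_def\<close>)
next
  case False
  \<comment> \<open>The difference is taken among integers, since subtraction of natural numbers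
    truncates.\<close>
  define c d where "c = real_of_int (int i - int j)" and "d = real (i + j + 2)"
  have cd: "c \<noteq> 0" "d \<noteq> 0" using False by (simp_all add: c_def d_def)
  have "((\<lambda>\<theta>. sin (c * \<theta>) / (2 * c) - sin (d * \<theta>) / (2 * d)) has_real_derivative
      sin (real (i + 1) * \<theta>) * sin (real (j + 1) * \<theta>)) (at \<theta>)" for \<theta>
  proof -
    have "((\<lambda>\<theta>. sin (c * \<theta>) / (2 * c) - sin (d * \<theta>) / (2 * d)) has_real_derivative
      (cos (c * \<theta>) - cos (d * \<theta>)) / 2) (at \<theta>)"
      using cd by (auto intro!: derivative_eq_intros simp: field_simps)
    also have "(cos (c * \<theta>) - cos (d * \<theta>)) / 2 = sin (real (i + 1) * \<theta>) * sin (real (j + 1) * \<theta>)"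
      by (subst sin_times_sin) (simp add: c_def d_def algebra_simps)
    finally show ?thesis .
  qed
  moreover have "sin (c * pi) = 0" "sin (d * pi) = 0"
    using sin_npi_int[of "int i - int j"] sin_npi[of "i + j + 2"]
    by (simp_all only: c_def d_def mult.commute)
  ultimately show ?thesis
    by (intro that[of "\<lambda>\<theta>. sin (c * \<theta>) / (2 * c) - sin (d * \<theta>) / (2 * d)"]) (use False in simp_all)
qed

text \<open>The substitution \<open>t = cos \<theta>\<close> is carried out on antiderivatives: by
  \<open>sin_times_cheb_cos\<close>, the negative of \<open>F\<close> composed with
  \<open>arccos\<close> has the integrand as derivative. The interior form of the fundamental
  theorem is used because \<open>arccos\<close> is not differentiable at the endpoints.\<close>

lemma cheb_orthogonal:
  "integrable lborel (\<lambda>t. cheb_weight t * (cheb i t * cheb j t))"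
  "(LINT t|lborel. cheb_weight t * (cheb i t * cheb j t)) = (if i = j then pi / 2 else 0)"
proof -
  define g where "g t = sqrt (1 - t\<^sup>2) * (cheb i t * cheb j t)" for t
  obtain F where F: "\<And>\<theta>. (F has_real_derivative sin (real (i + 1) * \<theta>) * sin (real (j + 1) * \<theta>)) (at \<theta>)"
    "F pi - F 0 = (if i = j then pi / 2 else 0)" using sin_sin_antiderivative by blast
  have cont: "continuous_on {-1..1} g" unfolding g_def by (intro continuous_intros)
  have set_int: "set_integrable lborel {-1..1} g"
    unfolding set_integrable_def by (rule borel_integrable_compact) (use cont in auto)
  have eq: "cheb_weight t * (cheb i t * cheb j t) = indicator {-1..1} t *\<^sub>R g t" for t
    by (simp add: cheb_weight_def g_def)
  show "integrable lborel (\<lambda>t. cheb_weight t * (cheb i t * cheb j t))"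
    using set_int unfolding eq set_integrable_def .
  have "(g has_integral (- F (arccos 1)) - (- F (arccos (-1)))) {-1..1}"
  proof (rule fundamental_theorem_of_calculus_interior)
    have "continuous_on UNIV F" using F(1) by (meson DERIV_isCont continuous_at_imp_continuous_on)
    then show "continuous_on {-1..1} (\<lambda>t. - F (arccos t))"
      by (intro continuous_intros continuous_on_compose2[of UNIV F "{-1..1}" arccos]) (auto intro!: continuous_intros)
    fix t :: real assume t: "t \<in> {-1<..<1}"
    then have t': "-1 < t" "t < 1" by auto
    define \<theta> where "\<theta> = arccos t"
    have cos: "cos \<theta> = t" unfolding \<theta>_def using t' by simp
    have sin: "sin \<theta> = sqrt (1 - t\<^sup>2)" unfolding \<theta>_def using t' by (simp add: sin_arccos)
    have "t\<^sup>2 < 1" using t' by (simp add: abs_square_less_1)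
    then have pos: "sqrt (1 - t\<^sup>2) > 0" by simp
    have "((\<lambda>t. F (arccos t)) has_real_derivative
        sin (real (i + 1) * arccos t) * sin (real (j + 1) * arccos t) * inverse (- sqrt (1 - t\<^sup>2))) (at t)"
      by (rule DERIV_chain2[OF F(1) DERIV_arccos[OF t']])
    then have "((\<lambda>t. - F (arccos t)) has_real_derivative
        - (sin (real (i + 1) * \<theta>) * sin (real (j + 1) * \<theta>) * inverse (- sqrt (1 - t\<^sup>2)))) (at t)"
      unfolding \<theta>_def by (rule DERIV_minus)
    moreover have "- (sin (real (i + 1) * \<theta>) * sin (real (j + 1) * \<theta>) * inverse (- sqrt (1 - t\<^sup>2))) = g t"
      unfolding sin_times_cheb_cos[symmetric] cos sin g_def using pos by (simp add: field_simps)
    ultimately show "((\<lambda>t. - F (arccos t)) has_vector_derivative g t) (at t)"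
      by (simp add: has_real_derivative_iff_has_vector_derivative)
  qed simp
  then have "integral {-1..1} g = (if i = j then pi / 2 else 0)"
    using F(2) by (simp add: integral_unique)
  then show "(LINT t|lborel. cheb_weight t * (cheb i t * cheb j t)) = (if i = j then pi / 2 else 0)"
    using set_borel_integral_eq_integral(2)[OF set_int]
    by (simp add: eq set_lebesgue_integral_def)
qed

lemma cheb_orthogonal_affine:
  assumes "r > 0"
  shows "integrable lborel (\<lambda>x. cheb_weight ((x - a) / r) * (cheb i ((x - a) / r) * cheb j ((x - a) / r)))"
    and "(LINT x|lborel. cheb_weight ((x - a) / r) * (cheb i ((x - a) / r) * cheb j ((x - a) / r)))
      = (if i = j then r * (pi / 2) else 0)"
proof -
  let ?g = "\<lambda>t. cheb_weight t * (cheb i t * cheb j t)"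
  have eq: "(\<lambda>t. ?g ((a + r * t - a) / r)) = ?g" using assms by simp
  show "integrable lborel (\<lambda>x. ?g ((x - a) / r))"
    using assms lborel_integrable_real_affine_iff[of r "\<lambda>x. ?g ((x - a) / r)" a] cheb_orthogonal(1)[of i j]
    unfolding eq by simp
  have "(LINT x|lborel. ?g ((x - a) / r)) = r * (LINT t|lborel. ?g t)"
    using assms lborel_integral_real_affine[of r "\<lambda>x. ?g ((x - a) / r)" a] unfolding eq by simp
  then show "(LINT x|lborel. ?g ((x - a) / r)) = (if i = j then r * (pi / 2) else 0)"
    unfolding cheb_orthogonal(2) by simp
qed

section \<open>Tensor products of Chebyshev polynomials on a rectangle\<close>

lemma lborel_prod_vec:
  fixes g :: "'d::finite \<Rightarrow> real \<Rightarrow> real"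
  assumes "\<And>i. integrable lborel (g i)"
  shows "integrable lborel (\<lambda>x::real ^ 'd. \<Prod>i\<in>UNIV. g i (x $ i))"
    and "(LINT x|lborel. (\<Prod>i\<in>UNIV. g i ((x::real ^ 'd) $ i))) = (\<Prod>i\<in>UNIV. LINT t|lborel. g i t)"
proof -
  interpret product_sigma_finite "\<lambda>_::real ^ 'd. lborel :: real measure" ..
  \<comment> \<open>The product measure behind \<open>lborel\<close> is indexed by basis vectors,
    the family \<open>g\<close> by coordinates; \<open>ix\<close> translates the former into the
    latter.\<close>
  define ix :: "real ^ 'd \<Rightarrow> 'd" where "ix = the_inv (\<lambda>i. axis i 1)"
  have inj: "inj (\<lambda>i::'d. axis i (1::real))" by (auto simp: inj_on_def axis_eq_axis)
  have ix: "ix (axis i 1) = i" for i unfolding ix_def by (rule the_inv_f_f[OF inj])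
  have B: "(Basis :: (real ^ 'd) set) = range (\<lambda>i. axis i 1)" by (auto simp: Basis_vec_def)
  have reindex: "(\<Prod>b\<in>Basis. h b) = (\<Prod>i\<in>UNIV. h (axis i 1))" for h :: "real ^ 'd \<Rightarrow> real"
    unfolding B by (subst prod.reindex[OF inj]) simp
  let ?T = "\<lambda>f::real ^ 'd \<Rightarrow> real. \<Sum>b\<in>Basis. f b *\<^sub>R b"
  let ?P = "\<lambda>x::real ^ 'd. \<Prod>i\<in>UNIV. g i (x $ i)"
  have coord: "?T f $ i = f (axis i 1)" for f i
  proof -
    have "?T f $ i = ?T f \<bullet> axis i 1" by (simp add: inner_axis)
    also have "\<dots> = f (axis i 1)" by (rule inner_sum_left_Basis) (simp add: axis_in_Basis_iff)
    finally show ?thesis .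
  qed
  have gm: "g i \<in> borel_measurable borel" for i using borel_measurable_integrable[OF assms] by simp
  have P: "?P \<in> borel_measurable borel"
    using gm by (intro borel_measurable_prod measurable_compose[OF borel_measurable_nth]) 
  have T: "?T \<in> (\<Pi>\<^sub>M b\<in>Basis. lborel) \<rightarrow>\<^sub>M borel" by measurable
  have PT: "?P (?T f) = (\<Prod>b\<in>Basis. g (ix b) (f b))" for f
    unfolding reindex coord ix ..
  have int: "integrable (\<Pi>\<^sub>M b\<in>Basis. lborel) (\<lambda>f. \<Prod>b\<in>(Basis::(real ^ 'd) set). g (ix b) (f b))"
    by (rule product_integrable_prod) (simp_all add: assms)
  show "integrable lborel ?P"
    unfolding lborel_eq[where 'a = "real ^ 'd"] 
    by (subst integrable_distr_eq[OF T P]) (unfold PT, rule int)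
  have "(LINT x|lborel. ?P x) = (LINT f|(\<Pi>\<^sub>M b\<in>Basis. lborel). (\<Prod>b\<in>(Basis::(real ^ 'd) set). g (ix b) (f b)))"
    unfolding lborel_eq[where 'a = "real ^ 'd"] 
    by (subst integral_distr[OF T P]) (unfold PT, rule refl)
  also have "\<dots> = (\<Prod>i\<in>UNIV. LINT t|lborel. g i t)"
    by (subst product_integral_prod) (simp_all add: assms reindex ix)
  finally show "(LINT x|lborel. ?P x) = (\<Prod>i\<in>UNIV. LINT t|lborel. g i t)" .
qed

definition cheb_tensor :: "real ^ 'd \<Rightarrow> real ^ 'd \<Rightarrow> ('d \<Rightarrow> nat) \<Rightarrow> real ^ 'd \<Rightarrow> real" where
  "cheb_tensor a r \<alpha> x = (\<Prod>i\<in>UNIV. cheb (\<alpha> i) ((x $ i - a $ i) / r $ i))"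

definition tensor_weight :: "real ^ 'd \<Rightarrow> real ^ 'd \<Rightarrow> real ^ 'd \<Rightarrow> real" where
  "tensor_weight a r x = (\<Prod>i\<in>UNIV. cheb_weight ((x $ i - a $ i) / r $ i))"

text \<open>The weighted squared norm common to all \<open>cheb_tensor a r \<alpha>\<close>: every
  polynomial of the second kind has squared norm \<open>pi / 2\<close>, and rescaling to the
  rectangle contributes \<open>r $ i\<close>.\<close>

definition cheb_norm :: "real ^ 'd \<Rightarrow> real" where
  "cheb_norm r = (\<Prod>i\<in>UNIV. r $ i * (pi / 2))"

definition multi_indices :: "nat \<Rightarrow> ('d::finite \<Rightarrow> nat) set" where
  "multi_indices n = {\<alpha>. sum \<alpha> UNIV \<le> n}"

lemma multi_indices_subset: "(multi_indices n :: ('d::finite \<Rightarrow> nat) set) \<subseteq> PiE UNIV (\<lambda>_. {..n})"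
proof
  fix \<alpha> :: "'d \<Rightarrow> nat" assume "\<alpha> \<in> multi_indices n"
  then show "\<alpha> \<in> PiE UNIV (\<lambda>_. {..n})"
    using member_le_sum[of _ UNIV \<alpha>] by (fastforce simp: multi_indices_def)
qed

lemma finite_multi_indices: "finite (multi_indices n)"
  by (rule finite_subset[OF multi_indices_subset]) (simp add: finite_PiE)

lemma card_multi_indices: "card (multi_indices n :: ('d::finite \<Rightarrow> nat) set) \<le> (n + 1) ^ CARD('d)"
  using card_mono[OF finite_PiE multi_indices_subset[of n]] by (simp add: card_PiE)

lemma multi_indices_mono: "m \<le> n \<Longrightarrow> multi_indices m \<subseteq> multi_indices n"
  by (auto simp: multi_indices_def)

lemma sum_fun_upd:
  fixes \<alpha> :: "'d::finite \<Rightarrow> nat"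
  shows "sum (\<alpha>(i := l)) UNIV = sum \<alpha> (UNIV - {i}) + l"
  by (subst sum.remove[of UNIV i]) (auto intro!: sum.cong)

lemma cheb_tensor_orthogonal:
  fixes a r :: "real ^ 'd"
  assumes "\<And>i. r $ i > 0"
  shows "integrable lborel (\<lambda>x. tensor_weight a r x * (cheb_tensor a r \<alpha> x * cheb_tensor a r \<beta> x))"
    and "(LINT x|lborel. tensor_weight a r x * (cheb_tensor a r \<alpha> x * cheb_tensor a r \<beta> x))
      = (if \<alpha> = \<beta> then cheb_norm r else 0)"
proof -
  define g where "g i t = cheb_weight ((t - a $ i) / r $ i)
    * (cheb (\<alpha> i) ((t - a $ i) / r $ i) * cheb (\<beta> i) ((t - a $ i) / r $ i))" for i t
  have eq: "tensor_weight a r x * (cheb_tensor a r \<alpha> x * cheb_tensor a r \<beta> x) = (\<Prod>i\<in>UNIV. g i (x $ i))" for x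
    by (simp add: tensor_weight_def cheb_tensor_def g_def prod.distrib)
  have g: "integrable lborel (g i)" "(LINT t|lborel. g i t) = (if \<alpha> i = \<beta> i then r $ i * (pi / 2) else 0)" for i
    unfolding g_def using cheb_orthogonal_affine[OF assms] by auto
  show "integrable lborel (\<lambda>x. tensor_weight a r x * (cheb_tensor a r \<alpha> x * cheb_tensor a r \<beta> x))"
    unfolding eq by (rule lborel_prod_vec(1)[OF g(1)])
  have "(LINT x|lborel. (\<Prod>i\<in>UNIV. g i ((x::real ^ 'd) $ i))) = (\<Prod>i\<in>UNIV. if \<alpha> i = \<beta> i then r $ i * (pi / 2) else 0)"
    unfolding lborel_prod_vec(2)[OF g(1)] g(2) ..
  also have "\<dots> = (if \<alpha> = \<beta> then cheb_norm r else 0)"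
    by (auto simp: cheb_norm_def fun_eq_iff)
  finally show "(LINT x|lborel. tensor_weight a r x * (cheb_tensor a r \<alpha> x * cheb_tensor a r \<beta> x))
      = (if \<alpha> = \<beta> then cheb_norm r else 0)" unfolding eq .
qed

lemma cheb_tensor_Parseval:
  fixes a r :: "real ^ 'd" and e :: "('d \<Rightarrow> nat) \<Rightarrow> real"
  assumes "\<And>i. r $ i > 0" "finite A"
  shows "integrable lborel (\<lambda>x. tensor_weight a r x * (\<Sum>\<alpha>\<in>A. e \<alpha> * cheb_tensor a r \<alpha> x)\<^sup>2)"
    and "(LINT x|lborel. tensor_weight a r x * (\<Sum>\<alpha>\<in>A. e \<alpha> * cheb_tensor a r \<alpha> x)\<^sup>2)
      = cheb_norm r * (\<Sum>\<alpha>\<in>A. (e \<alpha>)\<^sup>2)"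
proof -
  have eq: "tensor_weight a r x * (\<Sum>\<alpha>\<in>A. e \<alpha> * cheb_tensor a r \<alpha> x)\<^sup>2
    = (\<Sum>\<alpha>\<in>A. \<Sum>\<beta>\<in>A. (e \<alpha> * e \<beta>) * (tensor_weight a r x * (cheb_tensor a r \<alpha> x * cheb_tensor a r \<beta> x)))" for x
    unfolding power2_eq_square sum_product by (simp add: sum_distrib_left mult_ac)
  note orth = cheb_tensor_orthogonal[OF assms(1)]
  show "integrable lborel (\<lambda>x. tensor_weight a r x * (\<Sum>\<alpha>\<in>A. e \<alpha> * cheb_tensor a r \<alpha> x)\<^sup>2)"
    unfolding eq by (intro Bochner_Integration.integrable_sum integrable_mult_right orth)
  have "(LINT x|lborel. tensor_weight a r x * (\<Sum>\<alpha>\<in>A. e \<alpha> * cheb_tensor a r \<alpha> x)\<^sup>2)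
    = (\<Sum>\<alpha>\<in>A. \<Sum>\<beta>\<in>A. (e \<alpha> * e \<beta>) * (if \<alpha> = \<beta> then cheb_norm r else 0))"
    unfolding eq by (simp add: Bochner_Integration.integral_sum Bochner_Integration.integrable_sum orth)
  also have "\<dots> = (\<Sum>\<alpha>\<in>A. \<Sum>\<beta>\<in>A. if \<alpha> = \<beta> then e \<alpha> * e \<beta> * cheb_norm r else 0)"
    by (intro sum.cong refl) simp
  also have "\<dots> = cheb_norm r * (\<Sum>\<alpha>\<in>A. (e \<alpha>)\<^sup>2)"
    using assms(2) by (simp add: sum.delta power2_eq_square sum_distrib_left mult_ac)
  finally show "(LINT x|lborel. tensor_weight a r x * (\<Sum>\<alpha>\<in>A. e \<alpha> * cheb_tensor a r \<alpha> x)\<^sup>2)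
      = cheb_norm r * (\<Sum>\<alpha>\<in>A. (e \<alpha>)\<^sup>2)" .
qed

lemma rectangle_eq_cbox: "rectangle a r = cbox (a - r) (a + r)"
  by (auto simp: rectangle_def mem_box_cart)

text \<open>This comparison turns Parseval's identity into a bound for the coefficients by an
  unweighted integral over the rectangle.\<close>

lemma tensor_weight_le:
  fixes a r :: "real ^ 'd"
  assumes "\<And>i. r $ i > 0" shows "tensor_weight a r x \<le> indicator (rectangle a r) x"
proof (cases "x \<in> rectangle a r")
  case True
  have "tensor_weight a r x \<le> (\<Prod>i\<in>(UNIV::'d set). 1)"
    unfolding tensor_weight_def
    by (intro prod_mono conjI cheb_weight_nonneg order_trans[OF cheb_weight_le]) (simp add: indicator_def)
  then show ?thesis using True by simp
next
  case False
  then obtain i where "\<not> (a $ i - r $ i \<le> x $ i \<and> x $ i \<le> a $ i + r $ i)" by (auto simp: rectangle_def)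
  then have "cheb_weight ((x $ i - a $ i) / r $ i) = 0"
    using assms[of i] by (auto simp: cheb_weight_def indicator_def field_simps)
  then have "tensor_weight a r x = 0" unfolding tensor_weight_def by (intro prod_zero) auto
  then show ?thesis by simp
qed

text \<open>The coefficients are indexed by \<open>A\<close> rather than by the spanning functions,
  so \<open>g\<close> may fail to be injective.\<close>

lemma cspan_image_coefficients:
  assumes "finite A" "q \<in> cspan (g ` A)"
  obtains c where "q = (\<Sum>\<alpha>\<in>A. cscale (c \<alpha>) (g \<alpha>))"
proof -
  have "\<exists>c. q = (\<Sum>\<alpha>\<in>A. cscale (c \<alpha>) (g \<alpha>))" using assms(2)
  proof (induct rule: cfun.span_induct_alt)
    case base
    show ?case by (rule exI[of _ "\<lambda>_. 0"]) simp
  next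
    case (step c x y)
    from step(1) obtain \<beta> where \<beta>: "\<beta> \<in> A" "x = g \<beta>" by auto
    from step(2) obtain c' where c': "y = (\<Sum>\<alpha>\<in>A. cscale (c' \<alpha>) (g \<alpha>))" by blast
    have "cscale c x = (\<Sum>\<alpha>\<in>A. cscale (if \<alpha> = \<beta> then c else 0) (g \<alpha>))"
    proof -
      have "(\<Sum>\<alpha>\<in>A. cscale (if \<alpha> = \<beta> then c else 0) (g \<alpha>)) = (\<Sum>\<alpha>\<in>A. if \<alpha> = \<beta> then cscale c (g \<beta>) else 0)"
        by (intro sum.cong refl) simp
      also have "\<dots> = cscale c x" using assms(1) \<beta> by (simp add: sum.delta)
      finally show ?thesis by simp
    qed
    then have "cscale c x + y = (\<Sum>\<alpha>\<in>A. cscale ((if \<alpha> = \<beta> then c else 0) + c' \<alpha>) (g \<alpha>))"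
      unfolding c' cfun.scale_left_distrib sum.distrib by simp
    then show ?case by (intro exI)
  qed
  then show ?thesis using that by blast
qed

definition wcheb :: "(real ^ 'd \<Rightarrow> real) \<Rightarrow> real ^ 'd \<Rightarrow> real ^ 'd \<Rightarrow> ('d \<Rightarrow> nat) \<Rightarrow> real ^ 'd \<Rightarrow> complex" where
  "wcheb w a r \<alpha> x = of_real (w x * cheb_tensor a r \<alpha> x)"

lemma cheb_tensor_upd: "cheb_tensor a r (\<alpha>(i := l)) x =
   cheb l ((x $ i - a $ i) / r $ i) * (\<Prod>j\<in>UNIV - {i}. cheb (\<alpha> j) ((x $ j - a $ j) / r $ j))"
  unfolding cheb_tensor_def by (subst prod.remove[of UNIV i]) (auto intro!: prod.cong)

text \<open>Writing \<open>(x - p) $ i\<close> as \<open>r $ i\<close> times the normalized variable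
  plus \<open>a $ i - p $ i\<close> reduces this to \<open>times_cheb\<close>. If
  \<open>\<alpha> i = 0\<close>, the truncated index \<open>\<alpha> i - 1\<close> is harmless,
  since its coefficient is 0.\<close>

lemma coord_times_wcheb:
  fixes a r p :: "real ^ 'd"
  assumes "\<And>i. r $ i > 0"
  shows "(\<lambda>x. of_real ((x - p) $ i) * wcheb w a r \<alpha> x) =
     cscale (of_real (r $ i / 2)) (wcheb w a r (\<alpha>(i := Suc (\<alpha> i))))
     + cscale (of_real (if \<alpha> i = 0 then 0 else r $ i / 2)) (wcheb w a r (\<alpha>(i := \<alpha> i - 1)))
     + cscale (of_real (a $ i - p $ i)) (wcheb w a r \<alpha>)"
proof
  fix x
  define t P where "t = (x $ i - a $ i) / r $ i" and "P = (\<Prod>j\<in>UNIV - {i}. cheb (\<alpha> j) ((x $ j - a $ j) / r $ j))"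
  have U: "cheb_tensor a r (\<alpha>(i := l)) x = cheb l t * P" for l
    unfolding cheb_tensor_upd t_def P_def ..
  have U0: "cheb_tensor a r \<alpha> x = cheb (\<alpha> i) t * P" using U[of "\<alpha> i"] by simp
  have "(x - p) $ i = r $ i * t + (a $ i - p $ i)" using assms[of i] by (simp add: t_def)
  then have "(x - p) $ i * cheb (\<alpha> i) t = r $ i * (t * cheb (\<alpha> i) t) + (a $ i - p $ i) * cheb (\<alpha> i) t"
    by (simp add: algebra_simps)
  also have "\<dots> = r $ i / 2 * cheb (Suc (\<alpha> i)) t + (if \<alpha> i = 0 then 0 else r $ i / 2) * cheb (\<alpha> i - 1) t
     + (a $ i - p $ i) * cheb (\<alpha> i) t"
    unfolding times_cheb by (simp add: algebra_simps)
  finally have "(x - p) $ i * cheb (\<alpha> i) t = \<dots>" .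
  from arg_cong[OF this, of "\<lambda>z. z * (w x * P)"]
  have *: "(x - p) $ i * (w x * (cheb (\<alpha> i) t * P)) =
     (r $ i / 2) * (w x * (cheb (Suc (\<alpha> i)) t * P))
     + (if \<alpha> i = 0 then 0 else r $ i / 2) * (w x * (cheb (\<alpha> i - 1) t * P))
     + (a $ i - p $ i) * (w x * (cheb (\<alpha> i) t * P))"
    by (simp only: distrib_right distrib_left mult.assoc mult.left_commute mult.commute)
  show "of_real ((x - p) $ i) * wcheb w a r \<alpha> x =
     (cscale (of_real (r $ i / 2)) (wcheb w a r (\<alpha>(i := Suc (\<alpha> i))))
     + cscale (of_real (if \<alpha> i = 0 then 0 else r $ i / 2)) (wcheb w a r (\<alpha>(i := \<alpha> i - 1)))
     + cscale (of_real (a $ i - p $ i)) (wcheb w a r \<alpha>)) x"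
    unfolding wcheb_def cscale_def plus_fun_apply U U0
    by (simp only: of_real_mult[symmetric] of_real_add[symmetric] *)
qed

text \<open>Multiplication by one coordinate raises the degree of a Chebyshev span by at most one,
  and each weighted monomial arises from the constant tensor by such multiplications.\<close>

lemma wpoly_subset_cspan_wcheb:
  fixes a r :: "real ^ 'd"
  assumes r: "\<And>i. r $ i > 0"
  shows "wpoly w p n \<subseteq> cspan (wcheb w a r ` multi_indices n)"
proof -
  let ?S = "\<lambda>n. cspan (wcheb w a r ` multi_indices n)"
  have mono: "?S m \<subseteq> ?S n" if "m \<le> n" for m n
    using multi_indices_mono[OF that] by (intro cfun.span_mono) auto
  have step: "(\<lambda>x. of_real ((x - p) $ i) * q x) \<in> ?S (Suc l)" if "q \<in> ?S l" for q l i
    using that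
  proof (induct rule: cfun.span_induct_alt)
    case base
    have "(\<lambda>x. of_real ((x - p) $ i) * (0 :: real ^ 'd \<Rightarrow> complex) x) = 0" by (simp add: fun_eq_iff)
    then show ?case using cfun.span_zero by metis
  next
    case (step c x y)
    from step(1) obtain \<alpha> where \<alpha>: "\<alpha> \<in> multi_indices l" "x = wcheb w a r \<alpha>" by auto
    have s: "sum \<alpha> UNIV = sum \<alpha> (UNIV - {i}) + \<alpha> i" by (simp add: sum.remove[of UNIV i])
    have "\<alpha>(i := Suc (\<alpha> i)) \<in> multi_indices (Suc l)" "\<alpha>(i := \<alpha> i - 1) \<in> multi_indices (Suc l)"
      "\<alpha> \<in> multi_indices (Suc l)"
      using \<alpha>(1) s unfolding multi_indices_def mem_Collect_eq sum_fun_upd by linarith+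
    then have "(\<lambda>z. of_real ((z - p) $ i) * x z) \<in> ?S (Suc l)"
      unfolding \<alpha>(2) coord_times_wcheb[OF r] by (intro cfun.span_add cfun.span_scale cfun.span_base) auto
    then have "cscale c (\<lambda>z. of_real ((z - p) $ i) * x z) + (\<lambda>z. of_real ((z - p) $ i) * y z) \<in> ?S (Suc l)"
      by (intro cfun.span_add cfun.span_scale step(2))
    also have "cscale c (\<lambda>z. of_real ((z - p) $ i) * x z) + (\<lambda>z. of_real ((z - p) $ i) * y z)
      = (\<lambda>z. of_real ((z - p) $ i) * (cscale c x + y) z)"
      by (simp add: fun_eq_iff cscale_def algebra_simps)
    finally show ?case .
  qed
  have mon: "wmonom w p is \<in> ?S (length is)" for "is"
  proof (induct "is")
    case Nil
    have "wmonom w p [] = wcheb w a r (\<lambda>_. 0)"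
      by (simp add: fun_eq_iff wmonom_def wcheb_def monom_at_def cheb_tensor_def)
    then show ?case by (auto intro!: cfun.span_base simp: multi_indices_def)
  next
    case (Cons i "is")
    have "wmonom w p (i # is) = (\<lambda>x. of_real ((x - p) $ i) * wmonom w p is x)"
      by (simp add: fun_eq_iff wmonom_def monom_at_def)
    then show ?case using step[OF Cons, of i] by simp
  qed
  show ?thesis unfolding wpoly_def
  proof (rule cfun.span_minimal)
    show "{wmonom w p is | is. length is \<le> n} \<subseteq> ?S n" using mon mono by blast
  qed simp
qed

text \<open>In \<open>abs_bounded p \<tau> P A\<close> the number \<open>A\<close> bounds the sum of the \<open>\<bar>c\<^sub>\<alpha>\<bar> \<tau>\<^sup>\<alpha>\<close> for the coefficients
  \<open>c\<^sub>\<alpha>\<close> of the polynomial \<open>P\<close> at \<open>p\<close>.\<close>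

inductive abs_bounded :: "real ^ 'd \<Rightarrow> ('d \<Rightarrow> real) \<Rightarrow> (real ^ 'd \<Rightarrow> real) \<Rightarrow> real \<Rightarrow> bool"
  for p :: "real ^ 'd" and \<tau> :: "'d \<Rightarrow> real" where
  one: "abs_bounded p \<tau> (\<lambda>_. 1) 1"
| add: "abs_bounded p \<tau> P A \<Longrightarrow> abs_bounded p \<tau> Q B \<Longrightarrow> abs_bounded p \<tau> (\<lambda>y. P y + Q y) (A + B)"
| scale: "abs_bounded p \<tau> P A \<Longrightarrow> abs_bounded p \<tau> (\<lambda>y. c * P y) (\<bar>c\<bar> * A)"
| coord: "abs_bounded p \<tau> P A \<Longrightarrow> abs_bounded p \<tau> (\<lambda>y. (y - p) $ i * P y) (\<tau> i * A)"
| mono: "abs_bounded p \<tau> P A \<Longrightarrow> A \<le> B \<Longrightarrow> abs_bounded p \<tau> P B"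

lemma abs_bounded_nonneg: "abs_bounded p \<tau> P A \<Longrightarrow> (\<And>i. 0 \<le> \<tau> i) \<Longrightarrow> 0 \<le> A"
  by (induct rule: abs_bounded.induct) auto

text \<open>With the scale \<open>r $ i / 2\<close> the linear part of twice the normalized variable
  costs exactly 1, so the factor in the recursion costs \<open>1 + 2 * T\<close>, one less than
  \<open>2 * (1 + T)\<close>. That margin absorbs the subtracted polynomial of lower index. With the
  scale \<open>r $ i\<close> the factor would cost \<open>2 + 2 * T\<close>, and the growth rate
  \<open>2 * (1 + T)\<close> could not be maintained.\<close>

lemma abs_bounded_times_cheb:
  fixes a r p :: "real ^ 'd"
  assumes r: "\<And>i. r $ i > 0" and P: "abs_bounded p (\<lambda>i. r $ i / 2) P A"
    and D: "2 * (1 + \<bar>a $ i - p $ i\<bar> / r $ i) \<le> D"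
  shows "abs_bounded p (\<lambda>i. r $ i / 2) (\<lambda>y. cheb l ((y $ i - a $ i) / r $ i) * P y) (D ^ l * A)"
proof -
  define T where "T = \<bar>a $ i - p $ i\<bar> / r $ i"
  have T: "T \<ge> 0" using r[of i] by (simp add: T_def)
  let ?t = "\<lambda>y. (y $ i - a $ i) / r $ i"
  let ?b = "abs_bounded p (\<lambda>i. r $ i / 2)"
  have D2: "2 * (1 + T) \<le> D" using D by (simp add: T_def)
  have A: "A \<ge> 0" by (rule abs_bounded_nonneg[OF P]) (simp add: less_imp_le[OF r])
  have t: "?b (\<lambda>y. 2 * ?t y * Q y) ((1 + 2 * T) * B)" if "?b Q B" for Q B
  proof -
    have "?b (\<lambda>y. (2 / r $ i) * ((y - p) $ i * Q y) + (2 * (p $ i - a $ i) / r $ i) * Q y)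
      (\<bar>2 / r $ i\<bar> * ((r $ i / 2) * B) + \<bar>2 * (p $ i - a $ i) / r $ i\<bar> * B)"
      by (intro abs_bounded.add abs_bounded.scale abs_bounded.coord that)
    also have "(\<lambda>y. (2 / r $ i) * ((y - p) $ i * Q y) + (2 * (p $ i - a $ i) / r $ i) * Q y)
       = (\<lambda>y. 2 * ?t y * Q y)"
    proof
      fix y
      have "2 * ?t y = (2 / r $ i) * (y - p) $ i + 2 * (p $ i - a $ i) / r $ i"
        by (simp add: diff_divide_distrib right_diff_distrib)
      then show "(2 / r $ i) * ((y - p) $ i * Q y) + (2 * (p $ i - a $ i) / r $ i) * Q y = 2 * ?t y * Q y"
        by (simp only: distrib_right mult.assoc)
    qed
    also have "\<bar>2 / r $ i\<bar> * ((r $ i / 2) * B) + \<bar>2 * (p $ i - a $ i) / r $ i\<bar> * B = (1 + 2 * T) * B"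
    proof -
      have "\<bar>2 * (p $ i - a $ i) / r $ i\<bar> = 2 * T"
        unfolding T_def abs_mult abs_divide abs_numeral abs_of_pos[OF r] abs_minus_commute[of "p $ i"] by simp
      moreover have "\<bar>2 / r $ i\<bar> * ((r $ i / 2) * B) = B" using r[of i] by simp
      ultimately show ?thesis by (simp only: distrib_right mult_1_left)
    qed
    finally show ?thesis .
  qed
  show ?thesis
  proof (induct l rule: induct_nat_012)
    case 0 then show ?case using P by simp
  next
    case 1
    have "?b (\<lambda>y. 2 * ?t y * P y) (D * A)"
      by (rule abs_bounded.mono[OF t[OF P]]) (use D2 A T in \<open>auto intro!: mult_right_mono\<close>)
    then show ?case by (simp add: mult_ac)
  next
    case (ge2 l)
    let ?B = "D ^ l * A"
    have B: "?B \<ge> 0" using A D2 T by simp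
    have "?b (\<lambda>y. 2 * ?t y * (cheb (Suc l) (?t y) * P y) + (-1) * (cheb l (?t y) * P y))
       ((1 + 2 * T) * (D ^ Suc l * A) + \<bar>-1\<bar> * ?B)"
      by (intro abs_bounded.add abs_bounded.scale t ge2)
    also have "(\<lambda>y. 2 * ?t y * (cheb (Suc l) (?t y) * P y) + (-1) * (cheb l (?t y) * P y))
       = (\<lambda>y. cheb (Suc (Suc l)) (?t y) * P y)"
      by (simp add: fun_eq_iff left_diff_distrib)
    finally show ?case
    proof (rule abs_bounded.mono)
      \<comment> \<open>From \<open>1 + 2 * T \<le> D - 1\<close> and \<open>1 \<le> D\<close>; the
        right-hand side equals \<open>D * D\<close>.\<close>
      have "(1 + 2 * T) * D + 1 \<le> (D - 1) * D + 1 * D"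
        using D2 T by (intro add_mono mult_right_mono) auto
      then have "((1 + 2 * T) * D + 1) * ?B \<le> (D * D) * ?B"
        using B by (intro mult_right_mono) (auto simp: algebra_simps)
      then show "(1 + 2 * T) * (D ^ Suc l * A) + \<bar>-1\<bar> * ?B \<le> D ^ Suc (Suc l) * A"
        by (simp add: algebra_simps)
    qed
  qed
qed

lemma abs_bounded_cheb_tensor:
  fixes a r p :: "real ^ 'd"
  assumes r: "\<And>i. r $ i > 0" and D: "\<And>i. 2 * (1 + \<bar>a $ i - p $ i\<bar> / r $ i) \<le> D"
  shows "abs_bounded p (\<lambda>i. r $ i / 2) (cheb_tensor a r \<alpha>) (D ^ sum \<alpha> UNIV)"
proof -
  have "abs_bounded p (\<lambda>i. r $ i / 2) (\<lambda>y. \<Prod>i\<in>S. cheb (\<alpha> i) ((y $ i - a $ i) / r $ i)) (D ^ sum \<alpha> S)"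
    if "finite S" for S
    using that
  proof induct
    case (insert i S)
    show ?case using abs_bounded_times_cheb[OF r insert(3) D[of i], of "\<alpha> i"] insert(1,2)
      by (simp add: power_add)
  qed (simp add: abs_bounded.one)
  then show ?thesis unfolding cheb_tensor_def[abs_def] by simp
qed

section \<open>From L2 norms on a rectangle to inner products in \<open>H\<close>\<close>

context weighted_rkhs
begin

text \<open>The extra factor \<open>monom_at p is\<close> strengthens the induction: in the case
  \<open>coord\<close> the new coordinate moves into the list. Membership in \<open>H\<close> is
  carried along because additivity and homogeneity of \<open>ip\<close> presuppose it.\<close>

lemma abs_bounded_functional:
  assumes P: "abs_bounded p \<tau> P A" and g: "g \<in> H"
    and C: "\<And>is. cmod (ip (wmonom w p is) g) \<le> C * (\<Prod>i\<leftarrow>is. \<tau> i)"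
  shows "(\<lambda>y. of_real (w y * (monom_at p is y * P y))) \<in> H \<and>
    cmod (ip (\<lambda>y. of_real (w y * (monom_at p is y * P y))) g) \<le> C * (\<Prod>i\<leftarrow>is. \<tau> i) * A"
  using P
proof (induct arbitrary: "is" rule: abs_bounded.induct)
  case one
  have "wmonom w p is \<in> H" by (rule subsetD[OF wpoly_subset wmonom_in_wpoly[OF order_refl]])
  moreover have "(\<lambda>y. of_real (w y * (monom_at p is y * 1))) = wmonom w p is"
    by (rule ext) (simp only: wmonom_def mult_1_right)
  ultimately show ?case using C[of "is"] by (simp only: mult_1_right simp_thms)
next
  case (add P A Q B)
  let ?f = "\<lambda>P y. complex_of_real (w y * (monom_at p is y * P y))"
  have eq: "?f (\<lambda>y. P y + Q y) = ?f P + ?f Q" by (simp add: fun_eq_iff distrib_left)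
  note P = add(2)[of "is"] and Q = add(4)[of "is"]
  have "ip (?f P + ?f Q) g = ip (?f P) g + ip (?f Q) g" using P Q g by (intro ip_add) auto
  then have "cmod (ip (?f P + ?f Q) g) \<le> cmod (ip (?f P) g) + cmod (ip (?f Q) g)"
    by (simp only: norm_triangle_ineq)
  also have "\<dots> \<le> C * (\<Prod>i\<leftarrow>is. \<tau> i) * (A + B)"
    using P Q unfolding distrib_left by (intro add_mono) blast+
  finally show ?case unfolding eq using P Q mem_add by blast
next
  case (scale P A c)
  let ?f = "\<lambda>P y. complex_of_real (w y * (monom_at p is y * P y))"
  have eq: "?f (\<lambda>y. c * P y) = cscale (of_real c) (?f P)" by (simp add: fun_eq_iff cscale_def)
  note P = scale(2)[of "is"]
  have "cmod (ip (cscale (of_real c) (?f P)) g) = \<bar>c\<bar> * cmod (ip (?f P) g)"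
    using P g by (simp add: ip_scale norm_mult)
  also have "\<dots> \<le> \<bar>c\<bar> * (C * (\<Prod>i\<leftarrow>is. \<tau> i) * A)" using P by (intro mult_left_mono) auto
  also have "\<dots> = C * (\<Prod>i\<leftarrow>is. \<tau> i) * (\<bar>c\<bar> * A)" by (simp only: mult_ac)
  finally show ?case unfolding eq using P mem_scale by blast
next
  case (coord P A i)
  have "(\<lambda>y. of_real (w y * (monom_at p is y * ((y - p) $ i * P y))))
      = (\<lambda>y. complex_of_real (w y * (monom_at p (i # is) y * P y)))"
    by (simp only: monom_at_def list.map prod_list.Cons mult_ac)
  moreover have "C * (\<Prod>i\<leftarrow>i # is. \<tau> i) * A = C * (\<Prod>i\<leftarrow>is. \<tau> i) * (\<tau> i * A)"
    by simp
  ultimately show ?case using coord(2)[of "i # is"] by (simp only:)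
next
  case (mono P A B)
  have "0 \<le> C * (\<Prod>i\<leftarrow>is. \<tau> i)" using C[of "is"] norm_ge_zero order_trans by blast
  from mult_left_mono[OF mono(3) this] show ?case
    using mono(2)[of "is"] order_trans by blast
qed

text \<open>In the Chebyshev expansion of \<open>q\<close>, Parseval bounds each coefficient by the
  L2 norm, \<open>abs_bounded_functional\<close> bounds the pairing of each tensor with
  \<open>g\<close> by \<open>C * D ^ n\<close>, and at most \<open>(n + 1) ^ CARD('d)\<close> terms
  occur.\<close>

lemma ip_wpoly_bound:
  fixes a r :: "real ^ 'd"
  assumes r: "\<And>i. r $ i > 0"
    and g: "g \<in> H" and q: "q \<in> wpoly w p n"
    and C: "\<And>is. cmod (ip (wmonom w p is) g) \<le> C * (\<Prod>i\<leftarrow>is. r $ i / 2)"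
    and D: "\<And>i. 2 * (1 + \<bar>a $ i - p $ i\<bar> / r $ i) \<le> D"
    and \<delta>: "\<delta> > 0" "\<And>y. y \<in> rectangle a r \<Longrightarrow> \<delta> \<le> w y"
    and int: "integrable lborel (\<lambda>y. indicator (rectangle a r) y * (cmod (q y))\<^sup>2)"
    and J: "(LINT y|lborel. indicator (rectangle a r) y * (cmod (q y))\<^sup>2) \<le> J\<^sup>2" "J \<ge> 0"
  shows "cmod (ip q g) \<le> real (n + 1) ^ CARD('d) * C * D ^ n * (J / (\<delta> * sqrt (cheb_norm r)))"
proof -
  have K: "cheb_norm r > 0" unfolding cheb_norm_def using r by (intro prod_pos) auto
  have D1: "1 \<le> D"
  proof -
    have "1 \<le> D" if "0 \<le> T" "2 * (1 + T) \<le> D" for T :: real using that by simp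
    from this[OF divide_nonneg_pos[OF abs_ge_zero r] D] show ?thesis .
  qed
  have C0: "0 \<le> C" using C[of "[]"] by (auto intro: order_trans[OF norm_ge_zero])
  obtain c where c: "q = (\<Sum>\<alpha>\<in>multi_indices n. cscale (c \<alpha>) (wcheb w a r \<alpha>))"
    using cspan_image_coefficients[OF finite_multi_indices] q wpoly_subset_cspan_wcheb[OF r] by blast
  \<comment> \<open>\<open>cheb_tensor_Parseval\<close> is about real coefficients, so real and
    imaginary parts are treated separately and added afterwards.\<close>
  define x y where "x \<alpha> = Re (c \<alpha>)" and "y \<alpha> = Im (c \<alpha>)" for \<alpha>
  have U_mem: "wcheb w a r \<alpha> \<in> H" and
    U_bound: "cmod (ip (wcheb w a r \<alpha>) g) \<le> C * D ^ sum \<alpha> UNIV" for \<alpha>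
  proof -
    have eq: "(\<lambda>y. of_real (w y * (monom_at p [] y * cheb_tensor a r \<alpha> y))) = wcheb w a r \<alpha>"
      by (rule ext) (simp add: wcheb_def monom_at_def)
    from abs_bounded_functional[OF abs_bounded_cheb_tensor[OF r D] g C, of "[]" \<alpha>]
    show "wcheb w a r \<alpha> \<in> H" "cmod (ip (wcheb w a r \<alpha>) g) \<le> C * D ^ sum \<alpha> UNIV"
      unfolding eq by simp_all
  qed
  let ?W = "tensor_weight a r"
  let ?S = "\<lambda>e z. \<Sum>\<alpha>\<in>multi_indices n. e \<alpha> * cheb_tensor a r \<alpha> z"
  have q_eq: "(cmod (q z))\<^sup>2 = (w z)\<^sup>2 * ((?S x z)\<^sup>2 + (?S y z)\<^sup>2)" for z
  proof -
    have "Re (q z) = w z * ?S x z" "Im (q z) = w z * ?S y z"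
      by (simp_all add: c sum_fun_apply cscale_def wcheb_def x_def y_def sum_distrib_left mult_ac)
    then show ?thesis by (simp add: cmod_power2 power_mult_distrib distrib_left)
  qed
  have le: "?W z * (?S x z)\<^sup>2 + ?W z * (?S y z)\<^sup>2 \<le> (1 / \<delta>\<^sup>2) * (indicator (rectangle a r) z * (cmod (q z))\<^sup>2)" for z
  proof -
    let ?s = "(?S x z)\<^sup>2 + (?S y z)\<^sup>2"
    have "?W z * ?s \<le> indicator (rectangle a r) z * ?s"
      by (intro mult_right_mono tensor_weight_le r) auto
    also have "\<dots> \<le> (1 / \<delta>\<^sup>2) * (indicator (rectangle a r) z * (cmod (q z))\<^sup>2)"
    proof (cases "z \<in> rectangle a r")
      case True
      then have "\<delta>\<^sup>2 \<le> (w z)\<^sup>2" using \<delta> by (intro power_mono) auto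
      then have "\<delta>\<^sup>2 * ?s \<le> (w z)\<^sup>2 * ?s" by (intro mult_right_mono) auto
      then show ?thesis using True \<delta>(1) unfolding q_eq by (simp add: field_simps)
    qed simp
    finally show ?thesis by (simp only: distrib_left)
  qed
  note P = cheb_tensor_Parseval[OF r finite_multi_indices, of a _ n]
  have "cheb_norm r * (\<Sum>\<alpha>\<in>multi_indices n. (cmod (c \<alpha>))\<^sup>2)
      = (LINT z|lborel. ?W z * (?S x z)\<^sup>2 + ?W z * (?S y z)\<^sup>2)"
    by (simp add: P cmod_power2 x_def y_def sum.distrib distrib_left)
  also have "\<dots> \<le> (LINT z|lborel. (1 / \<delta>\<^sup>2) * (indicator (rectangle a r) z * (cmod (q z))\<^sup>2))"
    by (intro integral_mono Bochner_Integration.integrable_add P integrable_mult_right int le)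
  also have "\<dots> \<le> (1 / \<delta>\<^sup>2) * J\<^sup>2"
    using J(1) by (simp add: divide_right_mono)
  finally have sum_le: "cheb_norm r * (\<Sum>\<alpha>\<in>multi_indices n. (cmod (c \<alpha>))\<^sup>2) \<le> (J / \<delta>)\<^sup>2"
    by (simp add: power_divide)
  have c_le: "cmod (c \<alpha>) \<le> J / (\<delta> * sqrt (cheb_norm r))" if "\<alpha> \<in> multi_indices n" for \<alpha>
  proof -
    have "(cmod (c \<alpha>))\<^sup>2 \<le> (\<Sum>\<alpha>\<in>multi_indices n. (cmod (c \<alpha>))\<^sup>2)"
      using that finite_multi_indices by (intro member_le_sum) auto
    then have "cheb_norm r * (cmod (c \<alpha>))\<^sup>2 \<le> (J / \<delta>)\<^sup>2"
      using sum_le K by (meson mult_left_mono order_trans less_imp_le)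
    then have "(cmod (c \<alpha>))\<^sup>2 \<le> (J / (\<delta> * sqrt (cheb_norm r)))\<^sup>2"
      using K \<delta>(1) by (simp add: power_divide power_mult_distrib field_simps)
    then show ?thesis by (rule power2_le_imp_le) (use J(2) K \<delta>(1) in simp)
  qed
  let ?E = "C * D ^ n * (J / (\<delta> * sqrt (cheb_norm r)))"
  have "cmod (ip q g) = cmod (\<Sum>\<alpha>\<in>multi_indices n. c \<alpha> * ip (wcheb w a r \<alpha>) g)"
    unfolding c using U_mem g by (simp add: ip_sum ip_scale mem_scale)
  also have "\<dots> \<le> (\<Sum>\<alpha>\<in>multi_indices n. cmod (c \<alpha>) * cmod (ip (wcheb w a r \<alpha>) g))"
    by (rule order_trans[OF norm_sum]) (simp add: norm_mult)
  also have "\<dots> \<le> (\<Sum>\<alpha>\<in>(multi_indices n :: ('d \<Rightarrow> nat) set). ?E)"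
  proof (rule sum_mono)
    fix \<alpha> :: "'d \<Rightarrow> nat" assume \<alpha>: "\<alpha> \<in> multi_indices n"
    have "cmod (ip (wcheb w a r \<alpha>) g) \<le> C * D ^ sum \<alpha> UNIV" by (rule U_bound)
    also have "\<dots> \<le> C * D ^ n"
      using \<alpha> C0 D1 by (intro mult_left_mono power_increasing) (auto simp: multi_indices_def)
    finally have "cmod (c \<alpha>) * cmod (ip (wcheb w a r \<alpha>) g) \<le> (J / (\<delta> * sqrt (cheb_norm r))) * (C * D ^ n)"
      using c_le[OF \<alpha>] J(2) K \<delta>(1) by (intro mult_mono) auto
    then show "cmod (c \<alpha>) * cmod (ip (wcheb w a r \<alpha>) g) \<le> ?E" by (simp only: mult_ac)
  qed
  also have "\<dots> = real (card (multi_indices n :: ('d \<Rightarrow> nat) set)) * ?E" by simp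
  also have "\<dots> \<le> real (n + 1) ^ CARD('d) * ?E"
  proof (rule mult_right_mono)
    show "real (card (multi_indices n :: ('d \<Rightarrow> nat) set)) \<le> real (n + 1) ^ CARD('d)"
      using card_multi_indices[of n] by (metis of_nat_le_iff of_nat_power)
    show "0 \<le> ?E" using C0 D1 J(2) K \<delta>(1) by simp
  qed
  finally show ?thesis by (simp only: mult_ac)
qed

end

section \<open>Jet spaces of the exponential and the Gaussian kernel\<close>

text \<open>The functions \<open>R(x,y)\<close> with \<open>jet_factor p n R\<close> are the polynomials in \<open>x\<close> and \<open>y\<close> whose degree in \<open>y\<close>
  is at most \<open>n\<close>.\<close>

inductive jet_factor :: "real ^ 'd \<Rightarrow> nat \<Rightarrow> (real ^ 'd \<Rightarrow> real ^ 'd \<Rightarrow> real) \<Rightarrow> bool" for p where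
  const: "jet_factor p n (\<lambda>x y. c)"
| add: "jet_factor p n R \<Longrightarrow> jet_factor p n S \<Longrightarrow> jet_factor p n (\<lambda>x y. R x y + S x y)"
| scale: "jet_factor p n R \<Longrightarrow> jet_factor p n (\<lambda>x y. c * R x y)"
| fst_coord: "jet_factor p n R \<Longrightarrow> jet_factor p n (\<lambda>x y. (x - p) $ i * R x y)"
| snd_coord: "jet_factor p n R \<Longrightarrow> jet_factor p (Suc n) (\<lambda>x y. (y - p) $ i * R x y)"

lemma jet_factor_weaken: "jet_factor p n R \<Longrightarrow> n \<le> m \<Longrightarrow> jet_factor p m R"
proof (induct arbitrary: m rule: jet_factor.induct)
  case (snd_coord n R i)
  then obtain l where "m = Suc l" "n \<le> l" by (cases m) auto
  then show ?case using snd_coord(2)[of l] jet_factor.snd_coord by metis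
qed (auto intro: jet_factor.intros simp del: vector_minus_component)

lemma jet_factor_monom_at: "jet_factor p (length is) (\<lambda>x y. monom_at p is y)"
proof (induct "is")
  case Nil
  have "(\<lambda>(x::real ^ 'a) y. monom_at p [] y) = (\<lambda>x y. 1)" by (simp add: monom_at_def)
  then show ?case using jet_factor.const[of p 0 1] by simp
next
  case (Cons i "is")
  then show ?case using jet_factor.snd_coord[OF Cons, of i] by (simp add: monom_at_def)
qed

lemma jet_factor_derivative:
  assumes "jet_factor p n R"
  obtains R' where "jet_factor p n R'"
    "\<And>x y. ((\<lambda>t. R (x + t *\<^sub>R axis j 1) y) has_real_derivative R' x y) (at 0)"
proof -
  have "\<exists>R'. jet_factor p n R' \<and> (\<forall>x y. ((\<lambda>t. R (x + t *\<^sub>R axis j 1) y) has_real_derivative R' x y) (at 0))"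
    using assms
  proof induct
    case (const n c)
    show ?case by (rule exI[of _ "\<lambda>x y. 0"]) (auto intro: jet_factor.const)
  next
    case (add n R S)
    then obtain R' S' where "jet_factor p n R'" "jet_factor p n S'"
      "\<And>x y. ((\<lambda>t. R (x + t *\<^sub>R axis j 1) y) has_real_derivative R' x y) (at 0)"
      "\<And>x y. ((\<lambda>t. S (x + t *\<^sub>R axis j 1) y) has_real_derivative S' x y) (at 0)" by blast
    then show ?case
      by (intro exI[of _ "\<lambda>x y. R' x y + S' x y"]) (auto intro!: jet_factor.add DERIV_add)
  next
    case (scale n R c)
    then obtain R' where "jet_factor p n R'"
      "\<And>x y. ((\<lambda>t. R (x + t *\<^sub>R axis j 1) y) has_real_derivative R' x y) (at 0)" by blast
    then show ?case
      by (intro exI[of _ "\<lambda>x y. c * R' x y"]) (auto intro!: jet_factor.scale DERIV_cmult)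
  next
    case (fst_coord n R i)
    then obtain R' where R': "jet_factor p n R'"
      "\<And>x y. ((\<lambda>t. R (x + t *\<^sub>R axis j 1) y) has_real_derivative R' x y) (at 0)" by blast
    let ?d = "if i = j then 1 else 0 :: real"
    have "((\<lambda>t. (x + t *\<^sub>R axis j 1 - p) $ i * R (x + t *\<^sub>R axis j 1) y) has_real_derivative
      ?d * R x y + (x - p) $ i * R' x y) (at 0)" for x y
    proof -
      have "((\<lambda>t. (x + t *\<^sub>R axis j 1 - p) $ i) has_real_derivative ?d) (at 0)"
        by (auto intro!: derivative_eq_intros simp: axis_def)
      from DERIV_mult'[OF this R'(2)[of x y]] show ?thesis by (simp add: algebra_simps)
    qed
    moreover have "jet_factor p n (\<lambda>x y. ?d * R x y + (x - p) $ i * R' x y)"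
      by (intro jet_factor.add jet_factor.scale jet_factor.fst_coord fst_coord(1) R'(1))
    ultimately show ?case by blast
  next
    case (snd_coord n R i)
    then obtain R' where "jet_factor p n R'"
      "\<And>x y. ((\<lambda>t. R (x + t *\<^sub>R axis j 1) y) has_real_derivative R' x y) (at 0)" by blast
    then show ?case
      by (intro exI[of _ "\<lambda>x y. (y - p) $ i * R' x y"]) (auto intro!: jet_factor.snd_coord DERIV_cmult simp del: vector_minus_component)
  qed
  then show ?thesis using that by blast
qed

text \<open>Setting \<open>x = p\<close> kills every factor from the first variable, so only a
  polynomial in the second one, of controlled degree, survives.\<close>

lemma jet_factor_in_wpoly: "jet_factor p n R \<Longrightarrow> (\<lambda>y. of_real (w y * R p y)) \<in> wpoly w p n"
proof (induct rule: jet_factor.induct)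
  case (const n c)
  have "(\<lambda>y. of_real (w y * c)) = cscale (of_real c) (wmonom w p [])"
    by (rule ext) (simp add: cscale_def wmonom_def monom_at_def)
  then show ?case by (simp only: cfun.subspace_scale[OF subspace_wpoly] wmonom_in_wpoly list.size le0)
next
  case (add n R S)
  have "(\<lambda>y. complex_of_real (w y * (R p y + S p y))) = (\<lambda>y. of_real (w y * R p y)) + (\<lambda>y. of_real (w y * S p y))"
    by (rule ext) (simp add: distrib_left)
  then show ?case using cfun.subspace_add[OF subspace_wpoly add(2,4)] by (simp only:)
next
  case (scale n R c)
  have "(\<lambda>y. complex_of_real (w y * (c * R p y))) = cscale (of_real c) (\<lambda>y. of_real (w y * R p y))"
    by (rule ext) (simp add: cscale_def)
  then show ?case using cfun.subspace_scale[OF subspace_wpoly scale(2)] by (simp only:)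
next
  case (fst_coord n R i)
  have "(\<lambda>y. complex_of_real (w y * ((p - p) $ i * R p y))) = 0"
    by (rule ext) simp
  then show ?case using cfun.subspace_0[OF subspace_wpoly] by (simp only:)
next
  case (snd_coord n R i)
  have "(\<lambda>y. complex_of_real (w y * ((y - p) $ i * R p y))) = (\<lambda>y. of_real ((y - p) $ i) * of_real (w y * R p y))"
    by (rule ext) simp
  then show ?case using wpoly_mult_coord[OF snd_coord(2), of i] by (simp only:)
qed

text \<open>Each derivative multiplies by a factor in which only
  \<open>(y - p) $ i / \<sigma>\<^sup>2\<close> depends on \<open>y\<close>. The highest degree in
  \<open>y\<close> therefore comes from choosing that term every time, and the rest is collected in
  \<open>S\<close>. The alternative \<open>S = (\<lambda>x y. 0)\<close> covers the empty list,
  where no smaller degree exists.\<close>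

lemma iter_partial_kernel:
  fixes p \<beta> :: "real ^ 'd" and k :: "real ^ 'd \<Rightarrow> real ^ 'd \<Rightarrow> complex"
  assumes w: "\<And>x. w x = exp (\<gamma> + inner \<beta> (x - p) - \<kappa> * inner (x - p) (x - p))"
    and k: "\<And>x y. k x y = of_real (w x * w y * exp (inner (x - p) (y - p) / \<sigma>\<^sup>2))"
  obtains S where "S = (\<lambda>x y. 0) \<or> (\<exists>m<length is. jet_factor p m S)"
    "\<And>x y. iter_partial is (\<lambda>x. k x y) x = of_real (w x * w y * exp (inner (x - p) (y - p) / \<sigma>\<^sup>2)
        * (monom_at p is y / (\<sigma>\<^sup>2) ^ length is + S x y))"
proof -
  define E where "E x y = w x * w y * exp (inner (x - p) (y - p) / \<sigma>\<^sup>2)" for x y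
  \<comment> \<open>Along a coordinate axis the exponent is a quadratic polynomial in
    \<open>t\<close>; its linear coefficient is the logarithmic derivative.\<close>
  have E_deriv: "((\<lambda>t. E (x + t *\<^sub>R axis i 1) y) has_real_derivative
      E x y * ((y - p) $ i / \<sigma>\<^sup>2 + \<beta> $ i - 2 * \<kappa> * (x - p) $ i)) (at 0)" for x y i
  proof -
    have in1: "inner (x + t *\<^sub>R axis i 1 - p) z = inner (x - p) z + t * z $ i" for t z
      by (simp add: inner_diff_left inner_add_left inner_axis' algebra_simps)
    have in2: "inner z (x + t *\<^sub>R axis i 1 - p) = inner z (x - p) + t * z $ i" for t z
      using in1[of t z] by (simp only: inner_commute)
    have in3: "inner (x + t *\<^sub>R axis i 1 - p) (x + t *\<^sub>R axis i 1 - p)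
      = inner (x - p) (x - p) + 2 * t * (x - p) $ i + t * t" for t
    proof -
      have "(x + t *\<^sub>R axis i 1 - p) $ i = (x - p) $ i + t" by simp
      then show ?thesis
        using in1[of t "x + t *\<^sub>R axis i 1 - p"] in2[of "x - p" t]
        by (simp only: distrib_left)
    qed
    let ?A = "(y - p) $ i / \<sigma>\<^sup>2 + \<beta> $ i - 2 * \<kappa> * (x - p) $ i"
    have "E (x + t *\<^sub>R axis i 1) y = E x y * exp (t * ?A - \<kappa> * t * t)" for t
    proof -
      have "E (x + t *\<^sub>R axis i 1) y = w y * exp ((\<gamma> + inner \<beta> (x - p) + t * \<beta> $ i
          - \<kappa> * (inner (x - p) (x - p) + 2 * t * (x - p) $ i + t * t))
          + (inner (x - p) (y - p) + t * (y - p) $ i) / \<sigma>\<^sup>2)"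
        unfolding E_def w[of "x + t *\<^sub>R axis i 1"] in3 in2[of \<beta>] in1[of t "y - p"] exp_add by simp
      also have "\<dots> = w y * exp ((\<gamma> + inner \<beta> (x - p) - \<kappa> * inner (x - p) (x - p))
          + inner (x - p) (y - p) / \<sigma>\<^sup>2 + (t * ?A - \<kappa> * t * t))"
        by (intro arg_cong2[of _ _ _ _ "(*)"] refl arg_cong[of _ _ exp])
           (simp add: add_divide_distrib right_diff_distrib distrib_left)
      also have "\<dots> = E x y * exp (t * ?A - \<kappa> * t * t)"
        unfolding E_def w[of x] exp_add by simp
      finally show ?thesis .
    qed
    moreover have "((\<lambda>t. E x y * exp (t * ?A - \<kappa> * t * t)) has_real_derivative E x y * ?A) (at 0)"
      by (auto intro!: derivative_eq_intros)
    ultimately show ?thesis by (simp only:)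
  qed
  have "\<exists>S. (S = (\<lambda>x y. 0) \<or> (\<exists>m<length is. jet_factor p m S)) \<and>
    (\<forall>x y. iter_partial is (\<lambda>x. k x y) x = of_real (E x y * (monom_at p is y / (\<sigma>\<^sup>2) ^ length is + S x y)))"
  proof (induct "is")
    case Nil
    show ?case by (rule exI[of _ "\<lambda>x y. 0"]) (simp add: iter_partial_def monom_at_def k E_def)
  next
    case (Cons i "is")
    then obtain S where S: "S = (\<lambda>x y. 0) \<or> (\<exists>m<length is. jet_factor p m S)"
      "\<And>x y. iter_partial is (\<lambda>x. k x y) x = of_real (E x y * (monom_at p is y / (\<sigma>\<^sup>2) ^ length is + S x y))"
      by blast
    let ?n = "length is"
    have Sn: "jet_factor p ?n S" using S(1)
      by (auto intro: jet_factor.const jet_factor_weaken)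
    have yS: "jet_factor p ?n (\<lambda>x y. (y - p) $ i * S x y)"
      using S(1)
    proof
      assume "S = (\<lambda>x y. 0)"
      then have "(\<lambda>x y. (y - p) $ i * S x y) = (\<lambda>x y. 0)" by simp
      then show ?thesis using jet_factor.const[of p ?n 0] by (simp only:)
    next
      assume "\<exists>m<?n. jet_factor p m S"
      then obtain m where m: "m < ?n" "jet_factor p m S" by blast
      show ?thesis by (rule jet_factor_weaken[OF jet_factor.snd_coord[OF m(2)]]) (use m(1) in simp)
    qed
    obtain S' where S': "jet_factor p ?n S'"
      "\<And>x y. ((\<lambda>t. S (x + t *\<^sub>R axis i 1) y) has_real_derivative S' x y) (at 0)"
      using jet_factor_derivative[OF Sn] by blast
    define Q where "Q = (\<lambda>x y. 1 / (\<sigma>\<^sup>2) ^ ?n * monom_at p is y + S x y)"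
    have Q: "jet_factor p ?n Q" unfolding Q_def
      by (intro jet_factor.add jet_factor.scale jet_factor_monom_at Sn)
    \<comment> \<open>Everything except \<open>(y - p) $ i / \<sigma>\<^sup>2\<close> times the
      leading monomial; the degree in \<open>y\<close> of these terms stays at most
      \<open>?n\<close>.\<close>
    define T where "T = (\<lambda>x y. (1 / \<sigma>\<^sup>2 * ((y - p) $ i * S x y) + (\<beta> $ i * Q x y + (- 2 * \<kappa>) * ((x - p) $ i * Q x y))) + S' x y)"
    have T: "jet_factor p ?n T" unfolding T_def
      by (intro jet_factor.add jet_factor.scale jet_factor.fst_coord Q yS S')
    have "iter_partial (i # is) (\<lambda>x. k x y) x
        = of_real (E x y * (monom_at p (i # is) y / (\<sigma>\<^sup>2) ^ length (i # is) + T x y))" for x y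
    proof -
      have "((\<lambda>t. Q (x + t *\<^sub>R axis i 1) y) has_real_derivative S' x y) (at 0)"
        unfolding Q_def using DERIV_add[OF DERIV_const S'(2)] by simp
      from DERIV_mult'[OF E_deriv[of x i y] this]
      have "((\<lambda>t. E (x + t *\<^sub>R axis i 1) y * Q (x + t *\<^sub>R axis i 1) y) has_real_derivative
          E x y * (((y - p) $ i / \<sigma>\<^sup>2 + \<beta> $ i - 2 * \<kappa> * (x - p) $ i) * Q x y + S' x y)) (at 0)"
        by (simp add: algebra_simps del: vector_minus_component)
      then have "((\<lambda>t. complex_of_real (E (x + t *\<^sub>R axis i 1) y * Q (x + t *\<^sub>R axis i 1) y)) has_vector_derivative
          of_real (E x y * (((y - p) $ i / \<sigma>\<^sup>2 + \<beta> $ i - 2 * \<kappa> * (x - p) $ i) * Q x y + S' x y))) (at 0)"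
        by (rule has_vector_derivative_of_real)
      from vector_derivative_at[OF this]
      have "iter_partial (i # is) (\<lambda>x. k x y) x
        = of_real (E x y * (((y - p) $ i / \<sigma>\<^sup>2 + \<beta> $ i - 2 * \<kappa> * (x - p) $ i) * Q x y + S' x y))"
        using S(2)[of y] unfolding Q_def
        by (simp add: iter_partial_def partial_deriv_def del: vector_minus_component)
      also have "((y - p) $ i / \<sigma>\<^sup>2 + \<beta> $ i - 2 * \<kappa> * (x - p) $ i) * Q x y + S' x y
        = monom_at p (i # is) y / (\<sigma>\<^sup>2) ^ length (i # is) + T x y"
      proof -
        have "monom_at p (i # is) y / (\<sigma>\<^sup>2) ^ length (i # is)
          = (y - p) $ i / \<sigma>\<^sup>2 * (1 / (\<sigma>\<^sup>2) ^ ?n * monom_at p is y)"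
          by (simp add: monom_at_def del: vector_minus_component)
        moreover have "(a + b - 2 * c * x) * (s + t) + d = a * s + ((a * t + (b * (s + t) + (- 2 * c) * (x * (s + t)))) + d)"
          for a b c x s t d :: real by (simp add: algebra_simps)
        moreover have "1 / \<sigma>\<^sup>2 * ((y - p) $ i * S x y) = (y - p) $ i / \<sigma>\<^sup>2 * S x y" by simp
        ultimately show ?thesis unfolding T_def Q_def by (simp only:)
      qed
      finally show ?thesis .
    qed
    then show ?case using T by (intro exI[of _ T]) auto
  qed
  then show ?thesis using that unfolding E_def by blast
qed

text \<open>The passage from weighted monomials to derivatives at \<open>p\<close> is triangular in
  the degree, with nonzero diagonal factors \<open>w p\<close> and a power of
  \<open>1 / \<sigma>\<^sup>2\<close>. The converse inclusion solves for the monomial by strong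
  induction on the degree.\<close>

lemma jet_space_eq_wpoly:
  fixes p \<beta> :: "real ^ 'd" and k :: "real ^ 'd \<Rightarrow> real ^ 'd \<Rightarrow> complex"
  assumes w: "\<And>x. w x = exp (\<gamma> + inner \<beta> (x - p) - \<kappa> * inner (x - p) (x - p))"
    and k: "\<And>x y. k x y = of_real (w x * w y * exp (inner (x - p) (y - p) / \<sigma>\<^sup>2))"
    and \<sigma>: "\<sigma> > 0"
  shows "jet_space k p n = wpoly w p n"
proof -
  have wp: "w p > 0" by (simp add: w)
  let ?D = "\<lambda>is y. iter_partial is (\<lambda>x. k x y) p"
  have deriv: "\<exists>g. (g = 0 \<or> (\<exists>m<length is. g \<in> wpoly w p m)) \<and>
    ?D is = cscale (of_real (w p)) (cscale (of_real (1 / (\<sigma>\<^sup>2) ^ length is)) (wmonom w p is) + g)" for "is"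
  proof -
    obtain S where S: "S = (\<lambda>x y. 0) \<or> (\<exists>m<length is. jet_factor p m S)"
     "\<And>x y. iter_partial is (\<lambda>x. k x y) x = of_real (w x * w y * exp (inner (x - p) (y - p) / \<sigma>\<^sup>2)
        * (monom_at p is y / (\<sigma>\<^sup>2) ^ length is + S x y))"
      using iter_partial_kernel[OF w k] by metis
    define g where "g = (\<lambda>y. complex_of_real (w y * S p y))"
    have "g = 0 \<or> (\<exists>m<length is. g \<in> wpoly w p m)"
      using S(1)
    proof
      assume "S = (\<lambda>x y. 0)"
      then have "g = 0" unfolding g_def by (intro ext) simp
      then show ?thesis ..
    next
      assume "\<exists>m<length is. jet_factor p m S"
      then show ?thesis using jet_factor_in_wpoly unfolding g_def by blast
    qed
    moreover have "?D is = cscale (of_real (w p)) (cscale (of_real (1 / (\<sigma>\<^sup>2) ^ length is)) (wmonom w p is) + g)"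
      by (rule ext) (simp add: S(2) g_def cscale_def wmonom_def algebra_simps)
    ultimately show ?thesis by blast
  qed
  show ?thesis
  proof (rule antisym)
    show "jet_space k p n \<subseteq> wpoly w p n"
      unfolding jet_space_def
    proof (rule cfun.span_minimal[OF _ subspace_wpoly], safe)
      fix "is" :: "'d list" assume l: "length is \<le> n"
      obtain g where g: "g = 0 \<or> (\<exists>m<length is. g \<in> wpoly w p m)"
        "?D is = cscale (of_real (w p)) (cscale (of_real (1 / (\<sigma>\<^sup>2) ^ length is)) (wmonom w p is) + g)"
        using deriv by blast
      from g(1) have "g \<in> wpoly w p n"
      proof
        assume "g = 0" then show ?thesis using cfun.subspace_0[OF subspace_wpoly] by (simp only:)
      next
        assume "\<exists>m<length is. g \<in> wpoly w p m"
        then obtain m where "m < length is" "g \<in> wpoly w p m" by blast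
        then show ?thesis using l wpoly_mono[of m n w p] by auto
      qed
      then show "?D is \<in> wpoly w p n" unfolding g(2)
        by (intro cfun.subspace_scale cfun.subspace_add subspace_wpoly wmonom_in_wpoly l)
    qed
    have sub: "csubspace (jet_space k p n)" unfolding jet_space_def by simp
    have "l \<le> n \<Longrightarrow> wpoly w p l \<subseteq> jet_space k p n" for l
    proof (induct l rule: less_induct)
      case (less l)
      show ?case unfolding wpoly_def
      proof (rule cfun.span_minimal[OF _ sub], safe)
        fix "is" :: "'d list" assume l: "length is \<le> l"
        obtain g where g: "g = 0 \<or> (\<exists>m<length is. g \<in> wpoly w p m)"
          "?D is = cscale (of_real (w p)) (cscale (of_real (1 / (\<sigma>\<^sup>2) ^ length is)) (wmonom w p is) + g)"
          using deriv by blast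
        have D: "?D is \<in> jet_space k p n"
          unfolding jet_space_def using l less(2) by (intro cfun.span_base) auto
        from g(1) have g_mem: "g \<in> jet_space k p n"
        proof
          assume "g = 0" then show ?thesis using cfun.subspace_0[OF sub] by (simp only:)
        next
          assume "\<exists>m<length is. g \<in> wpoly w p m"
          then obtain m where "m < length is" "g \<in> wpoly w p m" by blast
          then show ?thesis using less(1)[of m] l less(2) by auto
        qed
        have "wmonom w p is = cscale (of_real ((\<sigma>\<^sup>2) ^ length is)) (cscale (of_real (1 / w p)) (?D is) - g)"
          unfolding g(2) using wp \<sigma> by (intro ext) (simp add: cscale_def field_simps)
        then show "wmonom w p is \<in> jet_space k p n"
          using cfun.subspace_scale[OF sub cfun.subspace_diff[OF sub cfun.subspace_scale[OF sub D] g_mem]]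
          by (simp only:)
      qed
    qed
    then show "wpoly w p n \<subseteq> jet_space k p n" by simp
  qed
qed

section \<open>Factorization of the two kernels around \<open>p\<close>\<close>

lemma exp_kernel_weight:
  fixes b p :: "real ^ 'd"
  obtains \<gamma> \<beta> \<kappa> where "\<And>x y. exp_kernel \<sigma> b x y =
    of_real (exp (\<gamma> + inner \<beta> (x - p) - \<kappa> * inner (x - p) (x - p))
      * exp (\<gamma> + inner \<beta> (y - p) - \<kappa> * inner (y - p) (y - p)) * exp (inner (x - p) (y - p) / \<sigma>\<^sup>2))"
proof
  fix x y
  have "inner (x - b) (y - b) = inner (p - b) (p - b) / 2 + inner (p - b) (x - p)
     + (inner (p - b) (p - b) / 2 + inner (p - b) (y - p)) + inner (x - p) (y - p)"
    by (simp add: inner_diff_left inner_diff_right inner_commute)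
  then show "exp_kernel \<sigma> b x y = of_real (exp (inner (p - b) (p - b) / (2 * \<sigma>\<^sup>2) + inner ((1 / \<sigma>\<^sup>2) *\<^sub>R (p - b)) (x - p) - 0 * inner (x - p) (x - p))
      * exp (inner (p - b) (p - b) / (2 * \<sigma>\<^sup>2) + inner ((1 / \<sigma>\<^sup>2) *\<^sub>R (p - b)) (y - p) - 0 * inner (y - p) (y - p)) * exp (inner (x - p) (y - p) / \<sigma>\<^sup>2))"
    unfolding exp_kernel_def exp_add[symmetric] by (simp add: add_divide_distrib)
qed

text \<open>Polarizing \<open>x - y = (x - p) - (y - p)\<close> separates the mixed term; the weight
  is a Gaussian centred at \<open>p\<close>, with
  \<open>\<kappa> = 1 / (2 * \<sigma>\<^sup>2)\<close>.\<close>

lemma gauss_kernel_weight: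
  fixes p :: "real ^ 'd"
  obtains \<gamma> \<beta> \<kappa> where "\<And>x y. gauss_kernel \<sigma> x y =
    of_real (exp (\<gamma> + inner \<beta> (x - p) - \<kappa> * inner (x - p) (x - p))
      * exp (\<gamma> + inner \<beta> (y - p) - \<kappa> * inner (y - p) (y - p)) * exp (inner (x - p) (y - p) / \<sigma>\<^sup>2))"
proof
  fix x y :: "real ^ 'd"
  have "- (norm (x - y))\<^sup>2 = - inner (x - p) (x - p) - inner (y - p) (y - p) + 2 * inner (x - p) (y - p)"
    by (simp add: dot_square_norm[symmetric] inner_diff_left inner_diff_right inner_commute)
  then have "- (norm (x - y))\<^sup>2 / (2 * \<sigma>\<^sup>2) = 0 + inner 0 (x - p) - 1 / (2 * \<sigma>\<^sup>2) * inner (x - p) (x - p)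
     + (0 + inner 0 (y - p) - 1 / (2 * \<sigma>\<^sup>2) * inner (y - p) (y - p)) + inner (x - p) (y - p) / \<sigma>\<^sup>2"
    by (simp add: add_divide_distrib diff_divide_distrib)
  then show "gauss_kernel \<sigma> x y =
    of_real (exp (0 + inner 0 (x - p) - 1 / (2 * \<sigma>\<^sup>2) * inner (x - p) (x - p))
      * exp (0 + inner 0 (y - p) - 1 / (2 * \<sigma>\<^sup>2) * inner (y - p) (y - p)) * exp (inner (x - p) (y - p) / \<sigma>\<^sup>2))"
    unfolding gauss_kernel_def exp_add[symmetric] by (simp only:)
qed

section \<open>Strong law of large numbers and smooth maps\<close>

text \<open>For bounded variables Hoeffding's inequality makes the probability of a deviation by
  \<open>e\<close> decay geometrically in \<open>N\<close>, so Borel-Cantelli applies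
  directly.\<close>

lemma (in prob_space) bounded_strong_law_real:
  fixes X :: "nat \<Rightarrow> 'a \<Rightarrow> 'b::topological_space" and \<phi> :: "'b \<Rightarrow> real"
  assumes indep: "indep_vars (\<lambda>_. borel) X UNIV"
    and law: "\<And>i. distr M borel (X i) = \<mu>"
    and \<phi>[measurable]: "\<phi> \<in> borel_measurable borel"
    and bound: "AE x in \<mu>. \<bar>\<phi> x\<bar> \<le> B"
  shows "AE \<omega> in M. (\<lambda>N. (\<Sum>i<N. \<phi> (X i \<omega>)) / real N) \<longlonglongrightarrow> (LINT x|\<mu>. \<phi> x)"
proof -
  have X[measurable]: "random_variable borel (X i)" for i
    using indep unfolding indep_vars_def by simp
  \<comment> \<open>The increment makes the interval from \<open>-b\<close> to \<open>b\<close>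
    nondegenerate, whatever \<open>B\<close> is.\<close>
  define b where "b = \<bar>B\<bar> + 1"
  have b: "b > 0" by (simp add: b_def)
  have AE0: "AE \<omega> in M. \<phi> (X 0 \<omega>) \<in> {-b..b}"
  proof -
    have "AE x in distr M borel (X 0). \<phi> x \<in> {-b..b}"
      unfolding law using bound by eventually_elim (auto simp: b_def)
    then show ?thesis by (subst (asm) AE_distr_iff) auto
  qed
  define m where "m = (LINT x|\<mu>. \<phi> x)"
  have m: "expectation (\<lambda>\<omega>. \<phi> (X 0 \<omega>)) = m"
    unfolding m_def law[of 0, symmetric] by (subst integral_distr) auto
  have Hoeffding: "prob {\<omega> \<in> space M. N * e \<le> \<bar>(\<Sum>i<N. \<phi> (X i \<omega>)) - N * m\<bar>}
      \<le> 2 * exp (- (2 * e\<^sup>2 / (2 * b)\<^sup>2)) ^ N" if "e > 0" "N \<ge> 1" for e :: real and N :: nat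
  proof -
    have "Hoeffding_ineq_iid M {..<N} (\<lambda>i \<omega>. \<phi> (X i \<omega>)) (\<lambda>\<omega>. \<phi> (X 0 \<omega>)) (-b) b"
    proof (unfold_locales)
      show "indep_vars (\<lambda>_. borel) (\<lambda>i \<omega>. \<phi> (X i \<omega>)) {..<N}"
        by (rule indep_vars_subset[OF indep_vars_compose2[OF indep]]) auto
      fix i
      have "distr M borel (\<lambda>\<omega>. \<phi> (X i \<omega>)) = distr (distr M borel (X i)) borel \<phi>" for i
        by (simp add: distr_distr comp_def)
      then show "distr M borel (\<lambda>\<omega>. \<phi> (X i \<omega>)) = distr M borel (\<lambda>\<omega>. \<phi> (X 0 \<omega>))"
        by (simp add: law)
    qed (use AE0 in auto)
    from Hoeffding_ineq_iid.Hoeffding_ineq_abs_ge[OF this, of "N * e"]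
    have "prob {\<omega> \<in> space M. N * e \<le> \<bar>(\<Sum>i<N. \<phi> (X i \<omega>)) - N * m\<bar>}
       \<le> 2 * exp (- 2 * (N * e)\<^sup>2 / (N * (2 * b)\<^sup>2))"
      using that b m by (simp add: lessThan_empty_iff)
    also have "- 2 * (N * e)\<^sup>2 / (N * (2 * b)\<^sup>2) = N * (- (2 * e\<^sup>2 / (2 * b)\<^sup>2))"
      using that by (simp add: power2_eq_square field_simps)
    finally show ?thesis by (simp only: exp_of_nat_mult)
  qed
  have "AE \<omega> in M. \<forall>\<^sub>F N in sequentially. \<bar>(\<Sum>i<N. \<phi> (X i \<omega>)) / N - m\<bar> < e" if e: "e > 0" for e :: real
  proof -
    define A where "A N = {\<omega> \<in> space M. N * e \<le> \<bar>(\<Sum>i<N. \<phi> (X i \<omega>)) - N * m\<bar>}" for N :: nat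
    have A: "A N \<in> events" for N unfolding A_def by measurable
    have "summable (\<lambda>N. 2 * exp (- (2 * e\<^sup>2 / (2 * b)\<^sup>2)) ^ N)"
      using e b by (intro summable_mult summable_geometric) (auto simp: field_simps)
    then have "summable (\<lambda>N. prob (A N))"
      by (rule summable_comparison_test'[where N = 1]) (use Hoeffding e in \<open>auto simp: A_def\<close>)
    then have "AE \<omega> in M. \<forall>\<^sub>F N in sequentially. \<omega> \<in> space M - A N"
      by (intro borel_cantelli_AE1 A) (auto simp: less_top[symmetric])
    then show ?thesis
    proof eventually_elim
      case (elim \<omega>)
      with eventually_gt_at_top[of 0] show ?case
      proof eventually_elim
        case (elim N)
        then have "\<bar>(\<Sum>i<N. \<phi> (X i \<omega>)) - N * m\<bar> < N * e" by (auto simp: A_def)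
        moreover have "(\<Sum>i<N. \<phi> (X i \<omega>)) / N - m = ((\<Sum>i<N. \<phi> (X i \<omega>)) - N * m) / N"
          using elim by (simp add: field_simps)
        ultimately show ?case using elim by (simp add: field_simps)
      qed
    qed
  qed
  \<comment> \<open>The exceptional null set depends on the tolerance, so only countably many
    tolerances are used.\<close>
  from this[of "1 / real (Suc k)" for k]
  have "AE \<omega> in M. \<forall>k. \<forall>\<^sub>F N in sequentially. \<bar>(\<Sum>i<N. \<phi> (X i \<omega>)) / N - m\<bar> < 1 / real (Suc k)"
    by (simp add: AE_all_countable)
  then show ?thesis
  proof eventually_elim
    case (elim \<omega>)
    show ?case unfolding m_def[symmetric]
    proof (rule tendstoI)
      fix e :: real assume "e > 0"
      then obtain k where k: "1 / real (Suc k) < e" using nat_approx_posE by blast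
      from elim[rule_format, of k] show "\<forall>\<^sub>F N in sequentially. dist ((\<Sum>i<N. \<phi> (X i \<omega>)) / N) m < e"
        by eventually_elim (use k in \<open>simp add: dist_real_def\<close>)
    qed
  qed
qed

lemma (in prob_space) bounded_strong_law_complex:
  fixes X :: "nat \<Rightarrow> 'a \<Rightarrow> 'b::topological_space" and \<phi> :: "'b \<Rightarrow> complex"
  assumes indep: "indep_vars (\<lambda>_. borel) X UNIV"
    and law: "\<And>i. distr M borel (X i) = \<mu>"
    and \<phi>[measurable]: "\<phi> \<in> borel_measurable borel"
    and bound: "AE x in \<mu>. cmod (\<phi> x) \<le> B"
  shows "AE \<omega> in M. (\<lambda>N. (\<Sum>i<N. \<phi> (X i \<omega>)) / of_nat N) \<longlonglongrightarrow> (LINT x|\<mu>. \<phi> x)"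
proof -
  have [measurable_cong]: "sets \<mu> = sets borel" using law[of 0] by auto
  have "finite_measure \<mu>"
  proof -
    have "random_variable borel (X 0)" using indep unfolding indep_vars_def by simp
    then show ?thesis using law[of 0] prob_space_distr prob_space.finite_measure by metis
  qed
  then have int: "integrable \<mu> \<phi>"
    by (intro finite_measure.integrable_const_bound[OF _ bound]) auto
  have "AE x in \<mu>. \<bar>Re (\<phi> x)\<bar> \<le> B" "AE x in \<mu>. \<bar>Im (\<phi> x)\<bar> \<le> B"
    using bound by (eventually_elim; meson abs_Re_le_cmod abs_Im_le_cmod order_trans)+
  from bounded_strong_law_real[OF indep law _ this(1)] bounded_strong_law_real[OF indep law _ this(2)]
  have "AE \<omega> in M. (\<lambda>N. (\<Sum>i<N. Re (\<phi> (X i \<omega>))) / real N) \<longlonglongrightarrow> (LINT x|\<mu>. Re (\<phi> x))"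
     "AE \<omega> in M. (\<lambda>N. (\<Sum>i<N. Im (\<phi> (X i \<omega>))) / real N) \<longlonglongrightarrow> (LINT x|\<mu>. Im (\<phi> x))"
    by auto
  then show ?thesis
  proof eventually_elim
    case (elim \<omega>)
    then show ?case
      using integral_Re[OF int] integral_Im[OF int] unfolding tendsto_complex_iff
      by (simp add: Re_divide_of_nat Im_divide_of_nat)
  qed
qed

section \<open>Smooth maps through their partial derivatives\<close>

lemma has_derivative_along_axis:
  fixes F :: "real ^ 'd \<Rightarrow> 'b::real_normed_vector"
  assumes "(\<lambda>s. F ((z + t *\<^sub>R axis i 1) + s *\<^sub>R axis i 1)) differentiable (at 0)"
  shows "((\<lambda>s. F (z + s *\<^sub>R axis i 1)) has_vector_derivative partial_deriv i F (z + t *\<^sub>R axis i 1)) (at t)"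
proof -
  have "((\<lambda>s. F ((z + t *\<^sub>R axis i 1) + s *\<^sub>R axis i 1)) has_vector_derivative
      partial_deriv i F (z + t *\<^sub>R axis i 1)) (at (t - t))"
    using assms unfolding partial_deriv_def by (simp add: vector_derivative_works)
  moreover have "((\<lambda>s. s - t) has_vector_derivative 1) (at t)"
    by (auto intro!: derivative_eq_intros)
  ultimately have "((\<lambda>s. F ((z + t *\<^sub>R axis i 1) + (s - t) *\<^sub>R axis i 1)) has_vector_derivative
      1 *\<^sub>R partial_deriv i F (z + t *\<^sub>R axis i 1)) (at t)"
    using vector_diff_chain_at[of "\<lambda>s. s - t" 1 t] by (simp add: comp_def)
  moreover have "(z + t *\<^sub>R axis i 1) + (s - t) *\<^sub>R axis i 1 = z + s *\<^sub>R axis i (1::real)" for s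
    by (simp add: scaleR_left_diff_distrib)
  ultimately show ?thesis by simp
qed

lemma smooth_imp_continuous: "smooth F \<Longrightarrow> continuous_on UNIV F"
  unfolding smooth_def by (metis foldr_Nil id_apply iter_partial_def)

text \<open>\<open>smooth\<close> speaks of derivatives along the axes only, so the increment from
  \<open>p\<close> to \<open>x\<close> is telescoped over the coordinates. Each step is governed by
  the maximum of one partial derivative on a cube.\<close>

lemma smooth_imp_locally_Lipschitz:
  fixes F :: "real ^ 'd \<Rightarrow> 'b::real_normed_vector"
  assumes "smooth F"
  obtains L where "L \<ge> 0" "\<And>x. norm (x - p) \<le> 1 \<Longrightarrow> norm (F x - F p) \<le> L * norm (x - p)"
proof -
  define K where "K = cbox (p - (\<chi> i. 1)) (p + (\<chi> i::'d. 1))"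
  have K: "x \<in> K \<longleftrightarrow> (\<forall>i. \<bar>x $ i - p $ i\<bar> \<le> 1)" for x
    by (auto simp: K_def mem_box_cart abs_le_iff algebra_simps)
  have cont: "continuous_on UNIV (partial_deriv i F)" for i
    using assms unfolding smooth_def iter_partial_def by (metis comp_apply foldr.simps(1,2) id_apply)
  have diff: "(\<lambda>t. F (x + t *\<^sub>R axis i 1)) differentiable (at 0)" for i x
    using assms unfolding smooth_def iter_partial_def by (metis foldr_Nil id_apply)
  have "\<exists>B. \<forall>x\<in>K. norm (partial_deriv i F x) \<le> B" for i
  proof -
    have "compact (partial_deriv i F ` K)"
      by (rule compact_continuous_image[OF continuous_on_subset[OF cont]]) (auto simp: K_def)
    then show ?thesis using compact_imp_bounded bounded_iff by (metis imageI)
  qed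
  then obtain B where B: "\<And>i x. x \<in> K \<Longrightarrow> norm (partial_deriv i F x) \<le> B i" by metis
  have B0: "B i \<ge> 0" for i
    by (rule order_trans[OF norm_ge_zero B[of p]]) (simp add: K)
  have step: "norm (F (z + s *\<^sub>R axis i 1) - F z) \<le> B i * \<bar>s\<bar>"
    if z: "z \<in> K" "z $ i = p $ i" and s: "\<bar>s\<bar> \<le> 1" for z i s
  proof -
    let ?g = "\<lambda>t. F (z + t *\<^sub>R axis i 1)"
    have in_K: "z + t *\<^sub>R axis i 1 \<in> K" if "t \<in> closed_segment 0 s" for t
    proof -
      have "\<bar>t\<bar> \<le> 1" using that s by (auto simp: closed_segment_eq_real_ivl split: if_splits)
      then show ?thesis using z by (auto simp: K axis_def)
    qed
    have "norm (?g s - ?g 0) \<le> B i * norm (s - 0)"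
    proof (rule differentiable_bound[where f = ?g and S = "closed_segment 0 s"])
      fix t assume t: "t \<in> closed_segment 0 s"
      show "(?g has_derivative (\<lambda>h. h *\<^sub>R partial_deriv i F (z + t *\<^sub>R axis i 1))) (at t within closed_segment 0 s)"
        using has_derivative_along_axis[where i = i and t = t and z = z, OF diff]
        unfolding has_vector_derivative_def by (rule has_derivative_at_withinI)
      show "onorm (\<lambda>h. h *\<^sub>R partial_deriv i F (z + t *\<^sub>R axis i 1)) \<le> B i"
        by (rule onorm_le) (use B[OF in_K[OF t], of i] in \<open>simp add: mult.commute[of "B i"] mult_left_mono\<close>)
    qed auto
    then show ?thesis by simp
  qed
  show thesis
  proof
    show "sum B UNIV \<ge> 0" using B0 by (simp add: sum_nonneg)
    fix x :: "real ^ 'd" assume x: "norm (x - p) \<le> 1"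
    define u where "u = x - p"
    have u: "\<bar>u $ i\<bar> \<le> norm u" for i by (rule component_le_norm_cart)
    have u1: "\<bar>u $ i\<bar> \<le> 1" for i using u[of i] x by (simp add: u_def)
    have "norm (F (p + (\<Sum>i\<in>S. (u $ i) *\<^sub>R axis i 1)) - F p) \<le> sum B S * norm u" if "finite S" for S
      using that
    proof induct
      case (insert j S)
      let ?z = "p + (\<Sum>i\<in>S. (u $ i) *\<^sub>R axis i 1)"
      have zc: "?z $ l = p $ l + (if l \<in> S then u $ l else 0)" for l
        using insert(1) by (simp add: axis_def sum.delta if_distrib cong: if_cong)
      have "?z \<in> K" using u1 unfolding K zc by auto
      then have "norm (F (?z + (u $ j) *\<^sub>R axis j 1) - F ?z) \<le> B j * \<bar>u $ j\<bar>"
      proof (rule step)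
        show "?z $ j = p $ j" using insert(2) unfolding zc by simp
      qed (rule u1)
      also have "\<dots> \<le> B j * norm u" using u B0 by (intro mult_left_mono) auto
      finally have "norm ((F (?z + (u $ j) *\<^sub>R axis j 1) - F ?z) + (F ?z - F p)) \<le> B j * norm u + sum B S * norm u"
        by (intro norm_triangle_mono insert(3))
      then show ?case using insert(1,2) by (simp add: algebra_simps)
    qed simp
    from this[of UNIV] have "norm (F (p + (\<Sum>i\<in>UNIV. (u $ i) *\<^sub>R axis i 1)) - F p) \<le> sum B UNIV * norm u" by simp
    moreover have "p + (\<Sum>i\<in>UNIV. (u $ i) *\<^sub>R axis i 1) = x"
      unfolding Finite_Cartesian_Product.vec_eq_iff by (rule allI) (simp add: u_def axis_def if_distrib sum.delta cong: if_cong)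
    ultimately show "norm (F x - F p) \<le> sum B UNIV * norm (x - p)" by (simp add: u_def)
  qed
qed

section \<open>Limits of pseudo-inverses\<close>

lemma mult_mat_index:
  assumes "A \<in> carrier_mat n k" "B \<in> carrier_mat k l" "i < n" "j < l"
  shows "(A * B) $$ (i, j) = (\<Sum>h<k. A $$ (i, h) * B $$ (h, j))"
  using assms by (simp add: scalar_prod_def atLeast0LessThan)

lemma mat_adjoint_carrier: "A \<in> carrier_mat n k \<Longrightarrow> mat_adjoint A \<in> carrier_mat k n"
  unfolding mat_adjoint_def by (metis carrier_matD cols_length length_map mat_of_rows_carrier(1))

lemma mat_adjoint_index:
  fixes A :: "complex mat"
  assumes "A \<in> carrier_mat n k" "i < k" "j < n"
  shows "mat_adjoint A $$ (i, j) = cnj (A $$ (j, i))"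
  using assms by (simp add: mat_adjoint_def mat_of_rows_def conjugate_complex_def)

lemma mat_adjoint_mult:
  fixes A B :: "complex mat"
  assumes "A \<in> carrier_mat n k" "B \<in> carrier_mat k l"
  shows "mat_adjoint (A * B) = mat_adjoint B * mat_adjoint A"
proof (rule eq_matI)
  note c = mat_adjoint_carrier[OF assms(1)] mat_adjoint_carrier[OF assms(2)]
    mat_adjoint_carrier[OF mult_carrier_mat[OF assms]]
  fix i j assume "i < dim_row (mat_adjoint B * mat_adjoint A)" "j < dim_col (mat_adjoint B * mat_adjoint A)"
  then have ij: "i < l" "j < n" using c by auto
  then show "mat_adjoint (A * B) $$ (i, j) = (mat_adjoint B * mat_adjoint A) $$ (i, j)"
    by (simp add: mat_adjoint_index[OF mult_carrier_mat[OF assms]] mult_mat_index[OF assms]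
        mult_mat_index[OF c(2,1)] mat_adjoint_index[OF assms(1)] mat_adjoint_index[OF assms(2)] mult.commute
        del: index_mult_mat)
qed (use mat_adjoint_carrier[OF assms(1)] mat_adjoint_carrier[OF assms(2)]
    mat_adjoint_carrier[OF mult_carrier_mat[OF assms]] in auto)

lemma mat_adjoint_adjoint:
  fixes A :: "complex mat"
  assumes "A \<in> carrier_mat n k"
  shows "mat_adjoint (mat_adjoint A) = A"
  using assms mat_adjoint_carrier[OF assms] mat_adjoint_carrier[OF mat_adjoint_carrier[OF assms]]
  by (intro eq_matI) (auto simp: mat_adjoint_index[OF mat_adjoint_carrier[OF assms]] mat_adjoint_index[OF assms])

lemma mat_adjoint_one: "mat_adjoint (1\<^sub>m n :: complex mat) = 1\<^sub>m n"
  using mat_adjoint_carrier[of "1\<^sub>m n :: complex mat" n n]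
  by (intro eq_matI) (auto simp: mat_adjoint_index[of _ n n])

text \<open>\<open>T\<close> is the inverse of the self-adjoint matrix
  \<open>V * mat_adjoint V\<close>, and is therefore self-adjoint itself. For uniqueness,
  self-adjointness of \<open>Y * V\<close> writes any other solution as \<open>mat_adjoint V\<close>
  times a square matrix, and \<open>V * Y = 1\<^sub>m r\<close> identifies that matrix with
  \<open>T\<close>.\<close>

lemma pinv_full_row_rank:
  fixes V T :: "complex mat"
  assumes V: "V \<in> carrier_mat r N" and T: "T \<in> carrier_mat r r"
    and VT: "(V * mat_adjoint V) * T = 1\<^sub>m r"
  shows "pinv V = mat_adjoint V * T"
proof -
  let ?S = "V * mat_adjoint V"
  have Va: "mat_adjoint V \<in> carrier_mat N r" using V by (rule mat_adjoint_carrier)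
  have S: "?S \<in> carrier_mat r r" using V Va by simp
  have TS: "T * ?S = 1\<^sub>m r" using mat_mult_left_right_inverse[OF S T VT] .
  have S_adj: "mat_adjoint ?S = ?S" using mat_adjoint_mult[OF V Va] mat_adjoint_adjoint[OF V] by simp
  have Ta: "mat_adjoint T \<in> carrier_mat r r" using T by (rule mat_adjoint_carrier)
  have T_adj: "mat_adjoint T = T"
  proof -
    have "mat_adjoint T * ?S = 1\<^sub>m r"
      using mat_adjoint_mult[OF S T] by (simp add: VT mat_adjoint_one S_adj)
    then have "mat_adjoint T * ?S * T = T" using T by simp
    then show ?thesis using assoc_mult_mat[OF Ta S T] VT Ta by simp
  qed
  let ?X = "mat_adjoint V * T"
  have X: "?X \<in> carrier_mat N r" using Va T by simp
  have VX: "V * ?X = 1\<^sub>m r" using assoc_mult_mat[OF V Va T] VT by simp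
  have XV: "mat_adjoint (?X * V) = ?X * V"
    using mat_adjoint_mult[OF X V] mat_adjoint_mult[OF Va T] mat_adjoint_adjoint[OF V]
      assoc_mult_mat[OF Va T V] by (simp add: T_adj)
  show ?thesis unfolding pinv_def
  proof (rule the_equality)
    show "?X \<in> carrier_mat (dim_col V) (dim_row V) \<and> V * ?X * V = V \<and> ?X * V * ?X = ?X \<and>
        mat_adjoint (V * ?X) = V * ?X \<and> mat_adjoint (?X * V) = ?X * V"
    proof (intro conjI)
      show "?X \<in> carrier_mat (dim_col V) (dim_row V)" using X V by auto
      show "V * ?X * V = V" using V by (simp add: VX)
      show "?X * V * ?X = ?X" using assoc_mult_mat[OF X V X] right_mult_one_mat[OF X] by (simp add: VX)
      show "mat_adjoint (V * ?X) = V * ?X" by (simp add: VX mat_adjoint_one)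
      show "mat_adjoint (?X * V) = ?X * V" by (rule XV)
    qed
  next
    fix Y assume Y: "Y \<in> carrier_mat (dim_col V) (dim_row V) \<and> V * Y * V = V \<and> Y * V * Y = Y \<and>
        mat_adjoint (V * Y) = V * Y \<and> mat_adjoint (Y * V) = Y * V"
    then have Yc: "Y \<in> carrier_mat N r" using V by auto
    have VY: "V * Y \<in> carrier_mat r r" using V Yc by simp
    have "V * Y * ?S = ?S"
      using assoc_mult_mat[OF VY V Va] Y by simp
    then have "V * Y * ?S * T = ?S * T" by simp
    then have VY1: "V * Y = 1\<^sub>m r" using assoc_mult_mat[OF VY S T] right_mult_one_mat[OF VY] by (simp add: VT)
    have Ya: "mat_adjoint Y \<in> carrier_mat r N" using Yc by (rule mat_adjoint_carrier)
    let ?Q = "mat_adjoint Y * Y"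
    have Q: "?Q \<in> carrier_mat r r" using Ya Yc by simp
    have "Y * V = mat_adjoint V * mat_adjoint Y" using mat_adjoint_mult[OF Yc V] Y by simp
    then have YQ: "Y = mat_adjoint V * ?Q" using assoc_mult_mat[OF Va Ya Yc] Y by metis
    have SQ: "?S * ?Q = 1\<^sub>m r" using assoc_mult_mat[OF V Va Q] YQ VY1 by simp
    have "?Q = (T * ?S) * ?Q" using left_mult_one_mat[OF Q] by (simp add: TS)
    also have "\<dots> = T" using assoc_mult_mat[OF T S Q] SQ T by simp
    finally show "Y = ?X" using YQ by simp
  qed
qed

section \<open>Continuity of determinant, adjugate and inverse\<close>

lemma tendsto_det:
  fixes A :: "nat \<Rightarrow> complex mat"
  assumes "\<And>N. A N \<in> carrier_mat n n" "B \<in> carrier_mat n n"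
    and "\<And>i j. i < n \<Longrightarrow> j < n \<Longrightarrow> (\<lambda>N. A N $$ (i, j)) \<longlonglongrightarrow> B $$ (i, j)"
  shows "(\<lambda>N. det (A N)) \<longlonglongrightarrow> det B"
  unfolding det_def'[OF assms(1)] det_def'[OF assms(2)]
proof (intro tendsto_sum tendsto_mult tendsto_const tendsto_prod)
  fix p i assume "p \<in> {p. p permutes {0..<n}}" "i \<in> {0..<n}"
  then show "(\<lambda>N. A N $$ (i, p i)) \<longlonglongrightarrow> B $$ (i, p i)"
    by (intro assms(3)) (auto simp: permutes_in_image[of p "{0..<n}" i] dest: permutes_in_image)
qed

text \<open>The adjugate is polynomial in the entries and defined for singular matrices as well, so
  a limit of inverses can be taken as adjugate over determinant.\<close>

lemma tendsto_adj_mat: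
  fixes A :: "nat \<Rightarrow> complex mat"
  assumes A: "\<And>N. A N \<in> carrier_mat n n" "B \<in> carrier_mat n n"
    and lim: "\<And>i j. i < n \<Longrightarrow> j < n \<Longrightarrow> (\<lambda>N. A N $$ (i, j)) \<longlonglongrightarrow> B $$ (i, j)"
    and ij: "i < n" "j < n"
  shows "(\<lambda>N. adj_mat (A N) $$ (i, j)) \<longlonglongrightarrow> adj_mat B $$ (i, j)"
proof -
  have eq: "adj_mat C $$ (i, j) = (-1) ^ (j + i) * det (mat_delete C j i)" if "C \<in> carrier_mat n n" for C :: "complex mat"
    using that ij by (simp add: adj_mat_def cofactor_def)
  have "(\<lambda>N. det (mat_delete (A N) j i)) \<longlonglongrightarrow> det (mat_delete B j i)"
  proof (rule tendsto_det)
    show "mat_delete (A N) j i \<in> carrier_mat (n - 1) (n - 1)" for N by (rule mat_delete_carrier[OF A(1)])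
    show "mat_delete B j i \<in> carrier_mat (n - 1) (n - 1)" by (rule mat_delete_carrier[OF A(2)])
    fix i' j' assume ij': "i' < n - 1" "j' < n - 1"
    then have "mat_delete C j i $$ (i', j') = C $$ (if i' < j then i' else Suc i', if j' < i then j' else Suc j')"
      if "C \<in> carrier_mat n n" for C :: "complex mat"
      using that by (simp add: mat_delete_def)
    note this[OF A(1)] this[OF A(2)]
    then show "(\<lambda>N. mat_delete (A N) j i $$ (i', j')) \<longlonglongrightarrow> mat_delete B j i $$ (i', j')"
      using ij' by (simp only:) (intro lim, auto)
  qed
  then show ?thesis unfolding eq[OF A(1)] eq[OF A(2)] by (rule tendsto_mult_left)
qed

text \<open>Once the averaged Gram matrix \<open>A N\<close> is nonsingular, the product with the
  pseudo-inverse is \<open>K N\<close> times the inverse of \<open>A N\<close>; both averages are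
  normalized by the same \<open>N\<close>, which cancels. The limit is \<open>L * S\<close> times
  the inverse of \<open>S\<close>.\<close>

lemma tendsto_sample_mat_pinv:
  fixes \<phi> \<psi> :: "nat \<Rightarrow> 'a \<Rightarrow> complex" and S K L :: "complex mat"
  assumes S: "S \<in> carrier_mat r r" "det S \<noteq> 0"
    and L: "L \<in> carrier_mat s r"
    and lim_S: "\<And>i j. i < r \<Longrightarrow> j < r \<Longrightarrow>
      (\<lambda>N. (\<Sum>h<N. cnj (\<phi> i (x h)) * \<phi> j (x h)) / of_nat N) \<longlonglongrightarrow> S $$ (i, j)"
    and lim_K: "\<And>i j. i < s \<Longrightarrow> j < r \<Longrightarrow>
      (\<lambda>N. (\<Sum>h<N. cnj (\<psi> i (x h)) * \<phi> j (x h)) / of_nat N) \<longlonglongrightarrow> (L * S) $$ (i, j)"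
    and ij: "i < s" "j < r"
  shows "\<forall>\<^sub>F N in sequentially. pinv (sample_mat \<phi> r N x) \<in> carrier_mat N r"
    and "(\<lambda>N. (sample_mat \<psi> s N x * pinv (sample_mat \<phi> r N x)) $$ (i, j)) \<longlonglongrightarrow> L $$ (i, j)"
proof -
  define A where "A N = Matrix.mat r r (\<lambda>(i, j). (\<Sum>h<N. cnj (\<phi> i (x h)) * \<phi> j (x h)) / of_nat N)" for N
  define K where "K N = Matrix.mat s r (\<lambda>(i, j). (\<Sum>h<N. cnj (\<psi> i (x h)) * \<phi> j (x h)) / of_nat N)" for N
  let ?V = "\<lambda>N. sample_mat \<phi> r N x" and ?W = "\<lambda>N. sample_mat \<psi> s N x"
  have A: "A N \<in> carrier_mat r r" and K: "K N \<in> carrier_mat s r"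
    and V: "?V N \<in> carrier_mat r N" and W: "?W N \<in> carrier_mat s N" for N
    by (simp_all add: A_def K_def sample_mat_def)
  have A_lim: "(\<lambda>N. A N $$ (i, j)) \<longlonglongrightarrow> S $$ (i, j)" if "i < r" "j < r" for i j
    using lim_S[OF that] that by (simp add: A_def)
  have K_lim: "(\<lambda>N. K N $$ (i, j)) \<longlonglongrightarrow> (L * S) $$ (i, j)" if "i < s" "j < r" for i j
    using lim_K[OF that] that by (simp add: K_def del: index_mult_mat)
  have det_lim: "(\<lambda>N. det (A N)) \<longlonglongrightarrow> det S" by (rule tendsto_det[OF A S(1) A_lim])
  have adj: "adj_mat B \<in> carrier_mat r r" if "B \<in> carrier_mat r r" for B :: "complex mat"
    using adj_mat(1)[OF that] .
  have "(\<lambda>N. (K N * adj_mat (A N)) $$ (i, j) / det (A N)) \<longlonglongrightarrow> (L * S * adj_mat S) $$ (i, j) / det S"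
    unfolding mult_mat_index[OF K adj[OF A] ij] mult_mat_index[OF mult_carrier_mat[OF L S(1)] adj[OF S(1)] ij]
    by (intro tendsto_divide det_lim S(2) tendsto_sum tendsto_mult K_lim ij tendsto_adj_mat[OF A S(1) A_lim]) auto
  also have "L * S * adj_mat S = det S \<cdot>\<^sub>m L"
    using assoc_mult_mat[OF L S(1) adj[OF S(1)]] adj_mat(2)[OF S(1)] L mult_smult_distrib[OF L, of "1\<^sub>m r" r "det S"]
    by simp
  also have "(det S \<cdot>\<^sub>m L) $$ (i, j) / det S = L $$ (i, j)" using S(2) L ij by simp
  finally have lim: "(\<lambda>N. (K N * adj_mat (A N)) $$ (i, j) / det (A N)) \<longlonglongrightarrow> L $$ (i, j)" .
  have "\<forall>\<^sub>F N in sequentially. det (A N) \<noteq> 0"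
    using tendsto_imp_eventually_ne[OF det_lim S(2)] .
  then have ev: "\<forall>\<^sub>F N in sequentially. pinv (?V N) \<in> carrier_mat N r \<and> (?W N * pinv (?V N)) $$ (i, j) = (K N * adj_mat (A N)) $$ (i, j) / det (A N)"
    using eventually_gt_at_top[of 0]
  proof eventually_elim
    case (elim N)
    let ?Va = "mat_adjoint (?V N)"
    have Va: "?Va \<in> carrier_mat N r" using V by (rule mat_adjoint_carrier)
    have VV: "?V N * ?Va = of_nat N \<cdot>\<^sub>m A N"
    proof (rule eq_matI)
      fix i j assume "i < dim_row (of_nat N \<cdot>\<^sub>m A N)" "j < dim_col (of_nat N \<cdot>\<^sub>m A N)"
      then have ij: "i < r" "j < r" using A[of N] by auto
      then show "(?V N * ?Va) $$ (i, j) = (of_nat N \<cdot>\<^sub>m A N) $$ (i, j)"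
      proof -
        have "(?V N * ?Va) $$ (i, j) = (\<Sum>h<N. cnj (\<phi> i (x h)) * \<phi> j (x h))"
          unfolding mult_mat_index[OF V Va ij]
          by (intro sum.cong refl) (simp add: mat_adjoint_index[OF V] ij, simp add: sample_mat_def ij)
        then show ?thesis using elim ij by (simp add: A_def)
      qed
    qed (use V[of N] Va A[of N] in auto)
    have WV: "?W N * ?Va = of_nat N \<cdot>\<^sub>m K N"
    proof (rule eq_matI)
      fix i j assume "i < dim_row (of_nat N \<cdot>\<^sub>m K N)" "j < dim_col (of_nat N \<cdot>\<^sub>m K N)"
      then have ij: "i < s" "j < r" using K[of N] by auto
      then show "(?W N * ?Va) $$ (i, j) = (of_nat N \<cdot>\<^sub>m K N) $$ (i, j)"
      proof -
        have "(?W N * ?Va) $$ (i, j) = (\<Sum>h<N. cnj (\<psi> i (x h)) * \<phi> j (x h))"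
          unfolding mult_mat_index[OF W Va ij]
          by (intro sum.cong refl) (simp add: mat_adjoint_index[OF V] ij, simp add: sample_mat_def ij)
        then show ?thesis using elim ij by (simp add: K_def)
      qed
    qed (use W[of N] Va K[of N] in auto)
    \<comment> \<open>The matrix to invert is \<open>N\<close> times \<open>A N\<close>, and the
      adjugate gives its inverse only up to the determinant.\<close>
    define c where "c = 1 / (of_nat N * det (A N))"
    let ?T = "c \<cdot>\<^sub>m adj_mat (A N)"
    have T: "?T \<in> carrier_mat r r" using adj[OF A] by simp
    have "(?V N * ?Va) * ?T = (of_nat N * c * det (A N)) \<cdot>\<^sub>m 1\<^sub>m r"
      unfolding VV mult_smult_assoc_mat[OF A T] mult_smult_distrib[OF A adj[OF A]] adj_mat(2)[OF A]
      by (rule eq_matI) auto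
    also have "\<dots> = 1\<^sub>m r" using elim by (intro eq_matI) (auto simp: c_def)
    finally have pinv: "pinv (?V N) = ?Va * ?T" by (rule pinv_full_row_rank[OF V T])
    moreover have smult_smult: "of_nat N \<cdot>\<^sub>m (c \<cdot>\<^sub>m B) = (of_nat N * c) \<cdot>\<^sub>m B" for B
      by (intro eq_matI) auto
    ultimately have "?W N * pinv (?V N) = (of_nat N * c) \<cdot>\<^sub>m (K N * adj_mat (A N))"
      using assoc_mult_mat[OF W Va T] unfolding WV mult_smult_assoc_mat[OF K T] mult_smult_distrib[OF K adj[OF A]]
      by (simp only: smult_smult)
    then show ?case using pinv Va T elim ij K[of N] adj[OF A, of N] by (simp add: c_def del: index_mult_mat(1))
  qed
  then show "\<forall>\<^sub>F N in sequentially. pinv (?V N) \<in> carrier_mat N r" by eventually_elim simp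
  from ev have "\<forall>\<^sub>F N in sequentially. (?W N * pinv (?V N)) $$ (i, j) = (K N * adj_mat (A N)) $$ (i, j) / det (A N)"
    by eventually_elim simp
  then show "(\<lambda>N. (?W N * pinv (?V N)) $$ (i, j)) \<longlonglongrightarrow> L $$ (i, j)" using lim by (simp add: tendsto_cong)
qed

text \<open>Meant for Gram matrices of orthogonal families. \<open>mat_inverse\<close> returns an
  option, so invertibility has to be exhibited before its value can be identified.\<close>

lemma mat_inverse_diagonal:
  fixes D :: "complex mat"
  assumes D: "D \<in> carrier_mat n n"
    and offdiag: "\<And>i j. i < n \<Longrightarrow> j < n \<Longrightarrow> i \<noteq> j \<Longrightarrow> D $$ (i, j) = 0"
    and diag: "\<And>i. i < n \<Longrightarrow> D $$ (i, i) \<noteq> 0"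
  shows "the (mat_inverse D) = Matrix.mat n n (\<lambda>(i, j). if i = j then 1 / D $$ (i, i) else 0)"
proof -
  let ?E = "Matrix.mat n n (\<lambda>(i, j). if i = j then 1 / D $$ (i, i) else 0)"
  have E: "?E \<in> carrier_mat n n" by simp
  have DE: "D * ?E = 1\<^sub>m n"
  proof (rule eq_matI)
    fix i j assume "i < dim_row (1\<^sub>m n :: complex mat)" "j < dim_col (1\<^sub>m n :: complex mat)"
    then have ij: "i < n" "j < n" by auto
    have "(D * ?E) $$ (i, j) = (\<Sum>h<n. if h = j then D $$ (i, j) / D $$ (j, j) else 0)"
      unfolding mult_mat_index[OF D E ij] using ij by (intro sum.cong refl) auto
    also have "\<dots> = D $$ (i, j) / D $$ (j, j)" using ij by (simp add: sum.delta)
    also have "\<dots> = 1\<^sub>m n $$ (i, j)" using ij offdiag diag by auto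
    finally show "(D * ?E) $$ (i, j) = 1\<^sub>m n $$ (i, j)" .
  qed (use D in auto)
  have ED: "?E * D = 1\<^sub>m n" by (rule mat_mult_left_right_inverse[OF D E DE])
  have "D \<in> Units (ring_mat TYPE(complex) n ())"
    unfolding Units_def ring_mat_def using D E DE ED by auto
  then obtain B where B: "mat_inverse D = Some B" using mat_inverse(1)[OF D] by fastforce
  from mat_inverse(2)[OF D B] have B': "B * D = 1\<^sub>m n" "B \<in> carrier_mat n n" by auto
  have "B = B * (D * ?E)" using B' by (simp add: DE)
  also have "\<dots> = ?E" using assoc_mult_mat[OF B'(2) D E] B'(1) by simp
  finally show ?thesis by (simp add: B)
qed

section \<open>The adjoint of the composition operator on jets\<close>

text \<open>Coefficients vanish from the lowest upwards: when those below \<open>j\<close> are gone,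
  dividing by \<open>t ^ j\<close> leaves a polynomial with constant term \<open>c j\<close> that
  still tends to 0.\<close>

lemma polynomial_vanishing:
  fixes c :: "nat \<Rightarrow> complex"
  assumes \<epsilon>: "\<epsilon> > 0"
    and bound: "\<And>t::real. 0 < t \<Longrightarrow> t < \<epsilon> \<Longrightarrow> cmod (\<Sum>l\<le>m. c l * of_real (t ^ l)) \<le> C * t ^ (m + 1)"
  shows "j \<le> m \<Longrightarrow> c j = 0"
proof (induct j rule: less_induct)
  case (less j)
  have split: "(\<Sum>l\<le>m. c l * of_real (t ^ l)) = of_real (t ^ j) * (\<Sum>l=j..m. c l * of_real (t ^ (l - j)))" for t :: real
  proof -
    have "(\<Sum>l\<le>m. c l * of_real (t ^ l)) = (\<Sum>l=j..m. c l * of_real (t ^ l))"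
      using less by (intro sum.mono_neutral_right) auto
    also have "\<dots> = (\<Sum>l=j..m. of_real (t ^ j) * (c l * of_real (t ^ (l - j))))"
    proof (intro sum.cong refl)
      fix l assume "l \<in> {j..m}"
      then have "t ^ l = t ^ j * t ^ (l - j)" by (simp flip: power_add)
      then show "c l * of_real (t ^ l) = of_real (t ^ j) * (c l * of_real (t ^ (l - j)))" by simp
    qed
    finally show ?thesis by (simp only: sum_distrib_left)
  qed
  let ?g = "\<lambda>t::real. \<Sum>l=j..m. c l * of_real (t ^ (l - j))"
  have "(?g \<longlongrightarrow> (\<Sum>l=j..m. c l * of_real (0 ^ (l - j)))) (at_right 0)"
    by (intro tendsto_intros)
  moreover have "(\<Sum>l=j..m. c l * of_real (0 ^ (l - j))) = (\<Sum>l=j..m. if l = j then c j else 0)"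
    by (intro sum.cong refl) (auto simp: power_0_left)
  ultimately have lim1: "(?g \<longlongrightarrow> c j) (at_right 0)" using less(2) by (simp add: sum.delta)
  have lim2: "(?g \<longlongrightarrow> 0) (at_right 0)"
  proof (rule Lim_null_comparison)
    show "\<forall>\<^sub>F t in at_right 0. norm (?g t) \<le> C * t ^ (m + 1 - j)"
    proof -
      have "\<forall>\<^sub>F t in at_right (0::real). 0 < t \<and> t < \<epsilon>"
        using \<epsilon> by (auto simp: eventually_at_right_field)
      then show ?thesis
      proof eventually_elim
        case (elim t)
        have "t ^ j * norm (?g t) = cmod (\<Sum>l\<le>m. c l * of_real (t ^ l))"
          unfolding split using elim by (simp add: norm_mult norm_power)
        also have "\<dots> \<le> C * t ^ (m + 1)" using bound elim by blast
        also have "t ^ (m + 1) = t ^ j * t ^ (m + 1 - j)" using less(2) by (simp flip: power_add)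
        finally have "t ^ j * norm (?g t) \<le> t ^ j * (C * t ^ (m + 1 - j))" by (simp only: mult_ac)
        then show ?case using elim by simp
      qed
    qed
    have "((\<lambda>t. C * t ^ (m + 1 - j)) \<longlongrightarrow> C * 0 ^ (m + 1 - j)) (at_right 0)" by (intro tendsto_intros)
    then show "((\<lambda>t. C * t ^ (m + 1 - j)) \<longlongrightarrow> 0) (at_right 0)" using less(2) by (simp add: power_0_left)
  qed
  show ?case using tendsto_unique[OF _ lim1 lim2] by simp
qed

lemma wpoly_along_ray:
  assumes "g \<in> wpoly w p n"
  shows "\<exists>c. \<forall>t. g (p + t *\<^sub>R u) = of_real (w (p + t *\<^sub>R u)) * (\<Sum>l\<le>n. c l * of_real (t ^ l))"
  using assms unfolding wpoly_def
proof (induct rule: cfun.span_induct_alt)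
  case base
  show ?case by (rule exI[of _ "\<lambda>_. 0"]) simp
next
  case (step a x y)
  from step(1) obtain "is" where x: "x = wmonom w p is" "length is \<le> n" by auto
  from step(2) obtain c where c: "\<And>t. y (p + t *\<^sub>R u) = of_real (w (p + t *\<^sub>R u)) * (\<Sum>l\<le>n. c l * of_real (t ^ l))" by blast
  have mon: "monom_at p is (p + t *\<^sub>R u) = t ^ length is * (\<Prod>i\<leftarrow>is. u $ i)" for t
    by (induct "is") (simp_all add: monom_at_def)
  define d where "d l = (if l = length is then a * of_real (\<Prod>i\<leftarrow>is. u $ i) else 0)" for l
  have "(\<Sum>l\<le>n. d l * of_real (t ^ l)) = a * of_real (\<Prod>i\<leftarrow>is. u $ i) * of_real (t ^ length is)" for t :: real
  proof -
    have "(\<Sum>l\<le>n. d l * of_real (t ^ l)) = (\<Sum>l\<le>n. if l = length is then a * of_real (\<Prod>i\<leftarrow>is. u $ i) * of_real (t ^ length is) else 0)"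
      by (intro sum.cong refl) (auto simp: d_def)
    then show ?thesis using x(2) by (simp add: sum.delta)
  qed
  then have "cscale a x (p + t *\<^sub>R u) = of_real (w (p + t *\<^sub>R u)) * (\<Sum>l\<le>n. d l * of_real (t ^ l))" for t
    by (simp add: cscale_def x wmonom_def mon)
  then have "(cscale a x + y) (p + t *\<^sub>R u) = of_real (w (p + t *\<^sub>R u)) * (\<Sum>l\<le>n. (d l + c l) * of_real (t ^ l))" for t
    by (simp add: c distrib_left distrib_right sum.distrib)
  then show ?case by (intro exI[of _ "\<lambda>l. d l + c l"] allI)
qed

lemma continuous_on_wmonom:
  assumes "continuous_on UNIV w" shows "continuous_on UNIV (wmonom w p is)"
proof -
  have "continuous_on UNIV (monom_at p is)"
    unfolding monom_at_def[abs_def]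
    by (induct "is") (simp_all add: continuous_intros)
  then show ?thesis unfolding wmonom_def[abs_def] by (intro continuous_intros assms)
qed

lemma continuous_on_wpoly:
  assumes w: "continuous_on UNIV w" and g: "g \<in> wpoly w p n" shows "continuous_on UNIV g"
  using g unfolding wpoly_def
proof (induct rule: cfun.span_induct_alt)
  case base show ?case by (simp add: zero_fun_def)
next
  case (step c x y)
  then have "continuous_on UNIV x" using continuous_on_wmonom[OF w] by auto
  then have "continuous_on UNIV (\<lambda>z. c * x z + y z)" by (intro continuous_intros step(2))
  then show ?case by (simp add: plus_fun_def cscale_def)
qed

section \<open>Orthogonality to jets and order of vanishing at \<open>p\<close>\<close>

locale jet_rkhs = weighted_rkhs H ip k w p \<sigma>
  for H :: "(real ^ 'd \<Rightarrow> complex) set"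
    and ip :: "(real ^ 'd \<Rightarrow> complex) \<Rightarrow> (real ^ 'd \<Rightarrow> complex) \<Rightarrow> complex"
    and k :: "real ^ 'd \<Rightarrow> real ^ 'd \<Rightarrow> complex"
    and w :: "real ^ 'd \<Rightarrow> real" and p :: "real ^ 'd" and \<sigma> :: real +
  fixes v :: "nat \<Rightarrow> real ^ 'd \<Rightarrow> complex"
  assumes weight_cont: "continuous_on UNIV w"
    and jet_eq: "\<And>n. jet_space k p n = wpoly w p n"
    and basis: "jet_basis ip k p v"
begin

abbreviation jd :: "nat \<Rightarrow> nat" where "jd n \<equiv> jet_dim k p n"

lemma basis_span: "cspan (v ` {..<jd n}) = wpoly w p n"
  using basis unfolding jet_basis_def jet_eq by blast

lemma basis_orth: "i < jd n \<Longrightarrow> j < jd n \<Longrightarrow> i \<noteq> j \<Longrightarrow> ip (v i) (v j) = 0"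
  using basis unfolding jet_basis_def by blast

lemma basis_inj: "inj v" and basis_indep: "cfun.independent (range v)"
  using basis unfolding jet_basis_def cindependent_def by blast+

lemma basis_indep_image: "cfun.independent (v ` A)"
  by (rule cfun.independent_mono[OF basis_indep]) auto

lemma basis_in_wpoly: "i < jd n \<Longrightarrow> v i \<in> wpoly w p n"
  unfolding basis_span[symmetric] by (intro cfun.span_base) auto

lemma basis_in_some_wpoly: obtains n where "v i \<in> wpoly w p n"
proof -
  have "v i \<in> jet_space_all k p"
    using basis cfun.span_base[of "v i" "range v"] unfolding jet_basis_def by auto
  then show ?thesis using that unfolding jet_space_all_def jet_eq by blast
qed

lemma basis_mem: "v i \<in> H"
  using basis_in_some_wpoly[of i] wpoly_subset by blast

definition gr :: "nat \<Rightarrow> real" where "gr i = (hnorm ip (v i))\<^sup>2"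

lemma ip_basis_self: "ip (v i) (v i) = of_real (gr i)"
  unfolding gr_def by (rule ip_self[OF basis_mem])

lemma gr_pos: "gr i > 0"
proof -
  have "v i \<noteq> 0" using basis_indep cfun.dependent_zero[of "range v"] by (metis rangeI)
  then have "gr i \<noteq> 0" using ip_definite[OF basis_mem, of i] ip_basis_self by auto
  then show ?thesis unfolding gr_def by (simp add: order_less_le)
qed

lemma wpoly_coefficients:
  assumes "g \<in> wpoly w p n"
  obtains c where "g = (\<Sum>i<jd n. cscale (c i) (v i))"
  using assms cspan_image_coefficients[of "{..<jd n}" g v] unfolding basis_span by auto

lemma sum_basis_in_wpoly: "(\<Sum>i<jd n. cscale (c i) (v i)) \<in> wpoly w p n"
  by (intro cfun.subspace_sum cfun.subspace_scale subspace_wpoly basis_in_wpoly) auto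

lemma wpoly_mem: "g \<in> wpoly w p n \<Longrightarrow> g \<in> H"
  using wpoly_subset by blast

lemma jd_mono: assumes "m \<le> n" shows "jd m \<le> jd n"
proof -
  have "card (v ` {..<jd m}) \<le> card (v ` {..<jd n})"
  proof (rule conjunct2[OF cfun.independent_span_bound])
    show "cfun.independent (v ` {..<jd m})" by (rule basis_indep_image)
    show "v ` {..<jd m} \<subseteq> cspan (v ` {..<jd n})"
      unfolding basis_span using basis_in_wpoly wpoly_mono[OF assms, of w p] by blast
  qed simp
  moreover have "card (v ` {..<l}) = l" for l
    using card_image[OF inj_on_subset[OF basis_inj subset_UNIV]] by simp
  ultimately show ?thesis by simp
qed

definition proj :: "nat \<Rightarrow> (real ^ 'd \<Rightarrow> complex) \<Rightarrow> real ^ 'd \<Rightarrow> complex" where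
  "proj n h = (\<Sum>i<jd n. cscale (ip h (v i) / of_real (gr i)) (v i))"

lemma proj_in_wpoly: "proj n h \<in> wpoly w p n"
  unfolding proj_def by (rule sum_basis_in_wpoly)

lemma ip_sum_basis:
  assumes "j < jd n" shows "ip (\<Sum>i<jd n. cscale (c i) (v i)) (v j) = c j * of_real (gr j)"
proof -
  have "ip (\<Sum>i<jd n. cscale (c i) (v i)) (v j) = (\<Sum>i<jd n. c i * ip (v i) (v j))"
    by (simp add: ip_sum ip_scale mem_scale basis_mem)
  also have "\<dots> = (\<Sum>i<jd n. if i = j then c j * of_real (gr j) else 0)"
    using assms by (intro sum.cong refl) (auto simp: basis_orth ip_basis_self)
  finally show ?thesis using assms by (simp add: sum.delta)
qed

lemma proj_orth:
  assumes h: "h \<in> H" and g: "g \<in> wpoly w p n" shows "ip (h - proj n h) g = 0"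
proof -
  obtain c where c: "g = (\<Sum>i<jd n. cscale (c i) (v i))" using wpoly_coefficients[OF g] .
  have P: "proj n h \<in> H" using wpoly_mem[OF proj_in_wpoly] .
  have "ip (h - proj n h) (v j) = 0" if "j < jd n" for j
    using ip_sum_basis[OF that] h P gr_pos[of j]
    by (simp add: ip_diff basis_mem) (simp add: proj_def)
  then show ?thesis
    unfolding c using h P by (simp add: ip_sum_right ip_scale_right mem_diff mem_scale basis_mem)
qed

lemma hnorm_proj_le:
  assumes h: "h \<in> H" shows "hnorm ip (h - proj n h) \<le> hnorm ip h"
proof -
  let ?e = "h - proj n h"
  have P: "proj n h \<in> H" using wpoly_mem[OF proj_in_wpoly] .
  have e: "?e \<in> H" using h P by (rule mem_diff)
  have "ip ?e ?e = ip ?e h" 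
    using ip_diff_right[OF h P e] proj_orth[OF h proj_in_wpoly] by simp
  then have "(hnorm ip ?e)\<^sup>2 \<le> hnorm ip ?e * hnorm ip h"
    using Cauchy_Schwarz[OF e h] norm_ip_self[OF e] by (simp only:)
  then show ?thesis using hnorm_nonneg[OF e] hnorm_nonneg[OF h]
    by (cases "hnorm ip ?e = 0") (auto simp: power2_eq_square)
qed

lemma weight_bounded_near: "\<exists>W. \<forall>x. norm (x - p) \<le> 1 \<longrightarrow> w x \<le> W"
proof -
  have "\<exists>z\<in>cball p 1. \<forall>x\<in>cball p 1. w x \<le> w z"
    by (rule continuous_attains_sup[OF _ _ continuous_on_subset[OF weight_cont subset_UNIV]]) auto
  then obtain z where "\<And>x. x \<in> cball p 1 \<Longrightarrow> w x \<le> w z" by blast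
  then show ?thesis by (intro exI[of _ "w z"]) (simp add: dist_norm norm_minus_commute)
qed

lemma orthogonal_imp_vanishing:
  assumes h: "h \<in> H" and orth: "\<And>g. g \<in> wpoly w p m \<Longrightarrow> ip h g = 0"
  obtains C where "\<And>x. norm (x - p) \<le> 1 \<Longrightarrow> cmod (h x) \<le> C * norm (x - p) ^ (m + 1)"
proof -
  obtain W where W: "\<And>x. norm (x - p) \<le> 1 \<Longrightarrow> w x \<le> W" using weight_bounded_near by blast
  \<comment> \<open>The constant of \<open>orthogonal_wpoly_bound\<close> with the weight replaced
    by its bound \<open>W\<close> on the unit ball and the distance in the exponential by 1.\<close>
  define C where "C = hnorm ip h * (W * sqrt (exp ((1 / \<sigma>)\<^sup>2) / fact (m + 1)) * (1 / \<sigma>) ^ (m + 1))"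
  have "cmod (h x) \<le> C * norm (x - p) ^ (m + 1)" if x: "norm (x - p) \<le> 1" for x
  proof -
    have "w x \<le> W" using W[OF x] .
    moreover have "(norm (x - p) / \<sigma>)\<^sup>2 \<le> (1 / \<sigma>)\<^sup>2"
      using x sigma_pos by (intro power_mono divide_right_mono) auto
    ultimately have "w x * sqrt (exp ((norm (x - p) / \<sigma>)\<^sup>2) / fact (m + 1)) \<le> W * sqrt (exp ((1 / \<sigma>)\<^sup>2) / fact (m + 1))"
      using weight_pos[of x] by (intro mult_mono real_sqrt_le_mono divide_right_mono) auto
    then have "hnorm ip h * (w x * sqrt (exp ((norm (x - p) / \<sigma>)\<^sup>2) / fact (m + 1)) * (norm (x - p) / \<sigma>) ^ (m + 1))
      \<le> hnorm ip h * (W * sqrt (exp ((1 / \<sigma>)\<^sup>2) / fact (m + 1)) * (norm (x - p) / \<sigma>) ^ (m + 1))"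
      using sigma_pos by (intro mult_left_mono mult_right_mono hnorm_nonneg[OF h]) auto
    also have "\<dots> = C * norm (x - p) ^ (m + 1)" by (simp add: C_def power_divide)
    finally have "hnorm ip h * (w x * sqrt (exp ((norm (x - p) / \<sigma>)\<^sup>2) / fact (m + 1)) * (norm (x - p) / \<sigma>) ^ (m + 1))
      \<le> C * norm (x - p) ^ (m + 1)" .
    with orthogonal_wpoly_bound[where n = m and x = x, OF h orth] show ?thesis by (rule order_trans)
  qed
  then show ?thesis by (rule that)
qed

text \<open>The residual \<open>h - proj m h\<close> vanishes to order \<open>m + 1\<close> by
  \<open>orthogonal_imp_vanishing\<close>, and so does \<open>h\<close>; hence the projection does
  too. Along each ray the projection is the weight times a polynomial of degree at most
  \<open>m\<close>, which forces it to be 0.\<close>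

lemma vanishing_imp_orthogonal:
  assumes h: "h \<in> H" and \<epsilon>: "\<epsilon> > 0"
    and bound: "\<And>x. norm (x - p) \<le> \<epsilon> \<Longrightarrow> cmod (h x) \<le> C * norm (x - p) ^ (m + 1)"
    and g: "g \<in> wpoly w p m"
  shows "ip h g = 0"
proof -
  let ?P = "proj m h"
  have P: "?P \<in> H" using wpoly_mem[OF proj_in_wpoly] .
  obtain D where D: "\<And>x. norm (x - p) \<le> 1 \<Longrightarrow> cmod ((h - ?P) x) \<le> D * norm (x - p) ^ (m + 1)"
    using orthogonal_imp_vanishing[OF mem_diff[OF h P] proj_orth[OF h]] by blast
  have "?P x = 0" for x
  proof -
    define u where "u = x - p"
    obtain c where c: "\<And>t. ?P (p + t *\<^sub>R u) = of_real (w (p + t *\<^sub>R u)) * (\<Sum>l\<le>m. c l * of_real (t ^ l))"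
      using wpoly_along_ray[OF proj_in_wpoly] by blast
    have "compact ((\<lambda>t. w (p + t *\<^sub>R u)) ` {0..1})"
      by (rule compact_continuous_image[OF continuous_on_compose2[OF weight_cont]]) (auto intro!: continuous_intros)
    moreover have "(\<lambda>t. w (p + t *\<^sub>R u)) ` {0..1} \<noteq> {}" by simp
    ultimately obtain s0 where s0: "s0 \<in> (\<lambda>t. w (p + t *\<^sub>R u)) ` {0..1}"
      "\<And>s. s \<in> (\<lambda>t. w (p + t *\<^sub>R u)) ` {0..1} \<Longrightarrow> s0 \<le> s"
      using compact_attains_inf by meson
    from s0(1) obtain t0 where "s0 = w (p + t0 *\<^sub>R u)" by blast
    with s0(2) have t0: "\<And>t. t \<in> {0..1} \<Longrightarrow> w (p + t0 *\<^sub>R u) \<le> w (p + t *\<^sub>R u)" by blast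
    define \<delta> where "\<delta> = w (p + t0 *\<^sub>R u)"
    have \<delta>: "\<delta> > 0" unfolding \<delta>_def by (rule weight_pos)
    \<comment> \<open>Below \<open>\<eta>\<close> the point on the ray lies within both radii, 1 and
      \<open>\<epsilon>\<close>, and \<open>t\<close> stays where \<open>\<delta>\<close> bounds the
      weight from below; adding 1 to the norm covers \<open>u = 0\<close>.\<close>
    define \<eta> where "\<eta> = min 1 (min 1 \<epsilon> / (norm u + 1))"
    have \<eta>: "\<eta> > 0" using \<epsilon> by (simp add: \<eta>_def add_nonneg_pos)
    have "cmod (\<Sum>l\<le>m. c l * of_real (t ^ l)) \<le> ((C + D) * norm u ^ (m + 1) / \<delta>) * t ^ (m + 1)"
      if t: "0 < t" "t < \<eta>" for t
    proof -
      have "t \<le> min 1 \<epsilon> / (norm u + 1)" using t by (simp add: \<eta>_def)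
      moreover have "norm u + 1 > 0" by (simp add: add_nonneg_pos)
      ultimately have "t * (norm u + 1) \<le> min 1 \<epsilon>" using pos_le_divide_eq by blast
      moreover have "t * norm u \<le> t * (norm u + 1)" using t by simp
      ultimately have tu: "t * norm u \<le> 1" "t * norm u \<le> \<epsilon>" by linarith+
      have nt: "norm (p + t *\<^sub>R u - p) = t * norm u" using t by simp
      have "cmod (?P (p + t *\<^sub>R u)) \<le> cmod (h (p + t *\<^sub>R u)) + cmod ((h - ?P) (p + t *\<^sub>R u))"
        using norm_triangle_ineq4[of "h (p + t *\<^sub>R u)" "(h - ?P) (p + t *\<^sub>R u)"] by simp
      also have "\<dots> \<le> C * (t * norm u) ^ (m + 1) + D * (t * norm u) ^ (m + 1)"
        using bound[of "p + t *\<^sub>R u"] D[of "p + t *\<^sub>R u"] tu unfolding nt by (intro add_mono) auto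
      finally have "w (p + t *\<^sub>R u) * cmod (\<Sum>l\<le>m. c l * of_real (t ^ l)) \<le> (C + D) * (t * norm u) ^ (m + 1)"
        unfolding c using weight_pos[of "p + t *\<^sub>R u"] by (simp add: norm_mult distrib_right del: power_Suc)
      moreover have "\<delta> * cmod (\<Sum>l\<le>m. c l * of_real (t ^ l)) \<le> w (p + t *\<^sub>R u) * cmod (\<Sum>l\<le>m. c l * of_real (t ^ l))"
        unfolding \<delta>_def using t \<eta>_def by (intro mult_right_mono t0) auto
      ultimately have "\<delta> * cmod (\<Sum>l\<le>m. c l * of_real (t ^ l)) \<le> (C + D) * (t * norm u) ^ (m + 1)" by linarith
      then show ?thesis using \<delta> by (simp add: field_simps power_mult_distrib)
    qed
    then have "c l = 0" if "l \<le> m" for l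
      using polynomial_vanishing[OF \<eta>] that by blast
    then have "?P (p + 1 *\<^sub>R u) = 0" unfolding c by simp
    then show ?thesis by (simp add: u_def)
  qed
  then have "?P = 0" by (simp add: fun_eq_iff)
  then show ?thesis using proj_orth[OF h g] by simp
qed

text \<open>A monomial of degree above \<open>m\<close> visibly vanishes to order
  \<open>m + 1\<close>, so orthogonality follows without evaluating any inner product.\<close>

lemma monom_orthogonal:
  assumes "m < length is" "g \<in> wpoly w p m"
  shows "ip (wmonom w p is) g = 0"
proof -
  obtain W where W: "\<And>x. norm (x - p) \<le> 1 \<Longrightarrow> w x \<le> W" using weight_bounded_near by blast
  have W0: "W \<ge> 0" using W[of p] weight_pos[of p] by simp
  have le: "\<bar>monom_at p is x\<bar> \<le> norm (x - p) ^ length is" for x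
  proof (induct "is")
    case (Cons i "is")
    then show ?case unfolding monom_at_def using component_le_norm_cart[of "x - p" i]
      by (simp add: abs_mult mult_mono del: vector_minus_component)
  qed (simp add: monom_at_def)
  show ?thesis
  proof (rule vanishing_imp_orthogonal[where \<epsilon> = 1, OF _ _ _ assms(2)])
    show "wmonom w p is \<in> H" by (rule wpoly_mem[OF wmonom_in_wpoly[OF order_refl]])
    show "0 < (1::real)" by simp
    fix x assume x: "norm (x - p) \<le> 1"
    have "norm (w x) \<le> W" using W[OF x] weight_pos[of x] by simp
    moreover have "\<bar>monom_at p is x\<bar> \<le> norm (x - p) ^ (m + 1)"
      using le[of x] power_decreasing[of "m + 1" "length is" "norm (x - p)"] x assms(1) by simp
    ultimately show "cmod (wmonom w p is x) \<le> W * norm (x - p) ^ (m + 1)"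
      using W0 unfolding wmonom_def norm_of_real abs_mult by (intro mult_mono) auto
  qed
qed

text \<open>Only the finitely many lists of length at most \<open>m\<close> give nonzero inner
  products, so the sum of their quotients serves as \<open>C\<close> for all lists. This supplies
  the hypothesis of \<open>abs_bounded_functional\<close>.\<close>

lemma ip_monom_bound:
  assumes g: "g \<in> wpoly w p m" and \<tau>: "\<And>i. \<tau> i > 0"
  obtains C where "\<And>is. cmod (ip (wmonom w p is) g) \<le> C * (\<Prod>i\<leftarrow>is. \<tau> i)"
proof -
  let ?A = "{is::'d list. length is \<le> m}"
  have fin: "finite ?A" using finite_lists_length_le[of "UNIV :: 'd set" m] by simp
  have pos: "(\<Prod>i\<leftarrow>is. \<tau> i) > 0" for "is" by (induct "is") (simp_all add: \<tau>)
  define C where "C = (\<Sum>is\<in>?A. cmod (ip (wmonom w p is) g) / (\<Prod>i\<leftarrow>is. \<tau> i))"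
  have C0: "C \<ge> 0" unfolding C_def using pos by (intro sum_nonneg divide_nonneg_pos) auto
  show ?thesis
  proof
    fix "is" :: "'d list"
    show "cmod (ip (wmonom w p is) g) \<le> C * (\<Prod>i\<leftarrow>is. \<tau> i)"
    proof (cases "length is \<le> m")
      case True
      then have "cmod (ip (wmonom w p is) g) / (\<Prod>i\<leftarrow>is. \<tau> i) \<le> C"
        unfolding C_def using pos fin by (intro member_le_sum) (auto intro: divide_nonneg_pos)
      then show ?thesis using pos[of "is"] by (simp add: field_simps)
    next
      case False
      then have "ip (wmonom w p is) g = 0" using monom_orthogonal[of m "is" g] g by simp
      then show ?thesis using C0 pos[of "is"] by simp
    qed
  qed
qed

end

section \<open>Matrix entries of the adjoint and of the estimator\<close>

locale jet_rkhs_comp = jet_rkhs H ip k w p \<sigma> v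
  for H :: "(real ^ 'd \<Rightarrow> complex) set"
    and ip :: "(real ^ 'd \<Rightarrow> complex) \<Rightarrow> (real ^ 'd \<Rightarrow> complex) \<Rightarrow> complex"
    and k :: "real ^ 'd \<Rightarrow> real ^ 'd \<Rightarrow> complex"
    and w :: "real ^ 'd \<Rightarrow> real" and p :: "real ^ 'd" and \<sigma> :: real
    and v :: "nat \<Rightarrow> real ^ 'd \<Rightarrow> complex" +
  fixes f :: "real ^ 'd \<Rightarrow> real ^ 'd"
  assumes smooth: "smooth f" and fixpoint: "f p = p"
    and dense: "comp_densely_defined H ip f"
    and dom: "\<And>n. wpoly w p n \<subseteq> comp_domain H f"
begin

lemma basis_comp_mem: "v i \<circ> f \<in> H"
  using basis_in_some_wpoly[of i] dom unfolding comp_domain_def by blast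

lemma comp_orthogonal:
  assumes h: "h \<in> H" "h \<circ> f \<in> H" and orth: "\<And>g. g \<in> wpoly w p m \<Longrightarrow> ip h g = 0"
    and g: "g \<in> wpoly w p m"
  shows "ip (h \<circ> f) g = 0"
proof -
  obtain L where L: "L \<ge> 0" "\<And>x. norm (x - p) \<le> 1 \<Longrightarrow> norm (f x - f p) \<le> L * norm (x - p)"
    using smooth_imp_locally_Lipschitz[OF smooth] by metis
  obtain C where C: "\<And>x. norm (x - p) \<le> 1 \<Longrightarrow> cmod (h x) \<le> C * norm (x - p) ^ (m + 1)"
    using orthogonal_imp_vanishing[OF h(1) orth] by blast
  show ?thesis
  proof (rule vanishing_imp_orthogonal[OF h(2) _ _ g])
    \<comment> \<open>Within this radius both \<open>x\<close> and, by the Lipschitz bound,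
      \<open>f x\<close> stay at distance at most 1 from \<open>p\<close>.\<close>
    show "0 < 1 / (L + 1)" using L(1) by simp
    fix x assume x: "norm (x - p) \<le> 1 / (L + 1)"
    then have "norm (x - p) * (L + 1) \<le> 1" using L(1) by (simp add: field_simps)
    then have "norm (x - p) + L * norm (x - p) \<le> 1" by (simp add: algebra_simps)
    then have x1: "norm (x - p) \<le> 1" "L * norm (x - p) \<le> 1"
      using mult_nonneg_nonneg[OF L(1) norm_ge_zero[of "x - p"]] norm_ge_zero[of "x - p"] by linarith+
    have fx: "norm (f x - p) \<le> L * norm (x - p)" using L(2)[OF x1(1)] by (simp add: fixpoint)
    then have "cmod (h (f x)) \<le> C * norm (f x - p) ^ (m + 1)" using C x1 by simp
    also have "\<dots> \<le> \<bar>C\<bar> * (L * norm (x - p)) ^ (m + 1)"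
      using fx by (intro mult_mono power_mono) auto
    finally show "cmod ((h \<circ> f) x) \<le> (\<bar>C\<bar> * L ^ (m + 1)) * norm (x - p) ^ (m + 1)"
      by (simp add: power_mult_distrib mult_ac)
  qed
qed

text \<open>Split \<open>h\<close> into its projection and a part orthogonal to
  \<open>wpoly w p m\<close>. After composition the latter stays orthogonal to \<open>g\<close>, so
  the pairing depends on finitely many coefficients of \<open>h\<close> and is represented by
  \<open>?u\<close>. Density of the domain makes this representative unique.\<close>

lemma comp_adjoint_wpoly:
  assumes g: "g \<in> wpoly w p m"
  shows "comp_adjoint H ip f g = (\<Sum>i<jd m. cscale (cnj (ip (v i \<circ> f) g) / of_real (gr i)) (v i))"
  (is "_ = ?u")
proof -
  have gH: "g \<in> H" using wpoly_mem[OF g] .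
  have u: "?u \<in> H" using wpoly_mem[OF sum_basis_in_wpoly] .
  have ipu: "ip (h \<circ> f) g = ip h ?u" if h: "h \<in> comp_domain H f" for h
  proof -
    have hH: "h \<in> H" and hf: "h \<circ> f \<in> H" using h by (auto simp: comp_domain_def)
    let ?P = "proj m h"
    have P: "?P \<in> H" "?P \<circ> f \<in> H"
      using dom[of m] proj_in_wpoly[of m h] by (auto simp: comp_domain_def)
    have eq: "(h - ?P) \<circ> f = (h \<circ> f) - (?P \<circ> f)" by (rule ext) simp
    have "ip ((h - ?P) \<circ> f) g = 0"
    proof (rule comp_orthogonal[OF mem_diff[OF hH P(1)] _ proj_orth[OF hH] g])
      show "(h - ?P) \<circ> f \<in> H" unfolding eq by (rule mem_diff[OF hf P(2)])
    qed
    then have "ip (h \<circ> f) g = ip (?P \<circ> f) g" unfolding eq using hf P(2) gH by (simp add: ip_diff)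
    also have "?P \<circ> f = (\<Sum>i<jd m. cscale (ip h (v i) / of_real (gr i)) (v i \<circ> f))"
      by (rule ext) (simp add: proj_def sum_fun_apply cscale_def)
    also have "ip \<dots> g = (\<Sum>i<jd m. ip h (v i) / of_real (gr i) * ip (v i \<circ> f) g)"
      by (simp add: ip_sum ip_scale mem_scale basis_comp_mem gH)
    also have "\<dots> = ip h ?u"
      using hH by (simp add: ip_sum_right ip_scale_right mem_scale basis_mem mult_ac)
    finally show ?thesis .
  qed
  show ?thesis unfolding comp_adjoint_def
  proof (rule the_equality)
    show "?u \<in> H \<and> (\<forall>h\<in>comp_domain H f. ip (h \<circ> f) g = ip h ?u)" using u ipu by blast
    fix u' assume u': "u' \<in> H \<and> (\<forall>h\<in>comp_domain H f. ip (h \<circ> f) g = ip h u')"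
    let ?d = "u' - ?u"
    have d: "?d \<in> H" using u u' by (intro mem_diff) auto
    have orth: "ip h ?d = 0" if h: "h \<in> comp_domain H f" for h
    proof -
      have "h \<in> H" using h by (auto simp: comp_domain_def)
      then show ?thesis using ip_diff_right[of u' ?u h] u u' h ipu[OF h] by simp
    qed
    \<comment> \<open>\<open>?d\<close> is orthogonal to the domain, so in \<open>ip ?d ?d\<close>
      the first argument may be replaced by \<open>?d - h\<close>, which is small in norm.\<close>
    have "(hnorm ip ?d)\<^sup>2 \<le> e * hnorm ip ?d" if e: "e > 0" for e
    proof -
      obtain h where h: "h \<in> comp_domain H f" "hnorm ip (?d - h) < e"
        using dense d e unfolding comp_densely_defined_def by blast
      have hH: "h \<in> H" using h by (auto simp: comp_domain_def)
      have "ip ?d ?d = ip (?d - h) ?d" using ip_diff[OF d hH d] orth[OF h(1)] by simp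
      then have "(hnorm ip ?d)\<^sup>2 \<le> hnorm ip (?d - h) * hnorm ip ?d"
        using Cauchy_Schwarz[OF mem_diff[OF d hH] d] norm_ip_self[OF d] by (simp only:)
      also have "\<dots> \<le> e * hnorm ip ?d" using h(2) hnorm_nonneg[OF d] by (intro mult_right_mono) auto
      finally show ?thesis .
    qed
    then have "hnorm ip ?d \<le> e" if "e > 0" for e
      using that hnorm_nonneg[OF d] by (cases "hnorm ip ?d = 0") (auto simp: power2_eq_square)
    then have "hnorm ip ?d \<le> 0" by (rule field_le_epsilon[of _ 0, simplified])
    then have "ip ?d ?d = 0" using ip_self[OF d] hnorm_nonneg[OF d] by simp
    then have "?d = 0" by (rule ip_definite[OF d])
    then show "u' = ?u" by simp
  qed
qed

lemma comp_adjoint_mat_index: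
  assumes "i < jd m" "j < jd m"
  shows "comp_adjoint_mat H ip k p v f m $$ (i, j) = cnj (ip (v i \<circ> f) (v j)) / of_real (gr i)"
proof -
  note indep = basis_indep_image[of "{..<jd m}"]
  have rep: "crepresentation (v ` {..<jd m}) (cscale c (v l)) (v i) = (if l = i then c else 0)" if "l < jd m" for c l
    using that basis_inj
    by (simp add: cfun.representation_scale[OF indep] cfun.span_base cfun.representation_basis[OF indep] inj_eq)
  have "comp_adjoint_mat H ip k p v f m $$ (i, j)
    = crepresentation (v ` {..<jd m}) (\<Sum>l<jd m. cscale (cnj (ip (v l \<circ> f) (v j)) / of_real (gr l)) (v l)) (v i)"
    using assms by (simp add: comp_adjoint_mat_def Let_def comp_adjoint_wpoly[OF basis_in_wpoly[OF assms(2)]])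
  also have "\<dots> = (\<Sum>l<jd m. crepresentation (v ` {..<jd m}) (cscale (cnj (ip (v l \<circ> f) (v j)) / of_real (gr l)) (v l)) (v i))"
    by (subst cfun.representation_sum[OF indep]) (auto intro: cfun.span_scale[OF cfun.span_base])
  also have "\<dots> = (\<Sum>l<jd m. if l = i then cnj (ip (v i \<circ> f) (v j)) / of_real (gr i) else 0)"
    by (intro sum.cong refl) (auto simp: rep)
  finally show ?thesis using assms(1) by (simp add: sum.delta)
qed

text \<open>Both Gram matrices are diagonal because the basis is orthogonal, so their effect on an
  entry is the factor \<open>gr j / gr i\<close>.\<close>

lemma tendsto_jet_dmd:
  assumes mn: "m \<le> n" and ij: "i < jd m" "j < jd m"
    and lim: "(\<lambda>N. (sample_mat (\<lambda>i. v i \<circ> f) (jd m) N x * pinv (sample_mat v (jd n) N x)) $$ (i, j)) \<longlonglongrightarrow> l"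
    and pinv: "\<forall>\<^sub>F N in sequentially. pinv (sample_mat v (jd n) N x) \<in> carrier_mat N (jd n)"
  shows "(\<lambda>N. jet_dmd ip k p v m n N x (\<lambda>h. f (x h)) $$ (i, j)) \<longlonglongrightarrow> l * of_real (gr j) / of_real (gr i)"
proof -
  have gram: "gram_mat ip v (jd n) \<in> carrier_mat (jd n) (jd n)" for n by (simp add: gram_mat_def)
  have gram_index: "gram_mat ip v (jd n) $$ (i, j) = (if i = j then of_real (gr i) else 0)" if "i < jd n" "j < jd n" for i j n
    using that by (simp add: gram_mat_def basis_orth ip_basis_self)
  define A where "A = the (mat_inverse (gram_mat ip v (jd m)))"
  have A_eq: "A = Matrix.mat (jd m) (jd m) (\<lambda>(i, j). if i = j then 1 / gram_mat ip v (jd m) $$ (i, i) else 0)"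
    unfolding A_def by (rule mat_inverse_diagonal[OF gram]) (use gr_pos in \<open>auto simp: gram_index less_imp_neq[symmetric]\<close>)
  have A: "A \<in> carrier_mat (jd m) (jd m)" unfolding A_eq by simp
  have A_index: "A $$ (i, l) = (if i = l then 1 / of_real (gr i) else 0)" if "i < jd m" "l < jd m" for i l
    unfolding A_eq using that by (simp add: gram_index)
  have jn: "j < jd n" using ij(2) jd_mono[OF mn] by simp
  let ?W = "\<lambda>N. sample_mat (\<lambda>i. v i \<circ> f) (jd m) N x" and ?P = "\<lambda>N. pinv (sample_mat v (jd n) N x)"
  have W: "?W N \<in> carrier_mat (jd m) N" for N by (simp add: sample_mat_def)
  have "\<forall>\<^sub>F N in sequentially. jet_dmd ip k p v m n N x (\<lambda>h. f (x h)) $$ (i, j)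
      = (?W N * ?P N) $$ (i, j) * of_real (gr j) / of_real (gr i)"
    using pinv
  proof eventually_elim
    case (elim N)
    have WP: "?W N * ?P N \<in> carrier_mat (jd m) (jd n)" using W elim by (rule mult_carrier_mat)
    have eq: "sample_mat v (jd m) N (\<lambda>h. f (x h)) = ?W N" by (simp add: sample_mat_def)
    have "jet_dmd ip k p v m n N x (\<lambda>h. f (x h)) $$ (i, j) = (A * (?W N * ?P N) * gram_mat ip v (jd n)) $$ (i, j)"
      unfolding jet_dmd_def Let_def A_def[symmetric] eq using ij assoc_mult_mat[OF A W elim] by simp
    also have "\<dots> = (\<Sum>h<jd n. (A * (?W N * ?P N)) $$ (i, h) * gram_mat ip v (jd n) $$ (h, j))"
      by (rule mult_mat_index[OF mult_carrier_mat[OF A WP] gram ij(1) jn])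
    also have "\<dots> = (\<Sum>h<jd n. if h = j then (A * (?W N * ?P N)) $$ (i, j) * of_real (gr j) else 0)"
      using jn by (intro sum.cong refl) (auto simp: gram_index simp del: index_mult_mat)
    also have "\<dots> = (A * (?W N * ?P N)) $$ (i, j) * of_real (gr j)" using jn by (simp add: sum.delta)
    also have "(A * (?W N * ?P N)) $$ (i, j) = (\<Sum>h<jd m. A $$ (i, h) * (?W N * ?P N) $$ (h, j))"
      by (rule mult_mat_index[OF A WP ij(1) jn])
    also have "\<dots> = (\<Sum>h<jd m. if h = i then (?W N * ?P N) $$ (i, j) / of_real (gr i) else 0)"
      using ij by (intro sum.cong refl) (auto simp: A_index simp del: index_mult_mat)
    also have "\<dots> = (?W N * ?P N) $$ (i, j) / of_real (gr i)" using ij by (simp add: sum.delta)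
    finally show ?case by simp
  qed
  moreover have "(\<lambda>N. (?W N * ?P N) $$ (i, j) * of_real (gr j) / of_real (gr i)) \<longlonglongrightarrow> l * of_real (gr j) / of_real (gr i)"
    using gr_pos[of i] by (intro tendsto_intros lim) auto
  ultimately show ?thesis by (simp add: tendsto_cong)
qed

end

section \<open>Almost sure limit of the estimator\<close>

lemma cmod_power2_add: "(cmod (a + b))\<^sup>2 = (cmod a)\<^sup>2 + (cmod b)\<^sup>2 + 2 * Re (cnj a * b)"
  by (simp add: cmod_power2) (simp add: power2_eq_square algebra_simps)

text \<open>Compact support makes continuous functions bounded almost everywhere. This gives their
  integrability and meets the boundedness hypothesis of the strong law.\<close>

locale compactly_supported_measure = finite_measure \<mu>
  for \<mu> :: "(real ^ 'd) measure" and K :: "(real ^ 'd) set" +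
  assumes sets_borel [measurable_cong]: "sets \<mu> = sets borel"
    and compact_supp: "compact K" and AE_supp: "AE x in \<mu>. x \<in> K"
begin

lemma continuous_AE_bounded:
  fixes g :: "real ^ 'd \<Rightarrow> 'b::real_normed_vector"
  assumes "continuous_on UNIV g"
  obtains B where "AE x in \<mu>. norm (g x) \<le> B"
proof -
  have "compact (g ` K)"
    by (rule compact_continuous_image[OF continuous_on_subset[OF assms]]) (auto simp: compact_supp)
  then obtain B where B: "\<And>x. x \<in> K \<Longrightarrow> norm (g x) \<le> B"
    using compact_imp_bounded bounded_iff by (metis imageI)
  have "AE x in \<mu>. norm (g x) \<le> B" using AE_supp by eventually_elim (rule B)
  then show ?thesis by (rule that)
qed

lemma continuous_integrable:
  fixes g :: "real ^ 'd \<Rightarrow> 'b::{banach, second_countable_topology}"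
  assumes "continuous_on UNIV g" shows "integrable \<mu> g"
proof -
  obtain B where "AE x in \<mu>. norm (g x) \<le> B" using continuous_AE_bounded[OF assms] .
  moreover have "g \<in> borel_measurable \<mu>"
    using borel_measurable_continuous_onI[OF assms] by (simp add: measurable_cong_sets[OF sets_borel refl])
  ultimately show ?thesis by (rule integrable_const_bound)
qed

end

context jet_rkhs
begin

lemma basis_cont: "continuous_on UNIV (v i)"
  using basis_in_some_wpoly[of i] continuous_on_wpoly[OF weight_cont] by blast

text \<open>A null vector of the Gram matrix yields a combination \<open>g\<close> of basis elements
  whose L2 norm is 0. Injectivity into L2 makes \<open>g\<close> zero, and independence of the basis
  makes the vector zero.\<close>

lemma gram_integral_nonsingular:
  assumes \<mu>: "compactly_supported_measure \<mu> K"
    and inj: "\<And>g. g \<in> wpoly w p n \<Longrightarrow> (AE x in \<mu>. g x = 0) \<Longrightarrow> g = 0"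
  shows "det (Matrix.mat (jd n) (jd n) (\<lambda>(a, b). LINT x|\<mu>. cnj (v a x) * v b x)) \<noteq> 0"
    (is "det ?S \<noteq> 0")
proof
  interpret compactly_supported_measure \<mu> K by (rule \<mu>)
  have S: "?S \<in> carrier_mat (jd n) (jd n)" by simp
  assume "det ?S = 0"
  then obtain z where z: "z \<in> carrier_vec (jd n)" "z \<noteq> 0\<^sub>v (jd n)" "?S *\<^sub>v z = 0\<^sub>v (jd n)"
    using det_0_iff_vec_prod_zero[OF S] by blast
  define c where "c b = vec_index z b" for b
  define g where "g = (\<Sum>b<jd n. cscale (c b) (v b))"
  have g: "g \<in> wpoly w p n" unfolding g_def by (rule sum_basis_in_wpoly)
  have g_apply: "g x = (\<Sum>b<jd n. c b * v b x)" for x by (simp add: g_def sum_fun_apply cscale_def)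
  have gc: "continuous_on UNIV g" by (rule continuous_on_wpoly[OF weight_cont g])
  have row: "(LINT x|\<mu>. cnj (v a x) * g x) = 0" if "a < jd n" for a
  proof -
    have "(LINT x|\<mu>. cnj (v a x) * g x) = (LINT x|\<mu>. (\<Sum>b<jd n. c b * (cnj (v a x) * v b x)))"
      by (simp add: g_apply sum_distrib_left mult_ac)
    also have "\<dots> = (\<Sum>b<jd n. c b * (LINT x|\<mu>. cnj (v a x) * v b x))"
      by (subst Bochner_Integration.integral_sum)
         (auto intro!: integrable_mult_right continuous_integrable continuous_intros basis_cont)
    also have "\<dots> = vec_index (?S *\<^sub>v z) a"
      using that z(1) by (simp add: scalar_prod_def c_def mult_ac atLeast0LessThan)
    also have "\<dots> = 0" using that by (simp add: z(3))
    finally show ?thesis .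
  qed
  have "(LINT x|\<mu>. cnj (g x) * g x) = (LINT x|\<mu>. (\<Sum>a<jd n. cnj (c a) * (cnj (v a x) * g x)))"
  proof -
    have "cnj (g x) = (\<Sum>a<jd n. cnj (c a) * cnj (v a x))" for x by (simp add: g_apply)
    then have "cnj (g x) * g x = (\<Sum>a<jd n. cnj (c a) * (cnj (v a x) * g x))" for x
      by (simp only: sum_distrib_right mult.assoc)
    then show ?thesis by (simp only:)
  qed
  also have "\<dots> = (\<Sum>a<jd n. cnj (c a) * (LINT x|\<mu>. cnj (v a x) * g x))"
    by (subst Bochner_Integration.integral_sum)
       (auto intro!: integrable_mult_right continuous_integrable continuous_intros basis_cont gc)
  also have "\<dots> = 0" by (simp add: row)
  finally have "Re (LINT x|\<mu>. cnj (g x) * g x) = 0" by simp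
  moreover have "Re (LINT x|\<mu>. cnj (g x) * g x) = (LINT x|\<mu>. (cmod (g x))\<^sup>2)"
  proof -
    have "integrable \<mu> (\<lambda>x. cnj (g x) * g x)" by (intro continuous_integrable continuous_intros gc)
    moreover have "Re (cnj z * z) = (cmod z)\<^sup>2" for z
      by (simp add: cmod_power2) (simp add: power2_eq_square)
    ultimately show ?thesis by (simp only: integral_Re[symmetric])
  qed
  ultimately have "(LINT x|\<mu>. (cmod (g x))\<^sup>2) = 0" by simp
  then have "AE x in \<mu>. (cmod (g x))\<^sup>2 = 0"
    by (subst (asm) integral_nonneg_eq_0_iff_AE) (auto intro!: continuous_integrable continuous_intros gc)
  then have "g = 0" by (intro inj[OF g]) simp
  have "c b = 0" if "b < jd n" for b
    using ip_sum_basis[OF that, of c] gr_pos[of b] ip_zero_left[OF basis_mem] \<open>g = 0\<close>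
    unfolding g_def[symmetric] by simp
  then have "z = 0\<^sub>v (jd n)" using z(1) by (intro eq_vecI) (auto simp: c_def)
  with z(2) show False by simp
qed

end

context jet_rkhs_comp
begin

lemma comp_cont: "continuous_on UNIV (v i \<circ> f)"
  using continuous_on_compose2[OF basis_cont smooth_imp_continuous[OF smooth]] by (simp add: comp_def)

abbreviation dmd_error :: "nat \<Rightarrow> nat \<Rightarrow> (nat \<Rightarrow> real ^ 'd) \<Rightarrow> nat \<Rightarrow> complex mat" where
  "dmd_error m n x N \<equiv> comp_adjoint_mat H ip k p v f m - jet_dmd ip k p v m n N x (\<lambda>i. f (x i))"

text \<open>The limit of the least-squares problem is the normal equation \<open>L * S = Km\<close>,
  so row \<open>i\<close> of \<open>L\<close> encodes the L2 projection \<open>P i\<close> of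
  \<open>v i \<circ> f\<close>. Subtracting the projection taken in \<open>H\<close> gives
  \<open>q i\<close>, whose inner product with \<open>v j\<close> is the limiting error up to
  conjugation, sign and \<open>gr i\<close>.\<close>

lemma AE_tendsto_error:
  assumes \<mu>: "compactly_supported_measure \<mu> K"
    and M: "prob_space M" and indep: "prob_space.indep_vars M (\<lambda>_. borel) X UNIV"
    and law: "\<And>i. distr M borel (X i) = \<mu>"
    and inj: "\<And>g. g \<in> wpoly w p n \<Longrightarrow> (AE x in \<mu>. g x = 0) \<Longrightarrow> g = 0"
    and mn: "m \<le> n"
  obtains q where "\<And>i. q i \<in> wpoly w p n"
    and "\<And>i. i < jd m \<Longrightarrow>
      (LINT x|\<mu>. (cmod (q i x))\<^sup>2) \<le> (LINT x|\<mu>. (cmod (((v i \<circ> f) - proj n (v i \<circ> f)) x))\<^sup>2)"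
    and "AE \<omega> in M. \<forall>i<jd m. \<forall>j<jd m. (\<lambda>N. (dmd_error m n (\<lambda>i. X i \<omega>) N) $$ (i, j))
      \<longlonglongrightarrow> - cnj (ip (q i) (v j)) / of_real (gr i)"
proof -
  interpret compactly_supported_measure \<mu> K by (rule \<mu>)
  interpret M: prob_space M by (rule M)
  let ?r = "jd n" and ?s = "jd m"
  define S where "S = Matrix.mat ?r ?r (\<lambda>(a, b). LINT x|\<mu>. cnj (v a x) * v b x)"
  define Km where "Km = Matrix.mat ?s ?r (\<lambda>(a, b). LINT x|\<mu>. cnj ((v a \<circ> f) x) * v b x)"
  have S: "S \<in> carrier_mat ?r ?r" and Km: "Km \<in> carrier_mat ?s ?r" by (simp_all add: S_def Km_def)
  have det: "det S \<noteq> 0" unfolding S_def by (rule gram_integral_nonsingular[OF \<mu> inj])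
  define L where "L = (1 / det S) \<cdot>\<^sub>m (Km * adj_mat S)"
  have adj: "adj_mat S \<in> carrier_mat ?r ?r" using adj_mat(1)[OF S] .
  have L: "L \<in> carrier_mat ?s ?r" unfolding L_def using Km adj by simp
  have LS: "L * S = Km"
  proof -
    have "L * S = (1 / det S) \<cdot>\<^sub>m (Km * (det S \<cdot>\<^sub>m 1\<^sub>m ?r))"
      unfolding L_def mult_smult_assoc_mat[OF mult_carrier_mat[OF Km adj] S] assoc_mult_mat[OF Km adj S] adj_mat(3)[OF S] ..
    also have "\<dots> = (1 / det S) \<cdot>\<^sub>m (det S \<cdot>\<^sub>m Km)"
      unfolding mult_smult_distrib[OF Km one_carrier_mat] right_mult_one_mat[OF Km] ..
    also have "\<dots> = Km" using det by (intro eq_matI) auto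
    finally show ?thesis .
  qed
  \<comment> \<open>The coefficients are conjugated because \<open>sample_mat\<close> stores
    conjugated values.\<close>
  define P where "P i = (\<Sum>b<?r. cscale (cnj (L $$ (i, b))) (v b))" for i
  define q where "q i = P i - proj n (v i \<circ> f)" for i
  have P: "P i \<in> wpoly w p n" for i unfolding P_def by (rule sum_basis_in_wpoly)
  have q: "q i \<in> wpoly w p n" for i
    unfolding q_def by (intro cfun.subspace_diff subspace_wpoly P proj_in_wpoly)
  have ip_q: "ip (q i) (v j) = cnj (L $$ (i, j)) * of_real (gr j) - ip (v i \<circ> f) (v j)" if "j < ?r" for i j
  proof -
    have "ip (q i) (v j) = ip (P i) (v j) - ip (proj n (v i \<circ> f)) (v j)"
      unfolding q_def by (rule ip_diff[OF wpoly_mem[OF P] wpoly_mem[OF proj_in_wpoly] basis_mem])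
    then show ?thesis
      unfolding P_def proj_def ip_sum_basis[OF that] using gr_pos[of j] by simp
  qed
  note cont = continuous_on_wpoly[OF weight_cont]
  have int_le: "(LINT x|\<mu>. (cmod (q i x))\<^sup>2) \<le> (LINT x|\<mu>. (cmod (((v i \<circ> f) - proj n (v i \<circ> f)) x))\<^sup>2)"
    if i: "i < ?s" for i
  proof -
    define u where "u x = v i (f x) - P i x" for x
    have hc: "continuous_on UNIV (\<lambda>x. v i (f x))" using comp_cont by (simp add: comp_def)
    have u: "continuous_on UNIV u" unfolding u_def by (intro continuous_intros hc cont[OF P])
    have orth: "(LINT x|\<mu>. cnj (u x) * v b x) = 0" if b: "b < ?r" for b
    proof -
      have eq: "cnj (u x) * v b x = cnj ((v i \<circ> f) x) * v b x - (\<Sum>a<?r. L $$ (i, a) * (cnj (v a x) * v b x))" for x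
        by (simp add: u_def P_def sum_fun_apply cscale_def left_diff_distrib sum_distrib_right mult.assoc)
      have "(LINT x|\<mu>. cnj (u x) * v b x) = (LINT x|\<mu>. cnj ((v i \<circ> f) x) * v b x)
          - (LINT x|\<mu>. (\<Sum>a<?r. L $$ (i, a) * (cnj (v a x) * v b x)))"
        unfolding eq
        by (rule Bochner_Integration.integral_diff)
           (intro continuous_integrable continuous_intros basis_cont comp_cont)+
      also have "(LINT x|\<mu>. (\<Sum>a<?r. L $$ (i, a) * (cnj (v a x) * v b x)))
          = (\<Sum>a<?r. L $$ (i, a) * (LINT x|\<mu>. cnj (v a x) * v b x))"
        by (subst Bochner_Integration.integral_sum)
           (auto intro!: integrable_mult_right continuous_integrable continuous_intros basis_cont)
      also have "\<dots> = (L * S) $$ (i, b)"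
        unfolding mult_mat_index[OF L S i b] using b by (intro sum.cong refl) (simp add: S_def)
      also have "\<dots> = (LINT x|\<mu>. cnj ((v i \<circ> f) x) * v b x)"
        unfolding LS using i b by (simp add: Km_def)
      finally show ?thesis by simp
    qed
    obtain c where c: "q i = (\<Sum>b<?r. cscale (c b) (v b))" using wpoly_coefficients[OF q] .
    have "(LINT x|\<mu>. cnj (u x) * q i x) = (LINT x|\<mu>. (\<Sum>b<?r. c b * (cnj (u x) * v b x)))"
      by (simp add: c sum_fun_apply cscale_def sum_distrib_left mult_ac)
    also have "\<dots> = (\<Sum>b<?r. c b * (LINT x|\<mu>. cnj (u x) * v b x))"
      by (subst Bochner_Integration.integral_sum)
         (auto intro!: integrable_mult_right continuous_integrable continuous_intros basis_cont u)
    also have "\<dots> = 0" by (simp add: orth)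
    finally have uq: "(LINT x|\<mu>. cnj (u x) * q i x) = 0" .
    have int: "integrable \<mu> (\<lambda>x. (cmod (u x))\<^sup>2)" "integrable \<mu> (\<lambda>x. (cmod (q i x))\<^sup>2)"
      "integrable \<mu> (\<lambda>x. cnj (u x) * q i x)"
      by (intro continuous_integrable continuous_intros u cont[OF q])+
    define R where "R x = Re (cnj (u x) * q i x)" for x
    have R: "integrable \<mu> R" unfolding R_def using integrable_Re[OF int(3)] .
    \<comment> \<open>An orthogonal decomposition in L2: \<open>u\<close> is orthogonal to
      \<open>wpoly w p n\<close>, which contains \<open>q i\<close>, so Pythagoras gives the
      inequality.\<close>
    have "((v i \<circ> f) - proj n (v i \<circ> f)) x = u x + q i x" for x by (simp add: u_def q_def)
    then have "(LINT x|\<mu>. (cmod (((v i \<circ> f) - proj n (v i \<circ> f)) x))\<^sup>2)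
      = (LINT x|\<mu>. (cmod (u x))\<^sup>2 + (cmod (q i x))\<^sup>2 + 2 * R x)"
      by (simp only: cmod_power2_add R_def)
    also have "\<dots> = (LINT x|\<mu>. (cmod (u x))\<^sup>2) + (LINT x|\<mu>. (cmod (q i x))\<^sup>2) + 2 * (LINT x|\<mu>. R x)"
      using int R by simp
    also have "(LINT x|\<mu>. R x) = 0" unfolding R_def using integral_Re[OF int(3)] uq by (simp only: zero_complex.sel)
    moreover have "0 \<le> (LINT x|\<mu>. (cmod (u x))\<^sup>2)" by (intro integral_nonneg_AE) simp
    ultimately show ?thesis by linarith
  qed
  \<comment> \<open>Stated for a general continuous family because it is used twice, for the basis
    and for the basis composed with \<open>f\<close>.\<close>
  have law_g: "AE \<omega> in M. \<forall>a b. (\<lambda>N. (\<Sum>h<N. cnj (g a (X h \<omega>)) * v b (X h \<omega>)) / of_nat N)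
      \<longlonglongrightarrow> (LINT x|\<mu>. cnj (g a x) * v b x)"
    if g: "\<And>a. continuous_on UNIV (g a)" for g :: "nat \<Rightarrow> real ^ 'd \<Rightarrow> complex"
    unfolding AE_all_countable
  proof (intro allI)
    fix a b
    have c: "continuous_on UNIV (\<lambda>x. cnj (g a x) * v b x)" by (intro continuous_intros basis_cont g)
    obtain B where B: "AE x in \<mu>. norm (cnj (g a x) * v b x) \<le> B" using continuous_AE_bounded[OF c] .
    show "AE \<omega> in M. (\<lambda>N. (\<Sum>h<N. cnj (g a (X h \<omega>)) * v b (X h \<omega>)) / of_nat N)
      \<longlonglongrightarrow> (LINT x|\<mu>. cnj (g a x) * v b x)"
      by (rule M.bounded_strong_law_complex[OF indep law borel_measurable_continuous_onI[OF c] B])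
  qed
  have "AE \<omega> in M. \<forall>i<?s. \<forall>j<?s. (\<lambda>N. (dmd_error m n (\<lambda>i. X i \<omega>) N) $$ (i, j))
      \<longlonglongrightarrow> - cnj (ip (q i) (v j)) / of_real (gr i)"
    using law_g[OF basis_cont] law_g[OF comp_cont]
  proof (eventually_elim, intro allI impI)
    fix \<omega> i j
    assume vv: "\<forall>a b. (\<lambda>N. (\<Sum>h<N. cnj (v a (X h \<omega>)) * v b (X h \<omega>)) / of_nat N)
      \<longlonglongrightarrow> (LINT x|\<mu>. cnj (v a x) * v b x)"
      and fv: "\<forall>a b. (\<lambda>N. (\<Sum>h<N. cnj ((v a \<circ> f) (X h \<omega>)) * v b (X h \<omega>)) / of_nat N)
      \<longlonglongrightarrow> (LINT x|\<mu>. cnj ((v a \<circ> f) x) * v b x)"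
      and ij: "i < ?s" "j < ?s"
    have jn: "j < ?r" using ij(2) jd_mono[OF mn] by simp
    note lim = tendsto_sample_mat_pinv[where S = S and L = L and r = ?r and s = ?s and \<phi> = v
        and \<psi> = "\<lambda>i. v i \<circ> f" and x = "\<lambda>i. X i \<omega>", OF S det L]
    have "(\<lambda>N. (\<Sum>h<N. cnj (v a (X h \<omega>)) * v b (X h \<omega>)) / of_nat N) \<longlonglongrightarrow> S $$ (a, b)" if "a < ?r" "b < ?r" for a b
      using vv that by (simp add: S_def)
    moreover have "(\<lambda>N. (\<Sum>h<N. cnj ((v a \<circ> f) (X h \<omega>)) * v b (X h \<omega>)) / of_nat N) \<longlonglongrightarrow> (L * S) $$ (a, b)" if "a < ?s" "b < ?r" for a b
      unfolding LS using fv that by (simp add: Km_def)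
    ultimately have l: "\<forall>\<^sub>F N in sequentially. pinv (sample_mat v ?r N (\<lambda>i. X i \<omega>)) \<in> carrier_mat N ?r"
      "(\<lambda>N. (sample_mat (\<lambda>i. v i \<circ> f) ?s N (\<lambda>i. X i \<omega>) * pinv (sample_mat v ?r N (\<lambda>i. X i \<omega>))) $$ (i, j)) \<longlonglongrightarrow> L $$ (i, j)"
      using lim ij jn by blast+
    have "(\<lambda>N. comp_adjoint_mat H ip k p v f m $$ (i, j) - jet_dmd ip k p v m n N (\<lambda>i. X i \<omega>) (\<lambda>i. f (X i \<omega>)) $$ (i, j))
      \<longlonglongrightarrow> cnj (ip (v i \<circ> f) (v j)) / of_real (gr i) - L $$ (i, j) * of_real (gr j) / of_real (gr i)"
      unfolding comp_adjoint_mat_index[OF ij] by (intro tendsto_diff tendsto_const tendsto_jet_dmd mn ij l)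
    moreover have "cnj (ip (v i \<circ> f) (v j)) / of_real (gr i) - L $$ (i, j) * of_real (gr j) / of_real (gr i)
      = - cnj (ip (q i) (v j)) / of_real (gr i)"
      unfolding ip_q[OF jn] by (simp add: diff_divide_distrib)
    ultimately show "(\<lambda>N. (dmd_error m n (\<lambda>i. X i \<omega>) N) $$ (i, j))
      \<longlonglongrightarrow> - cnj (ip (q i) (v j)) / of_real (gr i)"
      using ij by (simp add: jet_dmd_def Let_def)
  qed
  with q int_le show ?thesis by (rule that)
qed

end

text \<open>The Euclidean norm is at most the sum of the moduli, a loss that depends on the matrix
  size alone.\<close>

lemma frobenius_norm_le:
  fixes E :: "complex mat"
  assumes "\<And>i j. i < dim_row E \<Longrightarrow> j < dim_col E \<Longrightarrow> cmod (E $$ (i, j)) \<le> b i j"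
  shows "frobenius_norm E \<le> (\<Sum>i<dim_row E. \<Sum>j<dim_col E. b i j)"
proof -
  have "frobenius_norm E = L2_set (\<lambda>(i, j). cmod (E $$ (i, j))) ({..<dim_row E} \<times> {..<dim_col E})"
    by (simp add: frobenius_norm_def L2_set_def sum.cartesian_product split_def)
  also have "\<dots> \<le> (\<Sum>(i, j)\<in>{..<dim_row E} \<times> {..<dim_col E}. cmod (E $$ (i, j)))"
    by (rule L2_set_le_sum) auto
  also have "\<dots> \<le> (\<Sum>(i, j)\<in>{..<dim_row E} \<times> {..<dim_col E}. b i j)"
    using assms by (intro sum_mono) auto
  finally show ?thesis by (simp add: sum.cartesian_product)
qed

lemma tendsto_frobenius_norm:
  fixes E :: "nat \<Rightarrow> complex mat"
  assumes "\<And>N. E N \<in> carrier_mat s t" "F \<in> carrier_mat s t"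
    and "\<And>i j. i < s \<Longrightarrow> j < t \<Longrightarrow> (\<lambda>N. E N $$ (i, j)) \<longlonglongrightarrow> F $$ (i, j)"
  shows "(\<lambda>N. frobenius_norm (E N)) \<longlonglongrightarrow> frobenius_norm F"
proof -
  have "dim_row (E N) = s" "dim_col (E N) = t" "dim_row F = s" "dim_col F = t" for N
    using assms(1)[of N] assms(2) by auto
  then show ?thesis unfolding frobenius_norm_def by (simp, intro tendsto_intros assms(3)) auto
qed

lemma essinf_on_lower_bound:
  fixes \<rho> :: "real ^ 'd \<Rightarrow> real"
  assumes "essinf_on R \<rho> > 0" "R \<in> sets borel"
  obtains \<epsilon> where "\<epsilon> > 0" "AE x in lborel. x \<in> R \<longrightarrow> \<epsilon> \<le> \<rho> x"
proof -
  let ?s = "esssup (restrict_space lborel R) (\<lambda>x. - ereal (\<rho> x))"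
  have "0 < - ?s" using assms(1) by (simp add: essinf_on_def)
  \<comment> \<open>Any real number strictly between 0 and the essential infimum is a positive lower
    bound almost everywhere and leaves extended reals behind.\<close>
  then obtain e where e: "0 < ereal e" "ereal e < - ?s" using ereal_dense2 by blast
  have "AE x in restrict_space lborel R. - ereal (\<rho> x) \<le> ?s" by (rule esssup_AE)
  then have "AE x in restrict_space lborel R. e \<le> \<rho> x"
  proof eventually_elim
    case (elim x)
    then have "- ?s \<le> ereal (\<rho> x)" using ereal_uminus_le_reorder by blast
    with e(2) have "ereal e < ereal (\<rho> x)" by (rule less_le_trans)
    then show ?case by simp
  qed
  then have "AE x in lborel. x \<in> R \<longrightarrow> e \<le> \<rho> x"
    by (subst (asm) AE_restrict_space_iff) (use assms(2) in auto)
  then show ?thesis using e(1) that by simp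
qed

section \<open>The error bound\<close>

context jet_rkhs
begin

text \<open>On the rectangle the density is at least \<open>\<epsilon>\<close> and the weight at
  least its minimum \<open>w z\<close>, so the L2 norm for \<open>\<mu>\<close> can feed
  \<open>ip_wpoly_bound\<close>. It is essential that \<open>c\<close> is obtained before
  \<open>n\<close> and \<open>q\<close>.\<close>

lemma ip_basis_L2_bound:
  fixes a r :: "real ^ 'd" and \<rho> :: "real ^ 'd \<Rightarrow> real"
  assumes \<mu>: "compactly_supported_measure \<mu> K" and \<mu>_def: "\<mu> = density lborel (\<lambda>x. ennreal (\<rho> x))"
    and \<rho>: "\<rho> \<in> borel_measurable borel" "\<And>x. 0 \<le> \<rho> x"
    and r: "\<And>i. r $ i > 0" and D: "\<And>i. 2 * (1 + \<bar>a $ i - p $ i\<bar> / r $ i) \<le> D"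
    and \<epsilon>: "\<epsilon> > 0" "AE x in lborel. x \<in> rectangle a r \<longrightarrow> \<epsilon> \<le> \<rho> x"
  obtains c where "c \<ge> 0" "\<And>n q J. q \<in> wpoly w p n \<Longrightarrow> 0 \<le> J \<Longrightarrow> (LINT x|\<mu>. (cmod (q x))\<^sup>2) \<le> J\<^sup>2 \<Longrightarrow>
    cmod (ip q (v j)) \<le> c * (real (n + 1) ^ CARD('d) * D ^ n * J)"
proof -
  interpret compactly_supported_measure \<mu> K by (rule \<mu>)
  have R: "compact (rectangle a r)" "rectangle a r \<noteq> {}"
  proof -
    have "a \<in> rectangle a r" using r by (simp add: rectangle_def less_imp_le)
    then show "rectangle a r \<noteq> {}" by blast
  qed (simp add: rectangle_eq_cbox)
  obtain z where z: "\<And>y. y \<in> rectangle a r \<Longrightarrow> w z \<le> w y"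
    using continuous_attains_inf[OF R continuous_on_subset[OF weight_cont subset_UNIV]] by blast
  obtain m where vj: "v j \<in> wpoly w p m" using basis_in_some_wpoly .
  have "r $ i / 2 > 0" for i using r[of i] by simp
  then obtain C where C: "\<And>is. cmod (ip (wmonom w p is) (v j)) \<le> C * (\<Prod>i\<leftarrow>is. r $ i / 2)"
    using ip_monom_bound[OF vj, of "\<lambda>i. r $ i / 2"] by blast
  have C0: "C \<ge> 0" using C[of "[]"] by (auto intro: order_trans[OF norm_ge_zero])
  have K: "cheb_norm r > 0" unfolding cheb_norm_def using r by (intro prod_pos) auto
  define c where "c = C / (sqrt \<epsilon> * w z * sqrt (cheb_norm r))"
  show ?thesis
  proof
    show "c \<ge> 0" using C0 \<epsilon>(1) weight_pos[of z] K by (simp add: c_def)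
    fix n q and J :: real assume q: "q \<in> wpoly w p n" and J: "0 \<le> J" "(LINT x|\<mu>. (cmod (q x))\<^sup>2) \<le> J\<^sup>2"
    let ?g = "\<lambda>y. indicator (rectangle a r) y * (cmod (q y))\<^sup>2"
    have qc: "continuous_on UNIV (\<lambda>y. (cmod (q y))\<^sup>2)"
      by (intro continuous_intros continuous_on_wpoly[OF weight_cont q])
    have int: "integrable lborel ?g"
      using borel_integrable_compact[OF R(1) continuous_on_subset[OF qc subset_UNIV]] by simp
    have int\<mu>: "integrable lborel (\<lambda>x. \<rho> x * (cmod (q x))\<^sup>2)"
      using continuous_integrable[OF qc] \<rho> borel_measurable_continuous_onI[OF qc]
      unfolding \<mu>_def by (subst (asm) integrable_density) auto
    have "\<epsilon> * (LINT y|lborel. ?g y) = (LINT y|lborel. \<epsilon> * ?g y)" by simp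
    also have "\<dots> \<le> (LINT x|lborel. \<rho> x * (cmod (q x))\<^sup>2)"
    proof (rule integral_mono_AE)
      show "integrable lborel (\<lambda>y. \<epsilon> * ?g y)" using int by simp
      show "AE x in lborel. \<epsilon> * ?g x \<le> \<rho> x * (cmod (q x))\<^sup>2"
        using \<epsilon>(2)
      proof eventually_elim
        case (elim x)
        show ?case
        proof (cases "x \<in> rectangle a r")
          case True
          then show ?thesis using mult_right_mono[OF elim[rule_format, OF True] zero_le_power2[of "cmod (q x)"]] by simp
        qed (simp add: \<rho>(2))
      qed
    qed (rule int\<mu>)
    also have "\<dots> = (LINT x|\<mu>. (cmod (q x))\<^sup>2)"
      unfolding \<mu>_def using \<rho> borel_measurable_continuous_onI[OF qc] by (subst integral_density) auto
    also have "\<dots> \<le> J\<^sup>2" by (rule J(2))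
    finally have "(LINT y|lborel. ?g y) \<le> (J / sqrt \<epsilon>)\<^sup>2"
      using \<epsilon>(1) by (simp add: power_divide field_simps)
    from ip_wpoly_bound[OF r basis_mem q C D weight_pos[of z] z int this]
    have "cmod (ip q (v j)) \<le> real (n + 1) ^ CARD('d) * C * D ^ n * ((J / sqrt \<epsilon>) / (w z * sqrt (cheb_norm r)))"
      using J(1) \<epsilon>(1) by simp
    also have "\<dots> = c * (real (n + 1) ^ CARD('d) * D ^ n * J)"
      by (simp add: c_def mult_ac)
    finally show "cmod (ip q (v j)) \<le> c * (real (n + 1) ^ CARD('d) * D ^ n * J)" .
  qed
qed

end

context jet_rkhs_comp
begin

text \<open>For a probability measure a pointwise bound on the support is also an L2 bound. The
  residual has norm at most that of \<open>h\<close>, so \<open>n\<close> enters only through the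
  factorial and the power.\<close>

lemma projection_error_L2:
  assumes \<mu>: "compactly_supported_measure \<mu> K" and prob: "prob_space \<mu>"
    and B1: "\<And>x. x \<in> K \<Longrightarrow> norm (x - p) \<le> B1" and h: "h \<in> H" "continuous_on UNIV h"
    and W: "\<And>x. x \<in> K \<Longrightarrow> w x \<le> W" and nonneg: "0 \<le> B1" "0 \<le> W"
  shows "(LINT x|\<mu>. (cmod ((h - proj n h) x))\<^sup>2) \<le>
    (hnorm ip h * W * sqrt (exp ((B1 / \<sigma>)\<^sup>2)) / sqrt (fact (n + 1)) * (B1 / \<sigma>) ^ (n + 1))\<^sup>2"
    (is "_ \<le> ?J\<^sup>2")
proof -
  interpret compactly_supported_measure \<mu> K by (rule \<mu>)
  define e where "e = h - proj n h"
  have P: "proj n h \<in> H" using wpoly_mem[OF proj_in_wpoly] .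
  have eH: "e \<in> H" unfolding e_def using h(1) P by (rule mem_diff)
  have orth: "ip e g = 0" if "g \<in> wpoly w p n" for g unfolding e_def by (rule proj_orth[OF h(1) that])
  have "continuous_on UNIV (\<lambda>x. h x - proj n h x)"
    by (intro continuous_on_diff h(2) continuous_on_wpoly[OF weight_cont proj_in_wpoly])
  then have "continuous_on UNIV e" by (simp only: e_def fun_diff_def)
  then have ec: "continuous_on UNIV (\<lambda>x. (cmod (e x))\<^sup>2)" by (intro continuous_on_power continuous_on_norm)
  show ?thesis unfolding e_def[symmetric]
  proof (rule prob_space.integral_le_const[OF prob])
    show "integrable \<mu> (\<lambda>x. (cmod (e x))\<^sup>2)" by (rule continuous_integrable[OF ec])
    show "AE x in \<mu>. (cmod (e x))\<^sup>2 \<le> ?J\<^sup>2"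
      using AE_supp
    proof eventually_elim
      case (elim x)
      have b: "norm (x - p) / \<sigma> \<le> B1 / \<sigma>" using B1[OF elim] sigma_pos by (simp add: divide_right_mono)
      have "cmod (e x) \<le> hnorm ip e * (w x * sqrt (exp ((norm (x - p) / \<sigma>)\<^sup>2) / fact (n + 1)) * (norm (x - p) / \<sigma>) ^ (n + 1))"
        by (rule orthogonal_wpoly_bound[OF eH orth])
      also have "\<dots> \<le> hnorm ip h * (W * sqrt (exp ((B1 / \<sigma>)\<^sup>2) / fact (n + 1)) * (B1 / \<sigma>) ^ (n + 1))"
      proof (rule mult_mono[OF hnorm_proj_le[OF h(1), of n, folded e_def]])
        have b0: "0 \<le> norm (x - p) / \<sigma>" using sigma_pos by simp
        have exp_le: "sqrt (exp ((norm (x - p) / \<sigma>)\<^sup>2) / fact (n + 1)) \<le> sqrt (exp ((B1 / \<sigma>)\<^sup>2) / fact (n + 1))"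
        proof -
          have "exp ((norm (x - p) / \<sigma>)\<^sup>2) \<le> exp ((B1 / \<sigma>)\<^sup>2)"
            unfolding exp_le_cancel_iff by (rule power_mono[OF b b0])
          then show ?thesis by (intro real_sqrt_le_mono divide_right_mono) auto
        qed
        have "w x * sqrt (exp ((norm (x - p) / \<sigma>)\<^sup>2) / fact (n + 1)) \<le> W * sqrt (exp ((B1 / \<sigma>)\<^sup>2) / fact (n + 1))"
          by (rule mult_mono[OF W[OF elim] exp_le nonneg(2)]) simp
        then show "w x * sqrt (exp ((norm (x - p) / \<sigma>)\<^sup>2) / fact (n + 1)) * (norm (x - p) / \<sigma>) ^ (n + 1)
          \<le> W * sqrt (exp ((B1 / \<sigma>)\<^sup>2) / fact (n + 1)) * (B1 / \<sigma>) ^ (n + 1)"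
        proof (rule mult_mono[OF _ power_mono[OF b b0]])
          show "0 \<le> W * sqrt (exp ((B1 / \<sigma>)\<^sup>2) / fact (n + 1))" using nonneg(2) by simp
          show "0 \<le> (norm (x - p) / \<sigma>) ^ (n + 1)" by (rule zero_le_power[OF b0])
        qed
        show "0 \<le> w x * sqrt (exp ((norm (x - p) / \<sigma>)\<^sup>2) / fact (n + 1)) * (norm (x - p) / \<sigma>) ^ (n + 1)"
          using less_imp_le[OF weight_pos[of x]] b0 by (intro mult_nonneg_nonneg zero_le_power) auto
      qed (rule hnorm_nonneg[OF h(1)])
      also have "\<dots> = ?J" by (simp add: real_sqrt_divide del: fact_Suc power_Suc)
      finally show ?case by (rule power_mono) simp
    qed
  qed
qed

lemma limsup_error_bound:
  fixes a r :: "real ^ 'd" and \<rho> :: "real ^ 'd \<Rightarrow> real" and X :: "nat \<Rightarrow> 'w \<Rightarrow> real ^ 'd"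
  assumes \<mu>: "compactly_supported_measure \<mu> K" and \<mu>_def: "\<mu> = density lborel (\<lambda>x. ennreal (\<rho> x))"
    and prob: "prob_space \<mu>"
    and \<rho>: "\<rho> \<in> borel_measurable borel" "\<And>x. 0 \<le> \<rho> x"
    and r: "\<And>i. r $ i > 0" and B2: "\<And>i. 1 + \<bar>a $ i - p $ i\<bar> / r $ i \<le> B2"
    and \<epsilon>: "\<epsilon> > 0" "AE x in lborel. x \<in> rectangle a r \<longrightarrow> \<epsilon> \<le> \<rho> x"
    and B1: "\<And>x. x \<in> K \<Longrightarrow> norm (x - p) \<le> B1"
    and M: "prob_space M" and indep: "prob_space.indep_vars M (\<lambda>_. borel) X UNIV"
    and law: "\<And>i. distr M borel (X i) = \<mu>"
  shows "\<exists>C>0. \<forall>n. 1 \<le> n \<longrightarrow> m \<le> n \<longrightarrow>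
    (\<forall>g\<in>wpoly w p n. (AE x in \<mu>. g x = 0) \<longrightarrow> g = 0) \<longrightarrow>
    (AE \<omega> in M. limsup (\<lambda>N. ereal (frobenius_norm (dmd_error m n (\<lambda>i. X i \<omega>) N)))
        \<le> ereal (C * real n ^ (m + CARD('d)) / sqrt (fact (n + 1)) * (2 * B1 * B2 / \<sigma>) ^ n))"
proof -
  interpret compactly_supported_measure \<mu> K by (rule \<mu>)
  interpret \<mu>: prob_space \<mu> by (rule prob)
  have K_ne: "K \<noteq> {}" using AE_supp \<mu>.AE_False by auto
  then obtain x0 where "x0 \<in> K" by blast
  then have B1_0: "0 \<le> B1" using order_trans[OF norm_ge_zero B1] by blast
  \<comment> \<open>Any index would do; it only settles the sign of \<open>B2\<close>.\<close>
  have "0 \<le> \<bar>a $ undefined - p $ undefined\<bar> / r $ undefined"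
    using r[of undefined] by (simp add: less_imp_le)
  then have B2_0: "0 \<le> B2" using B2[of undefined] by linarith
  obtain W where W: "\<And>x. x \<in> K \<Longrightarrow> w x \<le> W"
    using continuous_attains_sup[OF compact_supp K_ne continuous_on_subset[OF weight_cont subset_UNIV]] by blast
  have W0: "0 \<le> W" using order_trans[OF less_imp_le[OF weight_pos] W[OF \<open>x0 \<in> K\<close>]] .
  have D: "2 * (1 + \<bar>a $ i - p $ i\<bar> / r $ i) \<le> 2 * B2" for i using B2[of i] by simp
  have "\<forall>j. \<exists>c. 0 \<le> c \<and> (\<forall>n q J. q \<in> wpoly w p n \<longrightarrow> 0 \<le> J \<longrightarrow> (LINT x|\<mu>. (cmod (q x))\<^sup>2) \<le> J\<^sup>2 \<longrightarrow>
    cmod (ip q (v j)) \<le> c * (real (n + 1) ^ CARD('d) * (2 * B2) ^ n * J))"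
  proof
    fix j
    show "\<exists>c. 0 \<le> c \<and> (\<forall>n q J. q \<in> wpoly w p n \<longrightarrow> 0 \<le> J \<longrightarrow> (LINT x|\<mu>. (cmod (q x))\<^sup>2) \<le> J\<^sup>2 \<longrightarrow>
      cmod (ip q (v j)) \<le> c * (real (n + 1) ^ CARD('d) * (2 * B2) ^ n * J))"
    proof (rule ip_basis_L2_bound[OF \<mu> \<mu>_def \<rho> r D \<epsilon>, of j])
      fix c :: real
      assume c: "0 \<le> c" "\<And>n q J. q \<in> wpoly w p n \<Longrightarrow> 0 \<le> J \<Longrightarrow> (LINT x|\<mu>. (cmod (q x))\<^sup>2) \<le> J\<^sup>2 \<Longrightarrow>
        cmod (ip q (v j)) \<le> c * (real (n + 1) ^ CARD('d) * (2 * B2) ^ n * J)"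
      show ?thesis by (intro exI[of _ c] conjI allI impI c)
    qed
  qed
  from choice[OF this] obtain c where c': "\<forall>j. 0 \<le> c j \<and> (\<forall>n q J. q \<in> wpoly w p n \<longrightarrow> 0 \<le> J \<longrightarrow> (LINT x|\<mu>. (cmod (q x))\<^sup>2) \<le> J\<^sup>2 \<longrightarrow>
      cmod (ip q (v j)) \<le> c j * (real (n + 1) ^ CARD('d) * (2 * B2) ^ n * J))" ..
  have c: "\<And>j. c j \<ge> 0"
    "\<And>j n q J. q \<in> wpoly w p n \<Longrightarrow> 0 \<le> J \<Longrightarrow> (LINT x|\<mu>. (cmod (q x))\<^sup>2) \<le> J\<^sup>2 \<Longrightarrow>
    cmod (ip q (v j)) \<le> c j * (real (n + 1) ^ CARD('d) * (2 * B2) ^ n * J)"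
    using c' by simp_all
  let ?s = "jd m"
  \<comment> \<open>The factors of the projection error that are free of \<open>n\<close>. One
    \<open>B1 / \<sigma>\<close> is taken out of the power \<open>n + 1\<close>, which leaves the
    exponent \<open>n\<close> of the claim.\<close>
  define G where "G i = hnorm ip (v i \<circ> f) * W * sqrt (exp ((B1 / \<sigma>)\<^sup>2)) * (B1 / \<sigma>)" for i
  have G: "G i \<ge> 0" for i
    unfolding G_def using hnorm_nonneg[OF basis_comp_mem] W0 B1_0 sigma_pos by simp
  define T where "T = (\<Sum>i<?s. \<Sum>j<?s. c j * G i / gr i)"
  have T: "T \<ge> 0" unfolding T_def using c(1) G gr_pos
    by (intro sum_nonneg divide_nonneg_pos mult_nonneg_nonneg) auto
  \<comment> \<open>The factor \<open>2 ^ CARD('d)\<close> pays for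
    \<open>n + 1 \<le> 2 * n\<close>, and the summand 1 keeps \<open>C\<close> positive when
    \<open>T\<close> is 0.\<close>
  define C where "C = 1 + 2 ^ CARD('d) * T"
  show ?thesis
  proof (intro exI[of _ C] conjI allI impI)
    show "C > 0" unfolding C_def using T by (simp add: add_pos_nonneg)
    fix n :: nat
    assume n: "1 \<le> n" and mn: "m \<le> n" and inj: "\<forall>g\<in>wpoly w p n. (AE x in \<mu>. g x = 0) \<longrightarrow> g = 0"
    let ?bound = "C * real n ^ (m + CARD('d)) / sqrt (fact (n + 1)) * (2 * B1 * B2 / \<sigma>) ^ n"
    have inj': "g = 0" if "g \<in> wpoly w p n" "AE x in \<mu>. g x = 0" for g using inj that by blast
    obtain q where q: "\<And>i. q i \<in> wpoly w p n"
      and q_le: "\<And>i. i < ?s \<Longrightarrow>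
        (LINT x|\<mu>. (cmod (q i x))\<^sup>2) \<le> (LINT x|\<mu>. (cmod (((v i \<circ> f) - proj n (v i \<circ> f)) x))\<^sup>2)"
      and lim: "AE \<omega> in M. \<forall>i<?s. \<forall>j<?s. (\<lambda>N. (dmd_error m n (\<lambda>i. X i \<omega>) N) $$ (i, j))
        \<longlonglongrightarrow> - cnj (ip (q i) (v j)) / of_real (gr i)"
    proof (rule AE_tendsto_error[OF \<mu> M indep law inj' mn])
      fix q
      assume "\<And>i. q i \<in> wpoly w p n"
        "\<And>i. i < ?s \<Longrightarrow>
          (LINT x|\<mu>. (cmod (q i x))\<^sup>2) \<le> (LINT x|\<mu>. (cmod (((v i \<circ> f) - proj n (v i \<circ> f)) x))\<^sup>2)"
        "AE \<omega> in M. \<forall>i<?s. \<forall>j<?s. (\<lambda>N. (dmd_error m n (\<lambda>i. X i \<omega>) N) $$ (i, j))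
          \<longlonglongrightarrow> - cnj (ip (q i) (v j)) / of_real (gr i)"
      then show thesis by (rule that)
    qed
    define F where "F = Matrix.mat ?s ?s (\<lambda>(i, j). - cnj (ip (q i) (v j)) / of_real (gr i) :: complex)"
    let ?S = "real (n + 1) ^ CARD('d) / sqrt (fact (n + 1)) * (2 * B1 * B2 / \<sigma>) ^ n"
    have entry: "cmod (F $$ (i, j)) \<le> c j * G i / gr i * ?S" if ij: "i < ?s" "j < ?s" for i j
    proof -
      let ?J = "hnorm ip (v i \<circ> f) * W * sqrt (exp ((B1 / \<sigma>)\<^sup>2)) / sqrt (fact (n + 1)) * (B1 / \<sigma>) ^ (n + 1)"
      have J: "0 \<le> ?J" using hnorm_nonneg[OF basis_comp_mem, of i] W0 B1_0 sigma_pos by simp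
      have "(LINT x|\<mu>. (cmod (q i x))\<^sup>2) \<le> ?J\<^sup>2"
        using order_trans[OF q_le[OF ij(1)] projection_error_L2[OF \<mu> prob B1 basis_comp_mem comp_cont W B1_0 W0]] .
      then have "cmod (ip (q i) (v j)) \<le> c j * (real (n + 1) ^ CARD('d) * (2 * B2) ^ n * ?J)"
        by (rule c(2)[OF q J])
      also have "\<dots> = c j * G i * ?S"
      proof -
        have "2 * B1 * B2 / \<sigma> = 2 * B2 * (B1 / \<sigma>)" by simp
        then have "(2 * B1 * B2 / \<sigma>) ^ n = (2 * B2) ^ n * (B1 / \<sigma>) ^ n"
          by (simp only: power_mult_distrib)
        moreover have "(B1 / \<sigma>) ^ (n + 1) = B1 / \<sigma> * (B1 / \<sigma>) ^ n" by simp
        moreover have "z * (A * P * (h / s * (b * Q))) = z * (h * b) * (A / s * (P * Q))"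
          for z A P h s b Q :: real by simp
        ultimately show ?thesis unfolding G_def by (simp only:)
      qed
      finally have "cmod (ip (q i) (v j)) / gr i \<le> c j * G i * ?S / gr i"
        using gr_pos[of i] by (intro divide_right_mono) auto
      moreover have "cmod (F $$ (i, j)) = cmod (ip (q i) (v j)) / gr i"
        using ij gr_pos[of i] by (simp add: F_def norm_divide)
      ultimately show ?thesis by (simp only: times_divide_eq_left)
    qed
    have S0: "0 \<le> ?S" using B1_0 B2_0 sigma_pos by simp
    have F: "F \<in> carrier_mat ?s ?s" by (simp add: F_def)
    have "frobenius_norm F \<le> (\<Sum>i<dim_row F. \<Sum>j<dim_col F. c j * G i / gr i * ?S)"
      by (rule frobenius_norm_le) (use entry F in auto)
    also have "\<dots> = T * ?S" by (simp only: T_def sum_distrib_right carrier_matD[OF F])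
    also have "\<dots> \<le> ?bound"
    proof -
      have "real (n + 1) ^ CARD('d) \<le> (2 * real n) ^ CARD('d)" using n by (intro power_mono) auto
      also have "\<dots> = 2 ^ CARD('d) * real n ^ CARD('d)" by (rule power_mult_distrib)
      \<comment> \<open>The exponent \<open>CARD('d)\<close> grows to \<open>m + CARD('d)\<close>
        because \<open>1 \<le> n\<close>.\<close>
      also have "\<dots> \<le> 2 ^ CARD('d) * real n ^ (m + CARD('d))"
        using n by (intro mult_left_mono power_increasing) auto
      finally have "T * real (n + 1) ^ CARD('d) \<le> T * (2 ^ CARD('d) * real n ^ (m + CARD('d)))"
        using T by (rule mult_left_mono)
      also have "\<dots> \<le> C * real n ^ (m + CARD('d))"
        unfolding C_def by (simp add: distrib_right)
      finally have "T * real (n + 1) ^ CARD('d) * ((2 * B1 * B2 / \<sigma>) ^ n / sqrt (fact (n + 1)))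
          \<le> C * real n ^ (m + CARD('d)) * ((2 * B1 * B2 / \<sigma>) ^ n / sqrt (fact (n + 1)))"
        by (rule mult_right_mono) (use B1_0 B2_0 sigma_pos in simp)
      then show ?thesis by (simp del: fact_Suc)
    qed
    finally have F_le: "frobenius_norm F \<le> ?bound" .
    show "AE \<omega> in M. limsup (\<lambda>N. ereal (frobenius_norm (dmd_error m n (\<lambda>i. X i \<omega>) N))) \<le> ereal ?bound"
      using lim
    proof eventually_elim
      case (elim \<omega>)
      have "(\<lambda>N. frobenius_norm (dmd_error m n (\<lambda>i. X i \<omega>) N)) \<longlonglongrightarrow> frobenius_norm F"
        by (rule tendsto_frobenius_norm[OF _ F])
           (use elim in \<open>auto simp: F_def jet_dmd_def Let_def\<close>)
      then have "limsup (\<lambda>N. ereal (frobenius_norm (dmd_error m n (\<lambda>i. X i \<omega>) N))) = ereal (frobenius_norm F)"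
        by (intro lim_imp_Limsup tendsto_intros) auto
      then show ?case using F_le by simp
    qed
  qed
qed

end

text \<open>\<open>C\<close> is chosen after \<open>m\<close> and the basis but before
  \<open>n\<close>. At \<open>n = 0\<close> the factor \<open>real n ^ (m + CARD('d))\<close> would
  be 0, hence the condition \<open>1 \<le> n\<close>. The conditions on sample size and span refer
  to all large \<open>N\<close>, which are the ones a limsup sees.\<close>

theorem theorem6p13:
  fixes \<sigma> :: real
    and b p a r :: "real ^ 'd"
    and H :: "(real ^ 'd \<Rightarrow> complex) set"
    and ip :: "(real ^ 'd \<Rightarrow> complex) \<Rightarrow> (real ^ 'd \<Rightarrow> complex) \<Rightarrow> complex"
    and k :: "real ^ 'd \<Rightarrow> real ^ 'd \<Rightarrow> complex"
    and v :: "nat \<Rightarrow> real ^ 'd \<Rightarrow> complex"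
    and f :: "real ^ 'd \<Rightarrow> real ^ 'd"
    and \<rho> :: "real ^ 'd \<Rightarrow> real"
    and \<mu> :: "(real ^ 'd) measure"
    and M :: "'w measure"
    and X :: "nat \<Rightarrow> 'w \<Rightarrow> real ^ 'd"
    and m :: nat
    and B1 B2 :: real
  assumes sigma: "\<sigma> > 0"
    and kernel: "k = exp_kernel \<sigma> b \<or> k = gauss_kernel \<sigma>"
    and H: "rkhs H ip k"
    and f_smooth: "smooth f"
    and f_dense: "comp_densely_defined H ip f"
    and f_fix: "f p = p"
    and V_dom: "jet_space_all k p \<subseteq> comp_domain H f"
    and v_basis: "jet_basis ip k p v"
    and rho_meas: "\<rho> \<in> borel_measurable borel"
    and rho_nonneg: "\<And>x. \<rho> x \<ge> 0"
    and rho_supp: "compact (supp \<rho>)"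
    and mu_def: "\<mu> = density lborel (\<lambda>x. ennreal (\<rho> x))"
    and mu_prob: "prob_space \<mu>"
    and r_pos: "\<And>i. r $ i > 0"
    and rho_essinf: "essinf_on (rectangle a r) \<rho> > 0"
    and M_prob: "prob_space M"
    and X_indep: "prob_space.indep_vars M (\<lambda>_. borel) X UNIV"
    and X_law: "\<And>i. distr M borel (X i) = \<mu>"
    and B1_def: "B1 = (SUP x\<in>supp \<rho>. norm (x - p))"
    and B2_def: "B2 = (SUP i. 1 + \<bar>a $ i - p $ i\<bar> / r $ i)"
  shows "\<exists>C>0. \<forall>n. 1 \<le> n \<longrightarrow> m \<le> n \<longrightarrow>
    (\<forall>h\<in>jet_space k p n. h \<in> borel_measurable \<mu> \<and> integrable \<mu> (\<lambda>x. (cmod (h x))\<^sup>2)) \<longrightarrow>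
    (\<forall>g\<in>jet_space k p n. \<forall>h\<in>jet_space k p n. (AE x in \<mu>. g x = h x) \<longrightarrow> g = h) \<longrightarrow>
    (AE \<omega> in M.
      (\<forall>\<^sub>F N in sequentially. jet_dim k p n \<le> N \<and>
         cspan ((\<lambda>i. oproj ip (jet_space k p n) (k (X i \<omega>))) ` {..<N}) = jet_space k p n) \<longrightarrow>
      limsup (\<lambda>N. ereal (frobenius_norm
          (comp_adjoint_mat H ip k p v f m
           - jet_dmd ip k p v m n N (\<lambda>i. X i \<omega>) (\<lambda>i. f (X i \<omega>)))))
        \<le> ereal (C * real n ^ (m + CARD('d)) / sqrt (fact (n + 1)) * (2 * B1 * B2 / \<sigma>) ^ n))"
proof -
  obtain \<gamma> \<kappa> and \<beta> :: "real ^ 'd" where k_eq: "\<And>x y. k x y =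
    of_real (exp (\<gamma> + inner \<beta> (x - p) - \<kappa> * inner (x - p) (x - p))
      * exp (\<gamma> + inner \<beta> (y - p) - \<kappa> * inner (y - p) (y - p)) * exp (inner (x - p) (y - p) / \<sigma>\<^sup>2))"
    using kernel exp_kernel_weight[of \<sigma> b p] gauss_kernel_weight[of \<sigma> p] by metis
  define w where "w x = exp (\<gamma> + inner \<beta> (x - p) - \<kappa> * inner (x - p) (x - p))" for x
  have k_w: "k x y = of_real (w x * w y * exp (inner (x - p) (y - p) / \<sigma>\<^sup>2))" for x y
    unfolding w_def by (rule k_eq)
  have jet: "jet_space k p n = wpoly w p n" for n
    by (rule jet_space_eq_wpoly[OF w_def k_w sigma])
  have dom: "wpoly w p n \<subseteq> comp_domain H f" for n
    using V_dom unfolding jet_space_all_def jet by blast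
  interpret rkhs H ip k by (rule H)
  interpret jet_rkhs_comp H ip k w p \<sigma> v f
  proof unfold_locales
    \<comment> \<open>The domain of C_f is part of \<open>H\<close> by definition, so the hypothesis
      on jets also yields membership in \<open>H\<close>.\<close>
    show "wpoly w p n \<subseteq> H" for n using dom[of n] by (auto simp: comp_domain_def)
    show "continuous_on UNIV w" unfolding w_def[abs_def] by (intro continuous_intros)
  qed (use sigma k_w jet v_basis f_smooth f_fix f_dense dom in \<open>auto simp: w_def\<close>)
  interpret \<mu>: prob_space \<mu> by (rule mu_prob)
  have supp: "compactly_supported_measure \<mu> (supp \<rho>)"
  proof
    show "sets \<mu> = sets borel" by (simp add: mu_def)
    show "compact (supp \<rho>)" by (rule rho_supp)
    show "AE x in \<mu>. x \<in> supp \<rho>"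
      unfolding mu_def using rho_meas
      by (subst AE_density) (auto simp: supp_def intro!: AE_I2 subsetD[OF closure_subset])
  qed
  have rect: "rectangle a r \<in> sets borel" by (simp add: rectangle_eq_cbox)
  obtain \<epsilon> where \<epsilon>: "\<epsilon> > 0" "AE x in lborel. x \<in> rectangle a r \<longrightarrow> \<epsilon> \<le> \<rho> x"
    using essinf_on_lower_bound[OF rho_essinf rect] .
  have B1: "norm (x - p) \<le> B1" if "x \<in> supp \<rho>" for x
  proof -
    have "compact ((\<lambda>x. norm (x - p)) ` supp \<rho>)"
      by (intro compact_continuous_image continuous_intros rho_supp)
    then have "bdd_above ((\<lambda>x. norm (x - p)) ` supp \<rho>)"
      by (intro bounded_imp_bdd_above compact_imp_bounded)
    then show ?thesis unfolding B1_def using that by (rule cSUP_upper[rotated])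
  qed
  have B2: "1 + \<bar>a $ i - p $ i\<bar> / r $ i \<le> B2" for i
    unfolding B2_def by (rule cSUP_upper) (auto intro: bdd_above_finite)
  obtain C where C: "C > 0" "\<And>n. 1 \<le> n \<Longrightarrow> m \<le> n \<Longrightarrow>
    (\<forall>g\<in>wpoly w p n. (AE x in \<mu>. g x = 0) \<longrightarrow> g = 0) \<Longrightarrow>
    (AE \<omega> in M. limsup (\<lambda>N. ereal (frobenius_norm (dmd_error m n (\<lambda>i. X i \<omega>) N)))
        \<le> ereal (C * real n ^ (m + CARD('d)) / sqrt (fact (n + 1)) * (2 * B1 * B2 / \<sigma>) ^ n))"
    using limsup_error_bound[OF supp mu_def mu_prob rho_meas rho_nonneg r_pos B2 \<epsilon> B1 M_prob X_indep X_law, of m]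
    by blast
  show ?thesis
  proof (intro exI[of _ C] conjI allI impI C(1), goal_cases)
    case (1 n)
    \<comment> \<open>Injectivity is assumed for pairs of functions; it is applied to
      \<open>g\<close> and the zero function.\<close>
    have "g = 0" if g: "g \<in> wpoly w p n" "AE x in \<mu>. g x = 0" for g
    proof -
      have "0 \<in> jet_space k p n" unfolding jet by (rule cfun.subspace_0[OF subspace_wpoly])
      moreover have "AE x in \<mu>. g x = (0 :: real ^ 'd \<Rightarrow> complex) x" using g(2) by simp
      ultimately show ?thesis using 1(4) g(1) unfolding jet by blast
    qed
    then have "\<forall>g\<in>wpoly w p n. (AE x in \<mu>. g x = 0) \<longrightarrow> g = 0" by blast
    from C(2)[OF 1(1,2) this] show ?case by eventually_elim (rule impI)
  qed
qed

end
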